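(* Let $M^2\subset A^3$ be a smooth hyperbolic surface whose centroaffine metric is flat. Then, in a neighbourhood of every point at which the characteristic directions are three distinct real directions, the characteristic 3-web of $M^2$ is hexagonal.
   Context: Centroaffine surfaces: let $\mathbf r$ be the position vector in $\mathbb R^3$ of a smooth surface $M^2$, with $\mathbf r$ and its two first partial derivatives linearly independent. The centroaffine metric $M=g_{ij}du^idu^j$ is defined by $\mathbf r_{ij}=\tilde\Gamma^k_{ij}\mathbf r_k+g_{ij}\mathbf r$ (assumed nondegenerate). The surface is hyperbolic if $M$ is indefinite; then, locally, there are asymptotic coordinates $x,y$ (null coordinates of $M$) in which $M=2e^u\,dx\,dy$ and $$\mathbf r_{xx}=(a+u_x)\mathbf r_x+p\,\mathbf r_y,\qquad \mathbf r_{xy}=b\,\mathbf r_x+a\,\mathbf r_y+e^u\,\mathbf r,\qquad \mathbf r_{yy}=q\,\mathbf r_x+(b+u_y)\mathbf r_y,$$ where $u,a,b,p,q$ are smooth functions of $x,y$. The compatibility conditions are $$a_y=b_x,\quad a_x-p_y=au_x+pu_y,\quad b_y-q_x=qu_x+bu_y,\quad pq-ab=e^u(K+1),$$ where $K=-e^{-u}u_{xy}$ is the Gaussian curvature of $M$; the centroaffine metric is flat if $K=0$. The centroaffine cubic form and the Chebyshev covector are $$C=e^u(p\,dx^3+3a\,dx^2dy+3b\,dx\,dy^2+q\,dy^3),\qquad T=a\,dx+b\,dy,$$ so that $C-2TM=e^u(p\,dx^3-a\,dx^2dy-b\,dx\,dy^2+q\,dy^3)$. The characteristic directions are the directions conjugate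 (i.e. orthogonal with respect to $M$) to the zero directions of $C-2TM$; equivalently, they are the zero directions of $$p\,dx^3+a\,dx^2dy-b\,dx\,dy^2-q\,dy^3=0 .$$ Where this cubic has three distinct real zero directions, its integral curves form three families of curves (three pairwise transversal one-dimensional foliations), called the characteristic 3-web. A 3-web on a surface (three pairwise transversal one-dimensional foliations) is hexagonal if its Blaschke curvature 2-form vanishes; equivalently, if near every point there are local coordinates $(\xi,\eta)$ in which the three foliations are given by $d\xi=0$, $d\eta=0$ and $d\xi-d\eta=0$. *)

theory Defs
  imports "HOL-Analysis.Analysis"
begin

section \<open>Partial derivatives and smooth functions of two variables\<close>

definition pd :: "2 \<Rightarrow> (real^2 \<Rightarrow> 'a::real_normed_vector) \<Rightarrow> real^2 \<Rightarrow> 'a" where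
  "pd i f s = frechet_derivative f (at s) (axis i 1)"

text \<open>The predicate below is only used for open sets.\<close>

primrec Ck_on :: "nat \<Rightarrow> (real^2) set \<Rightarrow> (real^2 \<Rightarrow> 'a::real_normed_vector) \<Rightarrow> bool" where
  "Ck_on 0 U f \<longleftrightarrow> continuous_on U f"
| "Ck_on (Suc k) U f \<longleftrightarrow> (\<forall>s\<in>U. f differentiable at s) \<and> (\<forall>i. Ck_on k U (pd i f))"

definition smooth_on :: "(real^2) set \<Rightarrow> (real^2 \<Rightarrow> 'a::real_normed_vector) \<Rightarrow> bool" where
  "smooth_on U f \<longleftrightarrow> (\<forall>k. Ck_on k U f)"


section \<open>Two-dimensional pseudo-Riemannian metrics\<close>

definition metric_form :: "(real^2 \<Rightarrow> real^2^2) \<Rightarrow> real^2 \<Rightarrow> real^2 \<Rightarrow> real^2 \<Rightarrow> real" where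
  "metric_form G s v w = (\<Sum>i\<in>UNIV. \<Sum>j\<in>UNIV. G s $ i $ j * v $ i * w $ j)"

text \<open>\<open>levi_civita G s k i j\<close> is the Christoffel symbol with upper index \<open>k\<close> and lower
  indices \<open>i\<close>, \<open>j\<close>.\<close>

definition levi_civita :: "(real^2 \<Rightarrow> real^2^2) \<Rightarrow> real^2 \<Rightarrow> 2 \<Rightarrow> 2 \<Rightarrow> 2 \<Rightarrow> real" where
  "levi_civita G s k i j = (\<Sum>l\<in>UNIV. matrix_inv (G s) $ k $ l *
     (pd i (\<lambda>t. G t $ j $ l) s + pd j (\<lambda>t. G t $ i $ l) s - pd l (\<lambda>t. G t $ i $ j) s)) / 2"

text \<open>\<open>riemann G s l k i j\<close> is the \<open>l\<close>-th component of \<open>R(\<partial>\<^sub>i, \<partial>\<^sub>j)\<partial>\<^sub>k\<close>.\<close>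

definition riemann :: "(real^2 \<Rightarrow> real^2^2) \<Rightarrow> real^2 \<Rightarrow> 2 \<Rightarrow> 2 \<Rightarrow> 2 \<Rightarrow> 2 \<Rightarrow> real" where
  "riemann G s l k i j =
     pd i (\<lambda>t. levi_civita G t l j k) s - pd j (\<lambda>t. levi_civita G t l i k) s
     + (\<Sum>m\<in>UNIV. levi_civita G s l i m * levi_civita G s m j k
                - levi_civita G s l j m * levi_civita G s m i k)"

definition gauss_curvature :: "(real^2 \<Rightarrow> real^2^2) \<Rightarrow> real^2 \<Rightarrow> real" where
  "gauss_curvature G s = (\<Sum>l\<in>UNIV. G s $ 1 $ l * riemann G s l 2 1 2) / det (G s)"


section \<open>Centroaffine surfaces\<close>

text \<open>The surface is given by its position vector \<open>r\<close> in arbitrary local coordinates,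
  ranging over an open set \<open>U\<close>.\<close>

definition gauss_formula ::
  "(real^2 \<Rightarrow> real^3) \<Rightarrow> real^2 \<Rightarrow> 2 \<Rightarrow> 2 \<Rightarrow> (2 \<Rightarrow> real) \<Rightarrow> real \<Rightarrow> bool" where
  "gauss_formula r s i j \<Gamma> g \<longleftrightarrow>
     pd j (pd i r) s = (\<Sum>k\<in>UNIV. \<Gamma> k *\<^sub>R pd k r s) + g *\<^sub>R r s"

text \<open>The descriptions are well defined wherever \<open>r\<close> and its first partial derivatives are
  linearly independent.\<close>

definition ca_metric :: "(real^2 \<Rightarrow> real^3) \<Rightarrow> real^2 \<Rightarrow> real^2^2" where
  "ca_metric r s = (\<chi> i j. THE g. \<exists>\<Gamma>. gauss_formula r s i j \<Gamma> g)"

definition ca_connection :: "(real^2 \<Rightarrow> real^3) \<Rightarrow> real^2 \<Rightarrow> 2 \<Rightarrow> 2 \<Rightarrow> 2 \<Rightarrow> real" where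
  "ca_connection r s k i j = (THE \<Gamma>. \<exists>g. gauss_formula r s i j \<Gamma> g) k"

definition centroaffine_surface :: "(real^2 \<Rightarrow> real^3) \<Rightarrow> (real^2) set \<Rightarrow> bool" where
  "centroaffine_surface r U \<longleftrightarrow> open U \<and> smooth_on U r \<and>
     (\<forall>s\<in>U. \<forall>c0 c1 c2. c0 *\<^sub>R r s + c1 *\<^sub>R pd 1 r s + c2 *\<^sub>R pd 2 r s = 0
        \<longrightarrow> c0 = 0 \<and> c1 = 0 \<and> c2 = 0) \<and>
     (\<forall>s\<in>U. det (ca_metric r s) \<noteq> 0)"

definition hyperbolic_surface :: "(real^2 \<Rightarrow> real^3) \<Rightarrow> (real^2) set \<Rightarrow> bool" where
  "hyperbolic_surface r U \<longleftrightarrow> centroaffine_surface r U \<and>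
     (\<forall>s\<in>U. (\<exists>v. metric_form (ca_metric r) s v v > 0) \<and>
            (\<exists>v. metric_form (ca_metric r) s v v < 0))"

definition flat_metric :: "(real^2 \<Rightarrow> real^3) \<Rightarrow> (real^2) set \<Rightarrow> bool" where
  "flat_metric r U \<longleftrightarrow> (\<forall>s\<in>U. gauss_curvature (ca_metric r) s = 0)"

text \<open>The cubic form and the Chebyshev covector in arbitrary coordinates: the difference tensor
  of the centroaffine connection and the Levi-Civita connection of the metric with its upper index
  lowered, and half of the trace of that tensor.  In asymptotic coordinates they become
  \<open>e\<^sup>u (p dx\<^sup>3 + 3a dx\<^sup>2dy + 3b dx dy\<^sup>2 + q dy\<^sup>3)\<close> and \<open>a dx + b dy\<close>; see the theorem
  \<open>asymptotic_coordinates\<close> below.\<close>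

definition difference_tensor :: "(real^2 \<Rightarrow> real^3) \<Rightarrow> real^2 \<Rightarrow> 2 \<Rightarrow> 2 \<Rightarrow> 2 \<Rightarrow> real" where
  "difference_tensor r s k i j = ca_connection r s k i j - levi_civita (ca_metric r) s k i j"

definition cubic_form :: "(real^2 \<Rightarrow> real^3) \<Rightarrow> real^2 \<Rightarrow> real^2 \<Rightarrow> real" where
  "cubic_form r s v = (\<Sum>i\<in>UNIV. \<Sum>j\<in>UNIV. \<Sum>k\<in>UNIV. \<Sum>l\<in>UNIV.
     ca_metric r s $ k $ l * difference_tensor r s l i j * v $ i * v $ j * v $ k)"

definition chebyshev :: "(real^2 \<Rightarrow> real^3) \<Rightarrow> real^2 \<Rightarrow> real^2 \<Rightarrow> real" where
  "chebyshev r s v = (\<Sum>i\<in>UNIV. \<Sum>k\<in>UNIV. difference_tensor r s k k i * v $ i) / 2"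

definition characteristic_vector :: "(real^2 \<Rightarrow> real^3) \<Rightarrow> real^2 \<Rightarrow> real^2 \<Rightarrow> bool" where
  "characteristic_vector r s v \<longleftrightarrow> v \<noteq> 0 \<and>
     (\<exists>w. w \<noteq> 0 \<and> metric_form (ca_metric r) s v w = 0 \<and>
          cubic_form r s w - 2 * chebyshev r s w * metric_form (ca_metric r) s w w = 0)"

text \<open>A direction is a one-dimensional subspace of the parameter plane.\<close>

definition characteristic_directions ::
  "(real^2 \<Rightarrow> real^3) \<Rightarrow> real^2 \<Rightarrow> (real^2) set set" where
  "characteristic_directions r s = {span {v} | v. characteristic_vector r s v}"


section \<open>3-webs\<close>

definition ker_differential :: "(real^2 \<Rightarrow> real) \<Rightarrow> real^2 \<Rightarrow> (real^2) set" where
  "ker_differential f s = {v. frechet_derivative f (at s) v = 0}"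

text \<open>A foliation is represented by the field of its tangent lines; its leaves are locally the
  level curves of \<open>f\<close>.\<close>

definition foliation :: "(real^2) set \<Rightarrow> (real^2 \<Rightarrow> (real^2) set) \<Rightarrow> bool" where
  "foliation V L \<longleftrightarrow> (\<forall>s\<in>V. \<exists>W f. open W \<and> s \<in> W \<and> W \<subseteq> V \<and> smooth_on W f \<and>
     (\<forall>t\<in>W. frechet_derivative f (at t) \<noteq> (\<lambda>v. 0) \<and> L t = ker_differential f t))"

definition three_web :: "(real^2) set \<Rightarrow> (3 \<Rightarrow> real^2 \<Rightarrow> (real^2) set) \<Rightarrow> bool" where
  "three_web V L \<longleftrightarrow> open V \<and> (\<forall>i. foliation V (L i)) \<and>
     (\<forall>s\<in>V. \<forall>i j. i \<noteq> j \<longrightarrow> L i s \<noteq> L j s)"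

definition local_coordinates ::
  "(real^2) set \<Rightarrow> (real^2 \<Rightarrow> real) \<Rightarrow> (real^2 \<Rightarrow> real) \<Rightarrow> bool" where
  "local_coordinates W \<xi> \<eta> \<longleftrightarrow> open W \<and> smooth_on W \<xi> \<and> smooth_on W \<eta> \<and>
     inj_on (\<lambda>s. (\<xi> s, \<eta> s)) W \<and>
     (\<forall>s\<in>W. pd 1 \<xi> s * pd 2 \<eta> s - pd 2 \<xi> s * pd 1 \<eta> s \<noteq> 0)"

definition hexagonal :: "(real^2) set \<Rightarrow> (3 \<Rightarrow> real^2 \<Rightarrow> (real^2) set) \<Rightarrow> bool" where
  "hexagonal V L \<longleftrightarrow> three_web V L \<and>
     (\<forall>s\<in>V. \<exists>W \<xi> \<eta>. s \<in> W \<and> W \<subseteq> V \<and> local_coordinates W \<xi> \<eta> \<and>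
        (\<forall>t\<in>W. L 1 t = ker_differential \<xi> t \<and> L 2 t = ker_differential \<eta> t \<and>
                L 3 t = ker_differential (\<lambda>x. \<xi> x - \<eta> x) t))"

definition characteristic_web ::
  "(real^2 \<Rightarrow> real^3) \<Rightarrow> (real^2) set \<Rightarrow> (3 \<Rightarrow> real^2 \<Rightarrow> (real^2) set) \<Rightarrow> bool" where
  "characteristic_web r V L \<longleftrightarrow> three_web V L \<and>
     (\<forall>s\<in>V. characteristic_directions r s = range (\<lambda>i. L i s))"


section \<open>Asymptotic coordinates\<close>

lemma gauss_formula_unique:
  assumes ind: "\<And>c0 c1 c2. c0 *\<^sub>R r s + c1 *\<^sub>R pd 1 r s + c2 *\<^sub>R pd 2 r s = 0
      \<Longrightarrow> c0 = 0 \<and> c1 = 0 \<and> c2 = 0"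
    and 1: "gauss_formula r s i j \<Gamma> g" and 2: "gauss_formula r s i j \<Gamma>' g'"
  shows "\<Gamma>' = \<Gamma>" "g' = g"
proof -
  have "(g' - g) *\<^sub>R r s + (\<Gamma>' 1 - \<Gamma> 1) *\<^sub>R pd 1 r s + (\<Gamma>' 2 - \<Gamma> 2) *\<^sub>R pd 2 r s = 0"
    using 1 2 unfolding gauss_formula_def by (simp add: sum_2 algebra_simps)
  from ind[OF this] show "\<Gamma>' = \<Gamma>" "g' = g"
    by (auto simp: fun_eq_iff forall_2)
qed

lemma gauss_formula_eq:
  assumes ind: "\<And>c0 c1 c2. c0 *\<^sub>R r s + c1 *\<^sub>R pd 1 r s + c2 *\<^sub>R pd 2 r s = 0
      \<Longrightarrow> c0 = 0 \<and> c1 = 0 \<and> c2 = 0"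
    and 1: "gauss_formula r s i j \<Gamma> g"
  shows "ca_connection r s k i j = \<Gamma> k" "ca_metric r s $ i $ j = g"
proof -
  have "(THE \<Gamma>. \<exists>g. gauss_formula r s i j \<Gamma> g) = \<Gamma>"
    by (rule the_equality) (use 1 gauss_formula_unique[OF ind 1] in blast)+
  then show "ca_connection r s k i j = \<Gamma> k" by (simp add: ca_connection_def)
  have "(THE g. \<exists>\<Gamma>. gauss_formula r s i j \<Gamma> g) = g"
    by (rule the_equality) (use 1 gauss_formula_unique[OF ind 1] in blast)+
  then show "ca_metric r s $ i $ j = g" by (simp add: ca_metric_def)
qed

lemma pd_cong_open:
  assumes "open U" "s \<in> U" "\<And>t. t \<in> U \<Longrightarrow> f t = g t"
  shows "pd i f s = pd i g s"
proof -
  have "(f has_derivative D) (at s) \<longleftrightarrow> (g has_derivative D) (at s)" for D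
    using assms has_derivative_transform_within_open[of f D s UNIV U g]
      has_derivative_transform_within_open[of g D s UNIV U f] by auto
  then show ?thesis by (simp add: pd_def frechet_derivative_def)
qed

lemma pd_const: "pd i (\<lambda>t. c) s = 0"
  by (simp add: pd_def)

lemma pd_exp:
  fixes u :: "real^2 \<Rightarrow> real"
  assumes "u differentiable at s"
  shows "pd i (\<lambda>t. exp (u t)) s = exp (u s) * pd i u s"
proof -
  have "(u has_derivative frechet_derivative u (at s)) (at s)"
    using assms frechet_derivative_works by blast
  from DERIV_exp[THEN DERIV_compose_FDERIV, OF this]
  have "((\<lambda>t. exp (u t)) has_derivative (\<lambda>h. exp (u s) * frechet_derivative u (at s) h)) (at s)"
    by (simp add: mult.commute)
  then show ?thesis by (simp add: pd_def frechet_derivative_at[symmetric])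
qed

lemma matrix_inv_offdiag:
  fixes A :: "real^2^2"
  assumes "A $ 1 $ 1 = 0" "A $ 2 $ 2 = 0" "A $ 1 $ 2 = e" "A $ 2 $ 1 = e" "e \<noteq> 0"
  shows "matrix_inv A $ 1 $ 1 = 0 \<and> matrix_inv A $ 2 $ 2 = 0 \<and>
         matrix_inv A $ 1 $ 2 = 1/e \<and> matrix_inv A $ 2 $ 1 = 1/e"
proof -
  define B :: "real^2^2" where "B = (\<chi> i j. if i = j then 0 else 1/e)"
  have 12: "(1::2) \<noteq> 2" by simp
  have "A ** B = mat 1" "B ** A = mat 1"
    using assms 12 by (auto simp: matrix_matrix_mult_def mat_def vec_eq_iff sum_2 forall_2 B_def)
  moreover from this have "A ** matrix_inv A = mat 1"
    unfolding matrix_inv_def by (metis (mono_tags, lifting) someI_ex)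
  ultimately have "matrix_inv A = B" by (metis matrix_mul_assoc matrix_mul_lid matrix_mul_rid)
  then show ?thesis using 12 by (simp add: B_def)
qed

text \<open>Agreement with the classical formulas in null coordinates \<open>x = s $ 1\<close>, \<open>y = s $ 2\<close>.\<close>

theorem asymptotic_coordinates:
  fixes r :: "real^2 \<Rightarrow> real^3" and u a b p q :: "real^2 \<Rightarrow> real"
  assumes U: "open U"
    and ind: "\<And>s c0 c1 c2. s \<in> U \<Longrightarrow>
        c0 *\<^sub>R r s + c1 *\<^sub>R pd 1 r s + c2 *\<^sub>R pd 2 r s = 0 \<Longrightarrow> c0 = 0 \<and> c1 = 0 \<and> c2 = 0"
    and u: "\<And>s. s \<in> U \<Longrightarrow> u differentiable at s"
    and xx: "\<And>s. s \<in> U \<Longrightarrow> pd 1 (pd 1 r) s = (a s + pd 1 u s) *\<^sub>R pd 1 r s + p s *\<^sub>R pd 2 r s"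
    and xy: "\<And>s. s \<in> U \<Longrightarrow>
        pd 2 (pd 1 r) s = b s *\<^sub>R pd 1 r s + a s *\<^sub>R pd 2 r s + exp (u s) *\<^sub>R r s"
    and yx: "\<And>s. s \<in> U \<Longrightarrow> pd 1 (pd 2 r) s = pd 2 (pd 1 r) s"
    and yy: "\<And>s. s \<in> U \<Longrightarrow> pd 2 (pd 2 r) s = q s *\<^sub>R pd 1 r s + (b s + pd 2 u s) *\<^sub>R pd 2 r s"
    and s: "s \<in> U"
  shows "metric_form (ca_metric r) s v v = 2 * exp (u s) * v $ 1 * v $ 2"
    and "gauss_curvature (ca_metric r) s = - exp (- u s) * pd 1 (pd 2 u) s"
    and "cubic_form r s v = exp (u s) * (p s * (v $ 1)^3 + 3 * a s * (v $ 1)^2 * v $ 2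
           + 3 * b s * v $ 1 * (v $ 2)^2 + q s * (v $ 2)^3)"
    and "chebyshev r s v = a s * v $ 1 + b s * v $ 2"
    and "characteristic_vector r s v \<longleftrightarrow> v \<noteq> 0 \<and>
           p s * (v $ 1)^3 + a s * (v $ 1)^2 * v $ 2 - b s * v $ 1 * (v $ 2)^2
             - q s * (v $ 2)^3 = 0"
proof -
  let ?G = "ca_metric r"
  define e where "e = exp (u s)"
  have e: "e > 0" by (simp add: e_def)
  define vec where "vec c d = (\<lambda>k::2. if k = 1 then c else d)" for c d :: real
  have [simp]: "vec c d 1 = c" "vec c d 2 = d" for c d by (simp_all add: vec_def)
  have F: "gauss_formula r t 1 1 (vec (a t + pd 1 u t) (p t)) 0"
    "gauss_formula r t 1 2 (vec (b t) (a t)) (exp (u t))"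
    "gauss_formula r t 2 1 (vec (b t) (a t)) (exp (u t))"
    "gauss_formula r t 2 2 (vec (q t) (b t + pd 2 u t)) 0" if "t \<in> U" for t
    using xx[OF that] xy[OF that] yx[OF that] yy[OF that]
    by (simp_all add: gauss_formula_def sum_2)
  have G: "?G t $ 1 $ 1 = 0" "?G t $ 1 $ 2 = exp (u t)" "?G t $ 2 $ 1 = exp (u t)" "?G t $ 2 $ 2 = 0"
    if "t \<in> U" for t
    using gauss_formula_eq(2)[OF ind[OF that] F(1)[OF that]]
      gauss_formula_eq(2)[OF ind[OF that] F(2)[OF that]]
      gauss_formula_eq(2)[OF ind[OF that] F(3)[OF that]]
      gauss_formula_eq(2)[OF ind[OF that] F(4)[OF that]] by simp_all
  have C: "ca_connection r s k 1 1 = vec (a s + pd 1 u s) (p s) k"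
    "ca_connection r s k 1 2 = vec (b s) (a s) k"
    "ca_connection r s k 2 1 = vec (b s) (a s) k"
    "ca_connection r s k 2 2 = vec (q s) (b s + pd 2 u s) k" for k
    using gauss_formula_eq(1)[OF ind[OF s] F(1)[OF s]]
      gauss_formula_eq(1)[OF ind[OF s] F(2)[OF s]]
      gauss_formula_eq(1)[OF ind[OF s] F(3)[OF s]]
      gauss_formula_eq(1)[OF ind[OF s] F(4)[OF s]] by simp_all
  have P: "pd i (\<lambda>t. ?G t $ 1 $ 1) t = 0" "pd i (\<lambda>t. ?G t $ 2 $ 2) t = 0"
    "pd i (\<lambda>t. ?G t $ 1 $ 2) t = exp (u t) * pd i u t"
    "pd i (\<lambda>t. ?G t $ 2 $ 1) t = exp (u t) * pd i u t" if "t \<in> U" for i t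
    using pd_cong_open[OF U that, of "\<lambda>t. ?G t $ 1 $ 1" "\<lambda>t. 0"]
      pd_cong_open[OF U that, of "\<lambda>t. ?G t $ 2 $ 2" "\<lambda>t. 0"]
      pd_cong_open[OF U that, of "\<lambda>t. ?G t $ 1 $ 2" "\<lambda>t. exp (u t)"]
      pd_cong_open[OF U that, of "\<lambda>t. ?G t $ 2 $ 1" "\<lambda>t. exp (u t)"] G pd_exp[OF u[OF that]]
    by (simp_all add: pd_const)
  have L: "levi_civita ?G t 1 1 1 = pd 1 u t" "levi_civita ?G t 2 2 2 = pd 2 u t"
    "levi_civita ?G t 1 1 2 = 0" "levi_civita ?G t 1 2 1 = 0" "levi_civita ?G t 1 2 2 = 0"
    "levi_civita ?G t 2 1 2 = 0" "levi_civita ?G t 2 2 1 = 0" "levi_civita ?G t 2 1 1 = 0"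
    if "t \<in> U" for t
    using matrix_inv_offdiag[of "?G t" "exp (u t)"] G[OF that] P[OF that]
    by (simp_all add: levi_civita_def sum_2)
  have "pd 1 (\<lambda>t. levi_civita ?G t 2 2 2) s = pd 1 (pd 2 u) s"
    "pd 2 (\<lambda>t. levi_civita ?G t 2 1 2) s = 0"
    using pd_cong_open[OF U s, of "\<lambda>t. levi_civita ?G t 2 2 2" "pd 2 u"]
      pd_cong_open[OF U s, of "\<lambda>t. levi_civita ?G t 2 1 2" "\<lambda>t. 0"] L
    by (simp_all add: pd_const)
  then have R: "riemann ?G s 2 2 1 2 = pd 1 (pd 2 u) s"
    using L[OF s] by (simp add: riemann_def sum_2)
  show "gauss_curvature ?G s = - exp (- u s) * pd 1 (pd 2 u) s"
    using R G[OF s] by (simp add: gauss_curvature_def sum_2 det_2 exp_minus field_simps)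
  show M: "metric_form ?G s v v = 2 * exp (u s) * v $ 1 * v $ 2" for v
    using G[OF s] by (simp add: metric_form_def sum_2)
  show K: "cubic_form r s v = exp (u s) * (p s * (v $ 1)^3 + 3 * a s * (v $ 1)^2 * v $ 2
           + 3 * b s * v $ 1 * (v $ 2)^2 + q s * (v $ 2)^3)" for v
    using G[OF s] C L[OF s]
    by (simp add: cubic_form_def difference_tensor_def sum_2 power2_eq_square power3_eq_cube
        algebra_simps)
  show T: "chebyshev r s v = a s * v $ 1 + b s * v $ 2" for v
    using C L[OF s] by (simp add: chebyshev_def difference_tensor_def sum_2 algebra_simps)
  let ?Q = "\<lambda>v::real^2. p s * (v $ 1)^3 + a s * (v $ 1)^2 * v $ 2 - b s * v $ 1 * (v $ 2)^2
             - q s * (v $ 2)^3"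
  have N: "metric_form ?G s v w = e * (v $ 1 * w $ 2 + v $ 2 * w $ 1)" for v w
    using G[OF s] by (simp add: metric_form_def sum_2 e_def algebra_simps)
  have D: "cubic_form r s w - 2 * chebyshev r s w * metric_form ?G s w w
      = e * (p s * (w $ 1)^3 - a s * (w $ 1)^2 * w $ 2 - b s * w $ 1 * (w $ 2)^2 + q s * (w $ 2)^3)"
    for w
    unfolding K M T e_def by (simp add: power2_eq_square power3_eq_cube algebra_simps)
  show "characteristic_vector r s v \<longleftrightarrow> v \<noteq> 0 \<and> ?Q v = 0"
  proof (cases "v = 0")
    case False
    let ?w = "vector [v $ 1, - v $ 2] :: real^2"
    have w: "?w \<noteq> 0" using False by (auto simp: vec_eq_iff forall_2 vector_2)
    have Dw: "cubic_form r s ?w - 2 * chebyshev r s ?w * metric_form ?G s ?w ?w = e * ?Q v"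
      unfolding D by (simp add: vector_2 power2_eq_square power3_eq_cube algebra_simps)
    have "metric_form ?G s v ?w = 0" unfolding N by (simp add: vector_2)
    moreover have "?Q v = 0" if w0: "w \<noteq> 0" and o: "metric_form ?G s v w = 0"
      and z: "cubic_form r s w - 2 * chebyshev r s w * metric_form ?G s w w = 0" for w
    proof -
      have o': "v $ 1 * w $ 2 + v $ 2 * w $ 1 = 0" using o e unfolding N by simp
      have "\<exists>c. c \<noteq> 0 \<and> w $ 1 = c * v $ 1 \<and> w $ 2 = - c * v $ 2"
      proof (cases "v $ 1 = 0")
        case True
        then have "v $ 2 \<noteq> 0" using False by (auto simp: vec_eq_iff forall_2)
        then show ?thesis using True o' w0
          by (intro exI[of _ "- w $ 2 / v $ 2"]) (auto simp: vec_eq_iff forall_2)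
      next
        case v1: False
        then have "w $ 2 = - (w $ 1 / v $ 1) * v $ 2" using o' by (simp add: field_simps)
        then show ?thesis using v1 w0
          by (intro exI[of _ "w $ 1 / v $ 1"]) (auto simp: vec_eq_iff forall_2)
      qed
      then obtain c where c: "c \<noteq> 0" "w $ 1 = c * v $ 1" "w $ 2 = - c * v $ 2" by blast
      have "e * c^3 * ?Q v = 0"
        using z unfolding D c by (simp add: power2_eq_square power3_eq_cube algebra_simps)
      then show ?thesis using e c(1) by simp
    qed
    ultimately show ?thesis using False w Dw e
      unfolding characteristic_vector_def by (metis mult_zero_right)
  qed (simp add: characteristic_vector_def)
qed

end

(* In the algebra R + R^2 with unit e and product v * w = C(v, w) + g(v, w) e, where g is the
   centroaffine metric and C the difference tensor, the Gauss equation together with flatness of g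
   says that the product is associative and that the covariant derivative of C is totally symmetric.
   A characteristic vector v is one for which 1, v, v * v are dependent, and three characteristic
   directions yield three characters e + w |-> omega_i(w).  Differentiating
   omega_i omega_i = omega_i(C) + g shows that the 1-forms omega_i are closed, and the characteristic
   directions are the kernels of the differences omega_i - omega_j, which sum to zero cyclically.
   All of this works in arbitrary coordinates; asymptotic ones are not needed. *)

theory Submission
  imports Defs
begin

section \<open>Calculus of smooth functions\<close>

text \<open>For a characteristic v let c(v) be the eigenvalue that multiplication by v, taken modulo
  e, has on the quotient of the plane by v. Then v - c(v) e is a common eigenvector of all
  multiplications, and its eigenvalues form the character omega. For two characteristic directions
  the product of the eigenvectors is a multiple of each of them, hence zero; this gives omega_i(v_j)
  = c(v_j) for i different from j and explains why omega_i - omega_j vanishes on the third direction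
  v_k. The obstacle is an eigenvector of square zero, that is omega_i(v_i) = c(v_i). In the presence
  of three directions this would force g(x, y) = - omega_i(x) omega_i(y), a degenerate form. Its
  exclusion is used four times: the differences of characters do not vanish identically, there are
  at most three directions, each direction is a simple root of the characteristic cubic and
  therefore depends smoothly on the point, and in the proof that omega_i is closed the factor
  omega_i(v_i) - c(v_i) can be cancelled.\<close>

lemma has_derivative_pd:
  fixes f :: "real^2 \<Rightarrow> 'a::real_normed_vector"
  assumes "f differentiable at s"
  shows "(f has_derivative (\<lambda>h. (h$1) *\<^sub>R pd 1 f s + (h$2) *\<^sub>R pd 2 f s)) (at s)"
proof -
  have D: "(f has_derivative frechet_derivative f (at s)) (at s)"
    using assms frechet_derivative_works by blast
  then interpret linear "frechet_derivative f (at s)"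
    by (rule has_derivative_linear)
  have "frechet_derivative f (at s) h = (h$1) *\<^sub>R pd 1 f s + (h$2) *\<^sub>R pd 2 f s" for h
  proof -
    have "h = (h$1) *\<^sub>R axis 1 1 + (h$2) *\<^sub>R axis 2 1"
      by (simp add: vec_eq_iff forall_2 axis_def)
    then have "frechet_derivative f (at s) h
        = frechet_derivative f (at s) ((h$1) *\<^sub>R axis 1 1 + (h$2) *\<^sub>R axis 2 1)"
      by simp
    then show ?thesis by (simp add: pd_def add scale)
  qed
  then have "frechet_derivative f (at s) = (\<lambda>h. (h$1) *\<^sub>R pd 1 f s + (h$2) *\<^sub>R pd 2 f s)"
    by blast
  with D show ?thesis by simp
qed

lemma pd_eqI:
  assumes "(f has_derivative D) (at s)"
  shows "pd i f s = D (axis i 1)"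
  unfolding pd_def using frechet_derivative_at[OF assms] by simp

lemma pd_bounded_linear:
  assumes "bounded_linear l" "f differentiable at s"
  shows "pd i (\<lambda>t. l (f t)) s = l (pd i f s)"
proof -
  have "(f has_derivative frechet_derivative f (at s)) (at s)"
    using assms(2) frechet_derivative_works by blast
  from pd_eqI[OF bounded_linear.has_derivative[OF assms(1) this]] show ?thesis
    by (simp add: pd_def)
qed

lemma pd_vec_nth:
  fixes f :: "real^2 \<Rightarrow> real^'n"
  assumes "f differentiable at s"
  shows "pd i (\<lambda>t. f t $ j) s = pd i f s $ j"
  by (rule pd_bounded_linear[OF bounded_linear_vec_nth assms])

lemma pd_add:
  assumes "f differentiable at s" "g differentiable at s"
  shows "pd i (\<lambda>t. f t + g t) s = pd i f s + pd i g s"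
  using pd_eqI[OF has_derivative_add[OF assms[unfolded frechet_derivative_works]]]
  by (simp add: pd_def)

lemma pd_minus:
  assumes "f differentiable at s"
  shows "pd i (\<lambda>t. - f t) s = - pd i f s"
  using pd_eqI[OF has_derivative_minus[OF assms[unfolded frechet_derivative_works]]]
  by (simp add: pd_def)

lemma pd_diff:
  assumes "f differentiable at s" "g differentiable at s"
  shows "pd i (\<lambda>t. f t - g t) s = pd i f s - pd i g s"
  using pd_eqI[OF has_derivative_diff[OF assms[unfolded frechet_derivative_works]]]
  by (simp add: pd_def)

lemma pd_scaleR:
  fixes f :: "real^2 \<Rightarrow> real" and g :: "real^2 \<Rightarrow> 'a::real_normed_vector"
  assumes "f differentiable at s" "g differentiable at s"
  shows "pd i (\<lambda>t. f t *\<^sub>R g t) s = pd i f s *\<^sub>R g s + f s *\<^sub>R pd i g s"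
  using pd_eqI[OF has_derivative_scaleR[OF assms[unfolded frechet_derivative_works]]]
  by (simp add: pd_def)

lemma pd_mult:
  fixes f g :: "real^2 \<Rightarrow> real"
  assumes "f differentiable at s" "g differentiable at s"
  shows "pd i (\<lambda>t. f t * g t) s = pd i f s * g s + f s * pd i g s"
  using pd_scaleR[OF assms] by simp

lemma pd_inverse:
  fixes f :: "real^2 \<Rightarrow> real"
  assumes "f differentiable at s" "f s \<noteq> 0"
  shows "pd i (\<lambda>t. inverse (f t)) s = - (pd i f s * (inverse (f s) * inverse (f s)))"
  using pd_eqI[OF Deriv.has_derivative_inverse[OF assms(2) assms(1)[unfolded frechet_derivative_works]]]
  by (simp add: pd_def)

lemma differentiable_cong_open:
  assumes "open U" "s \<in> U" "\<And>t. t \<in> U \<Longrightarrow> f t = g t" "f differentiable at s"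
  shows "g differentiable at s"
proof -
  obtain D where "(f has_derivative D) (at s)" using assms(4) by (auto simp: differentiable_def)
  from has_derivative_transform_within_open[OF this assms(1,2), of g] assms(3)
  show ?thesis by (auto simp: differentiable_def)
qed

text \<open>The rules for \<open>pd\<close> hold only at points of differentiability, so in the
  inductions below a derivative agrees with its computed form only on \<open>U\<close>. Openness of
  \<open>U\<close> lets such an agreement pass to all higher derivatives.\<close>

lemma Ck_on_cong:
  assumes "open U" "\<And>t. t \<in> U \<Longrightarrow> f t = g t"
  shows "Ck_on k U f \<longleftrightarrow> Ck_on k U g"
proof -
  have "Ck_on k U f \<Longrightarrow> Ck_on k U g" if "\<And>t. t \<in> U \<Longrightarrow> f t = g t"
    for f g :: "real^2 \<Rightarrow> 'a"
    using that
  proof (induction k arbitrary: f g)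
    case 0
    then show ?case using continuous_on_cong[of U U f g] by simp
  next
    case (Suc k)
    have "g differentiable at s" if "s \<in> U" for s
      using differentiable_cong_open[OF assms(1) that Suc.prems(2)] Suc.prems(1) that by auto
    moreover have "Ck_on k U (pd i g)" for i
    proof (rule Suc.IH[of "pd i f"])
      show "pd i f t = pd i g t" if "t \<in> U" for t
        by (rule pd_cong_open[OF assms(1) that Suc.prems(2)])
    qed (use Suc.prems(1) in simp)
    ultimately show ?case by simp
  qed
  from this[of f g] this[of g f] assms(2) show ?thesis by auto
qed

lemma Ck_on_subset: "Ck_on k U f \<Longrightarrow> V \<subseteq> U \<Longrightarrow> Ck_on k V f"
  by (induction k arbitrary: f) (auto intro: continuous_on_subset)

lemma Ck_on_Suc_imp: "Ck_on (Suc k) U f \<Longrightarrow> Ck_on k U f"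
proof (induction k arbitrary: f)
  case 0
  then show ?case
    by (auto intro!: continuous_at_imp_continuous_on differentiable_imp_continuous_within)
next
  case (Suc k)
  then show ?case by simp
qed

lemma Ck_on_const: "Ck_on k U (\<lambda>t. c)"
proof (induction k arbitrary: c)
  case (Suc k)
  have "pd i (\<lambda>t. c) = (\<lambda>t. 0)" for i by (simp add: pd_const fun_eq_iff)
  with Suc show ?case by simp
qed simp

lemma Ck_on_add:
  assumes "open U"
  shows "Ck_on k U f \<Longrightarrow> Ck_on k U g \<Longrightarrow> Ck_on k U (\<lambda>t. f t + g t)"
proof (induction k arbitrary: f g)
  case (Suc k)
  have "Ck_on k U (pd i (\<lambda>t. f t + g t))" for i
    using Suc Ck_on_cong[OF assms, of "pd i (\<lambda>t. f t + g t)" "\<lambda>t. pd i f t + pd i g t" k]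
    by (simp add: pd_add)
  with Suc.prems show ?case by simp
qed (simp add: continuous_on_add)

lemma Ck_on_minus:
  assumes "open U"
  shows "Ck_on k U f \<Longrightarrow> Ck_on k U (\<lambda>t. - f t)"
proof (induction k arbitrary: f)
  case (Suc k)
  have "Ck_on k U (pd i (\<lambda>t. - f t))" for i
    using Suc Ck_on_cong[OF assms, of "pd i (\<lambda>t. - f t)" "\<lambda>t. - pd i f t" k]
    by (simp add: pd_minus)
  with Suc.prems show ?case by simp
qed (simp add: continuous_on_minus)

lemma Ck_on_scaleR:
  fixes f :: "real^2 \<Rightarrow> real" and g :: "real^2 \<Rightarrow> 'a::real_normed_vector"
  assumes "open U"
  shows "Ck_on k U f \<Longrightarrow> Ck_on k U g \<Longrightarrow> Ck_on k U (\<lambda>t. f t *\<^sub>R g t)"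
proof (induction k arbitrary: f g)
  case (Suc k)
  have "Ck_on k U f" "Ck_on k U g" using Suc.prems by (auto simp only: Ck_on_Suc_imp)
  then have "Ck_on k U (\<lambda>t. pd i f t *\<^sub>R g t + f t *\<^sub>R pd i g t)" for i
    using Suc by (intro Ck_on_add[OF assms] Suc.IH) auto
  then have "Ck_on k U (pd i (\<lambda>t. f t *\<^sub>R g t))" for i
    using Suc.prems
      Ck_on_cong[OF assms, of "pd i (\<lambda>t. f t *\<^sub>R g t)" "\<lambda>t. pd i f t *\<^sub>R g t + f t *\<^sub>R pd i g t" k]
    by (simp add: pd_scaleR)
  with Suc.prems show ?case by simp
qed (simp add: continuous_on_scaleR)

text \<open>The derivative of the reciprocal is a polynomial in the reciprocal itself and the
  derivative of \<open>f\<close>, so order k of the reciprocal yields order k + 1.\<close>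

lemma Ck_on_inverse:
  fixes f :: "real^2 \<Rightarrow> real"
  assumes "open U" "\<And>s. s \<in> U \<Longrightarrow> f s \<noteq> 0"
  shows "Ck_on k U f \<Longrightarrow> Ck_on k U (\<lambda>t. inverse (f t))"
proof (induction k)
  case (Suc k)
  note M = Ck_on_scaleR[OF assms(1), where 'a = real, unfolded real_scaleR_def]
  have "Ck_on k U (\<lambda>t. inverse (f t))" using Suc Ck_on_Suc_imp by blast
  then have "Ck_on k U (\<lambda>t. - (pd i f t * (inverse (f t) * inverse (f t))))" for i
    using Suc.prems by (intro Ck_on_minus[OF assms(1)] M) auto
  then have "Ck_on k U (pd i (\<lambda>t. inverse (f t)))" for i
    using Suc.prems assms Ck_on_cong[OF assms(1), of "pd i (\<lambda>t. inverse (f t))"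
        "\<lambda>t. - (pd i f t * (inverse (f t) * inverse (f t)))" k]
    by (simp add: pd_inverse)
  with Suc.prems assms(2) show ?case by (simp add: differentiable_inverse)
qed (use assms(2) in \<open>auto intro: continuous_on_inverse\<close>)

lemma smooth_on_const: "smooth_on U (\<lambda>t. c)"
  by (simp add: smooth_on_def Ck_on_const)

lemma smooth_on_add: "open U \<Longrightarrow> smooth_on U f \<Longrightarrow> smooth_on U g \<Longrightarrow> smooth_on U (\<lambda>t. f t + g t)"
  by (simp add: smooth_on_def Ck_on_add)

lemma smooth_on_minus: "open U \<Longrightarrow> smooth_on U f \<Longrightarrow> smooth_on U (\<lambda>t. - f t)"
  by (simp add: smooth_on_def Ck_on_minus)

lemma smooth_on_diff: "open U \<Longrightarrow> smooth_on U f \<Longrightarrow> smooth_on U g \<Longrightarrow> smooth_on U (\<lambda>t. f t - g t)"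
  using smooth_on_add[OF _ _ smooth_on_minus, of U f g] by simp

lemma smooth_on_mult:
  fixes f g :: "real^2 \<Rightarrow> real"
  shows "open U \<Longrightarrow> smooth_on U f \<Longrightarrow> smooth_on U g \<Longrightarrow> smooth_on U (\<lambda>t. f t * g t)"
  using Ck_on_scaleR[of U _ f g] by (simp add: smooth_on_def)

lemma smooth_on_divide:
  fixes f g :: "real^2 \<Rightarrow> real"
  assumes "open U" "smooth_on U f" "smooth_on U g" "\<And>s. s \<in> U \<Longrightarrow> g s \<noteq> 0"
  shows "smooth_on U (\<lambda>t. f t / g t)"
  using smooth_on_mult[OF assms(1,2), of "\<lambda>t. inverse (g t)"] Ck_on_inverse[OF assms(1), of g] assms(3,4)
  by (simp add: smooth_on_def divide_inverse)

lemma smooth_on_subset: "smooth_on U f \<Longrightarrow> V \<subseteq> U \<Longrightarrow> smooth_on V f"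
  using Ck_on_subset[of _ U f V] by (simp add: smooth_on_def)

lemma smooth_on_cong:
  assumes "open U" "\<And>t. t \<in> U \<Longrightarrow> f t = g t"
  shows "smooth_on U f \<longleftrightarrow> smooth_on U g"
  using Ck_on_cong[OF assms] by (simp add: smooth_on_def)

lemma smooth_on_congI:
  "open U \<Longrightarrow> smooth_on U g \<Longrightarrow> (\<And>t. t \<in> U \<Longrightarrow> f t = g t) \<Longrightarrow> smooth_on U f"
  using smooth_on_cong[of U f g] by blast

lemma smooth_on_pd: "smooth_on U f \<Longrightarrow> smooth_on U (pd i f)"
  unfolding smooth_on_def by (metis Ck_on.simps(2))

lemma smooth_on_differentiable: "smooth_on U f \<Longrightarrow> s \<in> U \<Longrightarrow> f differentiable at s"
  unfolding smooth_on_def by (metis Ck_on.simps(2))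

lemma smooth_on_continuous: "smooth_on U f \<Longrightarrow> continuous_on U f"
  unfolding smooth_on_def by (metis Ck_on.simps(1))

lemma smooth_onI_pd:
  assumes "\<And>s. s \<in> U \<Longrightarrow> f differentiable at s" "\<And>i. smooth_on U (pd i f)"
  shows "smooth_on U f"
  unfolding smooth_on_def
proof
  fix k
  have "Ck_on (Suc k) U f" using assms by (simp add: smooth_on_def)
  then show "Ck_on k U f" by (rule Ck_on_Suc_imp)
qed

lemma smooth_on_vec_nth:
  fixes f :: "real^2 \<Rightarrow> real^'n"
  assumes "open U" "smooth_on U f"
  shows "smooth_on U (\<lambda>t. f t $ j)"
proof -
  have "Ck_on k U f \<Longrightarrow> Ck_on k U (\<lambda>t. f t $ j)" for k
  proof (induction k arbitrary: f)
    case (Suc k)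
    have "Ck_on k U (pd i (\<lambda>t. f t $ j))" for i
      using Suc Ck_on_cong[OF assms(1), of "pd i (\<lambda>t. f t $ j)" "\<lambda>t. pd i f t $ j" k]
      by (simp add: pd_vec_nth)
    with Suc.prems show ?case
      unfolding differentiable_def Ck_on.simps
      by (blast intro: bounded_linear.has_derivative[OF bounded_linear_vec_nth])
  qed (simp add: continuous_on_component)
  with assms(2) show ?thesis by (simp add: smooth_on_def)
qed

text \<open>Both mixed derivatives are limits of the second difference quotient over a square.\<close>

lemma second_difference:
  fixes f :: "real^2 \<Rightarrow> real" and s :: "real^2"
  assumes U: "open U" "s \<in> U"
    and f: "\<And>t. t \<in> U \<Longrightarrow> f differentiable at t"
    and g: "\<And>t. t \<in> U \<Longrightarrow> pd i f differentiable at t"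
    and sub: "\<And>x y. 0 \<le> x \<Longrightarrow> x \<le> h \<Longrightarrow> 0 \<le> y \<Longrightarrow> y \<le> h \<Longrightarrow>
        s + x *\<^sub>R axis i 1 + y *\<^sub>R axis j 1 \<in> U"
    and h: "h > 0"
  shows "\<exists>x y. 0 < x \<and> x < h \<and> 0 < y \<and> y < h \<and>
     f (s + h *\<^sub>R axis i 1 + h *\<^sub>R axis j 1) - f (s + h *\<^sub>R axis i 1)
       - f (s + h *\<^sub>R axis j 1) + f s
     = h * h * pd j (pd i f) (s + x *\<^sub>R axis i 1 + y *\<^sub>R axis j 1)"
proof -
  have line: "((\<lambda>x. F (p + x *\<^sub>R axis k 1)) has_real_derivative pd k F (p + x *\<^sub>R axis k 1)) (at x)"
    if "F differentiable at (p + x *\<^sub>R axis k 1)" for F :: "real^2 \<Rightarrow> real" and p k x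
  proof -
    have F: "(F has_derivative frechet_derivative F (at (p + x *\<^sub>R axis k 1))) (at (p + x *\<^sub>R axis k 1))"
      using that frechet_derivative_works by blast
    have "((\<lambda>x. p + x *\<^sub>R axis k 1) has_derivative (\<lambda>y. y *\<^sub>R axis k 1)) (at x)"
      by (auto intro!: derivative_eq_intros)
    from has_derivative_compose[OF this F] have
      "((\<lambda>x. F (p + x *\<^sub>R axis k 1)) has_derivative
         (\<lambda>y. frechet_derivative F (at (p + x *\<^sub>R axis k 1)) (y *\<^sub>R axis k 1))) (at x)" .
    then show ?thesis
      using linear_cmul[OF has_derivative_linear[OF F]]
      by (simp add: has_field_derivative_def pd_def mult.commute[of _ "frechet_derivative _ _ _"])
  qed
  \<comment> \<open>The mean value theorem is applied first to the increment \<open>H\<close> in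
    direction \<open>i\<close>, then to \<open>pd i f\<close> in direction \<open>j\<close>.\<close>
  define H where "H x = f ((s + h *\<^sub>R axis j 1) + x *\<^sub>R axis i 1) - f (s + x *\<^sub>R axis i 1)" for x
  have "\<exists>x. x > 0 \<and> x < h \<and> H h - H 0 = (h - 0) *
      (pd i f ((s + h *\<^sub>R axis j 1) + x *\<^sub>R axis i 1) - pd i f (s + x *\<^sub>R axis i 1))"
  proof (rule MVT2[OF h])
    fix x assume x: "0 \<le> x" "x \<le> h"
    show "(H has_real_derivative pd i f ((s + h *\<^sub>R axis j 1) + x *\<^sub>R axis i 1)
        - pd i f (s + x *\<^sub>R axis i 1)) (at x)"
      unfolding H_def using sub[OF x, of h] sub[OF x, of 0] h
      by (intro DERIV_diff line f) (simp_all add: algebra_simps)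
  qed
  then obtain x where x: "0 < x" "x < h" and Hx: "H h - H 0 = h *
      (pd i f ((s + x *\<^sub>R axis i 1) + h *\<^sub>R axis j 1) - pd i f ((s + x *\<^sub>R axis i 1) + 0 *\<^sub>R axis j 1))"
    by (auto simp: algebra_simps)
  have "\<exists>y. y > 0 \<and> y < h \<and> pd i f ((s + x *\<^sub>R axis i 1) + h *\<^sub>R axis j 1)
      - pd i f ((s + x *\<^sub>R axis i 1) + 0 *\<^sub>R axis j 1)
      = (h - 0) * pd j (pd i f) ((s + x *\<^sub>R axis i 1) + y *\<^sub>R axis j 1)"
    using sub[of x] x by (intro MVT2[OF h] line g) auto
  then obtain y where "0 < y" "y < h"
    "H h - H 0 = h * (h * pd j (pd i f) (s + x *\<^sub>R axis i 1 + y *\<^sub>R axis j 1))"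
    unfolding Hx by auto
  with x show ?thesis unfolding H_def by (intro exI[of _ x] exI[of _ y]) (simp add: algebra_simps)
qed

lemma pd_commute_real:
  fixes f :: "real^2 \<Rightarrow> real"
  assumes U: "open U" "s \<in> U" and f: "smooth_on U f"
  shows "pd i (pd j f) s = pd j (pd i f) s"
proof (rule ccontr)
  assume ne: "pd i (pd j f) s \<noteq> pd j (pd i f) s"
  define \<epsilon> where "\<epsilon> = \<bar>pd i (pd j f) s - pd j (pd i f) s\<bar> / 2"
  have \<epsilon>: "\<epsilon> > 0" using ne by (simp add: \<epsilon>_def)
  have "isCont (pd k (pd l f)) s" for k l
    using smooth_on_continuous[OF smooth_on_pd[OF smooth_on_pd[OF f]]] U
    by (simp add: continuous_on_eq_continuous_at)
  then have "\<exists>d>0. \<forall>t. dist t s < d \<longrightarrow> dist (pd k (pd l f) t) (pd k (pd l f) s) < \<epsilon>" for k l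
    using \<epsilon> unfolding continuous_at_eps_delta dist_norm by auto
  then obtain d where d: "\<And>k l. d k l > 0"
    "\<And>k l t. dist t s < d k l \<Longrightarrow> dist (pd k (pd l f) t) (pd k (pd l f) s) < \<epsilon>" by metis
  obtain e where e: "e > 0" "ball s e \<subseteq> U" using U openE by blast
  \<comment> \<open>Points of the square are at distance at most 2 h from \<open>s\<close>; division
    by 3 keeps this strictly below all three radii.\<close>
  define h where "h = min e (min (d i j) (d j i)) / 3"
  have h: "h > 0" using e d(1) by (simp add: h_def)
  have h3: "3 * h \<le> e" "3 * h \<le> d i j" "3 * h \<le> d j i" by (simp_all add: h_def)
  have near: "dist (s + x *\<^sub>R axis k 1 + y *\<^sub>R axis l 1) s < 3 * h"
    if "0 \<le> x" "x \<le> h" "0 \<le> y" "y \<le> h" for x y k l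
  proof -
    have "norm (x *\<^sub>R axis k 1 + y *\<^sub>R axis l (1::real) :: real^2) \<le> x + y"
      using norm_triangle_ineq[of "x *\<^sub>R axis k (1::real) :: real^2" "y *\<^sub>R axis l 1"] that
      by simp
    then show ?thesis using that h by (simp add: dist_norm)
  qed
  have sub: "s + x *\<^sub>R axis k 1 + y *\<^sub>R axis l 1 \<in> U"
    if "0 \<le> x" "x \<le> h" "0 \<le> y" "y \<le> h" for x y k l
  proof -
    have "dist (s + x *\<^sub>R axis k 1 + y *\<^sub>R axis l 1) s < e"
      using near[OF that, of k l] h3(1) by linarith
    then show ?thesis using e(2) by (auto simp: dist_commute subset_eq)
  qed
  note df = smooth_on_differentiable[OF f] smooth_on_differentiable[OF smooth_on_pd[OF f]]
  let ?a = "\<lambda>k. axis k 1 :: real^2"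
  from second_difference[OF U df sub h, of i j] obtain x y where
    1: "0 < x" "x < h" "0 < y" "y < h"
    "f (s + h *\<^sub>R ?a i + h *\<^sub>R ?a j) - f (s + h *\<^sub>R ?a i) - f (s + h *\<^sub>R ?a j) + f s
     = h * h * pd j (pd i f) (s + x *\<^sub>R ?a i + y *\<^sub>R ?a j)" by blast
  from second_difference[OF U df sub h, of j i] obtain x' y' where
    2: "0 < x'" "x' < h" "0 < y'" "y' < h"
    "f (s + h *\<^sub>R ?a j + h *\<^sub>R ?a i) - f (s + h *\<^sub>R ?a j) - f (s + h *\<^sub>R ?a i) + f s
     = h * h * pd i (pd j f) (s + x' *\<^sub>R ?a j + y' *\<^sub>R ?a i)" by blast
  have "h * h * pd j (pd i f) (s + x *\<^sub>R ?a i + y *\<^sub>R ?a j)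
      = h * h * pd i (pd j f) (s + x' *\<^sub>R ?a j + y' *\<^sub>R ?a i)"
    unfolding 1(5)[symmetric] 2(5)[symmetric] by (simp add: algebra_simps)
  then have "pd j (pd i f) (s + x *\<^sub>R ?a i + y *\<^sub>R ?a j)
      = pd i (pd j f) (s + x' *\<^sub>R ?a j + y' *\<^sub>R ?a i)" using h by simp
  moreover have "dist (pd j (pd i f) (s + x *\<^sub>R ?a i + y *\<^sub>R ?a j)) (pd j (pd i f) s) < \<epsilon>"
    using near[of x y i j] 1(1-4) h3 by (intro d(2)) linarith
  moreover have "dist (pd i (pd j f) (s + x' *\<^sub>R ?a j + y' *\<^sub>R ?a i)) (pd i (pd j f) s) < \<epsilon>"
    using near[of x' y' j i] 2(1-4) h3 by (intro d(2)) linarith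
  ultimately have "dist (pd j (pd i f) s) (pd i (pd j f) s) < \<epsilon> + \<epsilon>"
    by (metis dist_commute dist_triangle_less_add)
  then show False by (simp add: \<epsilon>_def dist_real_def abs_minus_commute)
qed

lemma pd_commute:
  fixes f :: "real^2 \<Rightarrow> real^'n"
  assumes U: "open U" "s \<in> U" and f: "smooth_on U f"
  shows "pd i (pd j f) s = pd j (pd i f) s"
proof -
  have "pd k (pd l f) s $ m = pd k (pd l (\<lambda>t. f t $ m)) s" for k l m
    using pd_vec_nth[OF smooth_on_differentiable[OF smooth_on_pd[OF f] U(2)], of k l m]
      pd_cong_open[OF U, of "pd l (\<lambda>t. f t $ m)" "\<lambda>t. pd l f t $ m" k]
      pd_vec_nth[OF smooth_on_differentiable[OF f]] by simp
  then show ?thesis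
    using pd_commute_real[OF U smooth_on_vec_nth[OF U(1) f]] by (simp add: vec_eq_iff)
qed

section \<open>Structure equations of a centroaffine surface\<close>

text \<open>Cramer's rule with the determinant multiplied out, hence a polynomial identity. It is
  used in both cases: a nonzero determinant gives the coefficients of \<open>w\<close>, a zero
  determinant gives a linear relation between \<open>a\<close>, \<open>b\<close>,
  \<open>c\<close>.\<close>

lemma cross3_frame:
  fixes a b c w :: "real^3"
  shows "(a \<bullet> cross3 b c) *\<^sub>R w
    = (w \<bullet> cross3 b c) *\<^sub>R a + (w \<bullet> cross3 c a) *\<^sub>R b + (w \<bullet> cross3 a b) *\<^sub>R c"
  by (simp add: vec_eq_iff forall_3 cross3_def inner_vec_def sum_3 vector_3 algebra_simps)

lemma triple_product_nonzero:
  fixes a b c :: "real^3"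
  assumes "\<And>x y z. x *\<^sub>R a + y *\<^sub>R b + z *\<^sub>R c = 0 \<Longrightarrow> x = 0 \<and> y = 0 \<and> z = 0"
  shows "a \<bullet> cross3 b c \<noteq> 0"
proof
  assume 0: "a \<bullet> cross3 b c = 0"
  have "w \<bullet> cross3 b c = 0" for w
    using assms[of "w \<bullet> cross3 b c"] cross3_frame[of a b c w] 0 by auto
  then have "cross3 b c = 0" using inner_eq_zero_iff by blast
  then have "collinear {0, b, c}" by (simp add: cross_eq_0)
  then consider "b = 0" | x where "c = x *\<^sub>R b"
    unfolding collinear_lemma by (metis scaleR_zero_left)
  then show False
  proof cases
    case 1
    then show ?thesis using assms[of 0 1 0] by simp
  next
    case 2
    then show ?thesis using assms[of 0 x "-1"] by simp
  qed
qed

lemma smooth_on_triple_product: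
  fixes a b c :: "real^2 \<Rightarrow> real^3"
  assumes "open U" "smooth_on U a" "smooth_on U b" "smooth_on U c"
  shows "smooth_on U (\<lambda>s. a s \<bullet> cross3 (b s) (c s))"
  unfolding inner_vec_def cross3_def sum_3 vector_3 inner_real_def
  by (intro smooth_on_add smooth_on_mult smooth_on_diff smooth_on_vec_nth assms)

lemma centroaffine_frame:
  assumes "centroaffine_surface r U" "s \<in> U"
    and "c0 *\<^sub>R r s + c1 *\<^sub>R pd 1 r s + c2 *\<^sub>R pd 2 r s = 0"
  shows "c0 = 0 \<and> c1 = 0 \<and> c2 = 0"
  using assms unfolding centroaffine_surface_def by blast

text \<open>The metric and the connection are defined by unique existence; as quotients of
  determinants they become accessible to proofs of smoothness and symmetry.\<close>

lemma centroaffine_cramer: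
  assumes S: "centroaffine_surface r U" and s: "s \<in> U"
  defines "\<Delta> \<equiv> r s \<bullet> cross3 (pd 1 r s) (pd 2 r s)"
  shows "\<Delta> \<noteq> 0"
    and "ca_metric r s $ i $ j = (pd j (pd i r) s \<bullet> cross3 (pd 1 r s) (pd 2 r s)) / \<Delta>"
    and "ca_connection r s 1 i j = (pd j (pd i r) s \<bullet> cross3 (pd 2 r s) (r s)) / \<Delta>"
    and "ca_connection r s 2 i j = (pd j (pd i r) s \<bullet> cross3 (r s) (pd 1 r s)) / \<Delta>"
    and "pd j (pd i r) s = (\<Sum>k\<in>UNIV. ca_connection r s k i j *\<^sub>R pd k r s)
           + ca_metric r s $ i $ j *\<^sub>R r s"
proof -
  note ind = centroaffine_frame[OF S s]
  show \<Delta>: "\<Delta> \<noteq> 0" unfolding \<Delta>_def by (rule triple_product_nonzero) (use ind in blast)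
  let ?w = "pd j (pd i r) s"
  let ?\<Gamma> = "\<lambda>k::2. if k = 1 then (?w \<bullet> cross3 (pd 2 r s) (r s)) / \<Delta>
    else (?w \<bullet> cross3 (r s) (pd 1 r s)) / \<Delta>"
  let ?g = "(?w \<bullet> cross3 (pd 1 r s) (pd 2 r s)) / \<Delta>"
  have "?w = (1 / \<Delta>) *\<^sub>R (\<Delta> *\<^sub>R ?w)" using \<Delta> by simp
  also have "\<dots> = (\<Sum>k\<in>UNIV. ?\<Gamma> k *\<^sub>R pd k r s) + ?g *\<^sub>R r s"
    using cross3_frame[of "r s" "pd 1 r s" "pd 2 r s" ?w]
    by (simp add: \<Delta>_def[symmetric] sum_2 scaleR_add_right algebra_simps)
  finally have F: "gauss_formula r s i j ?\<Gamma> ?g" unfolding gauss_formula_def .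
  note E = gauss_formula_eq[OF ind F]
  show "ca_metric r s $ i $ j = ?g" by (rule E(2))
  show "ca_connection r s 1 i j = (?w \<bullet> cross3 (pd 2 r s) (r s)) / \<Delta>"
    "ca_connection r s 2 i j = (?w \<bullet> cross3 (r s) (pd 1 r s)) / \<Delta>"
    using E(1)[of 1] E(1)[of 2] by simp_all
  show "?w = (\<Sum>k\<in>UNIV. ca_connection r s k i j *\<^sub>R pd k r s) + ca_metric r s $ i $ j *\<^sub>R r s"
    using F E(1)[of 1] E(1)[of 2] E(2) by (simp add: gauss_formula_def sum_2)
qed

lemma smooth_on_centroaffine:
  assumes S: "centroaffine_surface r U"
  shows "smooth_on U (\<lambda>s. ca_metric r s $ i $ j)" "smooth_on U (\<lambda>s. ca_connection r s k i j)"
proof -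
  have U: "open U" and r: "smooth_on U r" using S by (simp_all add: centroaffine_surface_def)
  let ?w = "pd j (pd i r)"
  let ?\<Delta> = "\<lambda>s. r s \<bullet> cross3 (pd 1 r s) (pd 2 r s)"
  note p = smooth_on_pd[OF r] smooth_on_pd[OF smooth_on_pd[OF r]]
  note T = smooth_on_triple_product[OF U]
  note sm = smooth_on_divide[OF U T T[OF r p(1) p(1)]]
  have "smooth_on U (\<lambda>s. (?w s \<bullet> cross3 (pd 1 r s) (pd 2 r s)) / ?\<Delta> s)"
    by (rule sm[OF p(2) p(1) p(1)]) (rule centroaffine_cramer(1)[OF S])
  then show "smooth_on U (\<lambda>s. ca_metric r s $ i $ j)"
    by (rule smooth_on_congI[OF U]) (rule centroaffine_cramer(2)[OF S])
  have "smooth_on U (\<lambda>s. (?w s \<bullet> cross3 (pd 2 r s) (r s)) / ?\<Delta> s)"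
    by (rule sm[OF p(2) p(1) r]) (rule centroaffine_cramer(1)[OF S])
  then have 1: "smooth_on U (\<lambda>s. ca_connection r s 1 i j)"
    by (rule smooth_on_congI[OF U]) (rule centroaffine_cramer(3)[OF S])
  have "smooth_on U (\<lambda>s. (?w s \<bullet> cross3 (r s) (pd 1 r s)) / ?\<Delta> s)"
    by (rule sm[OF p(2) r p(1)]) (rule centroaffine_cramer(1)[OF S])
  then have 2: "smooth_on U (\<lambda>s. ca_connection r s 2 i j)"
    by (rule smooth_on_congI[OF U]) (rule centroaffine_cramer(4)[OF S])
  show "smooth_on U (\<lambda>s. ca_connection r s k i j)"
    using exhaust_2[of k] 1 2 by metis
qed

lemma ca_symmetric:
  assumes S: "centroaffine_surface r U" and s: "s \<in> U"
  shows "ca_metric r s $ i $ j = ca_metric r s $ j $ i"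
    and "ca_connection r s k i j = ca_connection r s k j i"
proof -
  have "pd j (pd i r) s = pd i (pd j r) s"
    using S s pd_commute unfolding centroaffine_surface_def by blast
  then show "ca_metric r s $ i $ j = ca_metric r s $ j $ i"
    "ca_connection r s k i j = ca_connection r s k j i"
    using exhaust_2[of k] by (auto simp: centroaffine_cramer(2-4)[OF S s])
qed

text \<open>Both are the equality of the third derivatives of the position vector.\<close>

lemma codazzi_gauss:
  assumes S: "centroaffine_surface r U" and s: "s \<in> U"
  defines "g \<equiv> \<lambda>i j t. ca_metric r t $ i $ j" and "A \<equiv> \<lambda>k i j t. ca_connection r t k i j"
  shows "pd 1 (g i 2) s + (\<Sum>k\<in>UNIV. A k i 2 s * g k 1 s)
      = pd 2 (g i 1) s + (\<Sum>k\<in>UNIV. A k i 1 s * g k 2 s)"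
    and "pd 1 (A m i 2) s + (\<Sum>k\<in>UNIV. A k i 2 s * A m k 1 s) + (if m = 1 then g i 2 s else 0)
      = pd 2 (A m i 1) s + (\<Sum>k\<in>UNIV. A k i 1 s * A m k 2 s) + (if m = 2 then g i 1 s else 0)"
proof -
  have U: "open U" and r: "smooth_on U r" using S by (simp_all add: centroaffine_surface_def)
  note d = smooth_on_differentiable[OF _ s]
  have dg: "g i j differentiable at s" and dA: "A k i j differentiable at s" for i j k
    unfolding g_def A_def by (intro d smooth_on_centroaffine[OF S])+
  have dr: "r differentiable at s" "pd k r differentiable at s" for k
    by (intro d r smooth_on_pd)+
  have F: "pd j (pd i r) t = A 1 i j t *\<^sub>R pd 1 r t + A 2 i j t *\<^sub>R pd 2 r t + g i j t *\<^sub>R r t"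
    if "t \<in> U" for t i j
    using centroaffine_cramer(5)[OF S that] by (simp add: g_def A_def sum_2)
  have sc: "(\<lambda>t. f t *\<^sub>R h t) differentiable at s"
    if "f differentiable at s" "h differentiable at s" for f and h :: "real^2 \<Rightarrow> real^3"
    using has_derivative_scaleR[OF that[unfolded frechet_derivative_works]]
    by (auto simp: differentiable_def)
  have "pd l (pd j (pd i r)) s = pd l (\<lambda>t. A 1 i j t *\<^sub>R pd 1 r t + A 2 i j t *\<^sub>R pd 2 r t
      + g i j t *\<^sub>R r t) s" for l j
    by (rule pd_cong_open[OF U s F])
  moreover have "pd l (\<lambda>t. A 1 i j t *\<^sub>R pd 1 r t + A 2 i j t *\<^sub>R pd 2 r t + g i j t *\<^sub>R r t) s
    = pd l (A 1 i j) s *\<^sub>R pd 1 r s + A 1 i j s *\<^sub>R pd l (pd 1 r) s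
      + (pd l (A 2 i j) s *\<^sub>R pd 2 r s + A 2 i j s *\<^sub>R pd l (pd 2 r) s)
      + (pd l (g i j) s *\<^sub>R r s + g i j s *\<^sub>R pd l r s)" for l j
    by (simp add: pd_add pd_scaleR dg dA dr sc differentiable_add)
  \<comment> \<open>The summand \<open>g i j s\<close> in the coefficient of \<open>pd l r\<close>
    comes from differentiating the position vector in the last term of the Gauss formula.\<close>
  ultimately have D: "pd l (pd j (pd i r)) s = (pd l (g i j) s + (A 1 i j s * g 1 l s + A 2 i j s * g 2 l s)) *\<^sub>R r s
     + (pd l (A 1 i j) s + (A 1 i j s * A 1 1 l s + A 2 i j s * A 1 2 l s)
          + (if l = 1 then g i j s else 0)) *\<^sub>R pd 1 r s
     + (pd l (A 2 i j) s + (A 1 i j s * A 2 1 l s + A 2 i j s * A 2 2 l s)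
          + (if l = 2 then g i j s else 0)) *\<^sub>R pd 2 r s" for l j
    unfolding F[OF s] using exhaust_2[of l] by (auto simp: algebra_simps)
  have comm: "pd 1 (pd 2 (pd i r)) s = pd 2 (pd 1 (pd i r)) s"
    by (rule pd_commute[OF U s smooth_on_pd[OF r]])
  have coeff: "x0 = y0 \<and> x1 = y1 \<and> x2 = y2"
    if "x0 *\<^sub>R r s + x1 *\<^sub>R pd 1 r s + x2 *\<^sub>R pd 2 r s
      = y0 *\<^sub>R r s + y1 *\<^sub>R pd 1 r s + y2 *\<^sub>R pd 2 r s" for x0 x1 x2 y0 y1 y2
  proof -
    have "(x0 - y0) *\<^sub>R r s + (x1 - y1) *\<^sub>R pd 1 r s + (x2 - y2) *\<^sub>R pd 2 r s
      = (x0 *\<^sub>R r s + x1 *\<^sub>R pd 1 r s + x2 *\<^sub>R pd 2 r s)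
        - (y0 *\<^sub>R r s + y1 *\<^sub>R pd 1 r s + y2 *\<^sub>R pd 2 r s)"
      by (simp add: algebra_simps)
    then show ?thesis using centroaffine_frame[OF S s, of "x0 - y0" "x1 - y1" "x2 - y2"] that by simp
  qed
  note eqs = coeff[OF comm[unfolded D]]
  show "pd 1 (g i 2) s + (\<Sum>k\<in>UNIV. A k i 2 s * g k 1 s)
      = pd 2 (g i 1) s + (\<Sum>k\<in>UNIV. A k i 1 s * g k 2 s)"
    and "pd 1 (A m i 2) s + (\<Sum>k\<in>UNIV. A k i 2 s * A m k 1 s) + (if m = 1 then g i 2 s else 0)
      = pd 2 (A m i 1) s + (\<Sum>k\<in>UNIV. A k i 1 s * A m k 2 s) + (if m = 2 then g i 1 s else 0)"
    using eqs exhaust_2[of m] by (auto simp: sum_2)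
qed

section \<open>The Levi-Civita connection and its curvature\<close>

lemma matrix_inv_2:
  fixes A :: "real^2^2"
  assumes "det A \<noteq> 0"
  shows "matrix_inv A $ 1 $ 1 = A $ 2 $ 2 / det A" "matrix_inv A $ 1 $ 2 = - A $ 1 $ 2 / det A"
    "matrix_inv A $ 2 $ 1 = - A $ 2 $ 1 / det A" "matrix_inv A $ 2 $ 2 = A $ 1 $ 1 / det A"
proof -
  define B :: "real^2^2" where "B = vector [vector [A $ 2 $ 2 / det A, - A $ 1 $ 2 / det A],
    vector [- A $ 2 $ 1 / det A, A $ 1 $ 1 / det A]]"
  have "A ** B = mat 1" "B ** A = mat 1"
    using assms by (simp_all add: B_def matrix_matrix_mult_def mat_def vec_eq_iff sum_2 forall_2
        vector_2 field_simps) (simp_all add: det_2 algebra_simps)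
  moreover from this have "matrix_inv A ** A = mat 1"
    unfolding matrix_inv_def by (metis (mono_tags, lifting) someI_ex)
  ultimately have "matrix_inv A = B" by (metis matrix_mul_assoc matrix_mul_lid matrix_mul_rid)
  then show "matrix_inv A $ 1 $ 1 = A $ 2 $ 2 / det A" "matrix_inv A $ 1 $ 2 = - A $ 1 $ 2 / det A"
    "matrix_inv A $ 2 $ 1 = - A $ 2 $ 1 / det A" "matrix_inv A $ 2 $ 2 = A $ 1 $ 1 / det A"
    by (simp_all add: B_def vector_2)
qed

lemma levi_civita_metric:
  assumes U: "open U" "s \<in> U" and sym: "\<And>t i j. t \<in> U \<Longrightarrow> G t $ i $ j = G t $ j $ i"
    and det: "det (G s) \<noteq> 0"
  shows "levi_civita G s k i j = levi_civita G s k j i"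
    and "pd l (\<lambda>t. G t $ i $ j) s
      = (\<Sum>m\<in>UNIV. levi_civita G s m l i * G s $ m $ j + levi_civita G s m l j * G s $ m $ i)"
proof -
  let ?g = "\<lambda>i j t. G t $ i $ j"
  have pds: "pd l (?g i j) s = pd l (?g j i) s" for l i j
    by (rule pd_cong_open[OF U]) (rule sym)
  show "levi_civita G s k i j = levi_civita G s k j i"
    unfolding levi_civita_def pds[of _ i j] by (simp add: add.commute)
  \<comment> \<open>Lowering the index cancels the inverse matrix and leaves half of the bracket in
    the definition of the Christoffel symbol. Metric compatibility is the sum of two such
    brackets.\<close>
  have low: "(\<Sum>m\<in>UNIV. levi_civita G s m i j * G s $ m $ n)
      = (pd i (?g j n) s + pd j (?g i n) s - pd n (?g i j) s) / 2" for i j n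
  proof -
    define P where "P l = pd i (?g j l) s + pd j (?g i l) s - pd l (?g i j) s" for l
    have "n = 1 \<or> n = 2" by (rule exhaust_2)
    then have "(\<Sum>m\<in>UNIV. (\<Sum>l\<in>UNIV. matrix_inv (G s) $ m $ l * P l) / 2 * G s $ m $ n) = P n / 2"
      using det sym[OF U(2), of 2 1]
      by (auto simp: sum_2 matrix_inv_2 field_simps) (simp_all add: det_2 algebra_simps)
    then show ?thesis unfolding levi_civita_def P_def .
  qed
  show "pd l (?g i j) s
      = (\<Sum>m\<in>UNIV. levi_civita G s m l i * G s $ m $ j + levi_civita G s m l j * G s $ m $ i)"
    unfolding sum.distrib low using pds[of j i l] pds[of l i j] pds[of i l j] by argo
qed

lemma smooth_on_levi_civita:
  assumes U: "open U" and G: "\<And>i j. smooth_on U (\<lambda>t. G t $ i $ j)"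
    and det: "\<And>s. s \<in> U \<Longrightarrow> det (G s) \<noteq> 0"
  shows "smooth_on U (\<lambda>s. levi_civita G s k i j)"
proof -
  have "smooth_on U (\<lambda>s. det (G s))"
    unfolding det_2 by (intro smooth_on_diff smooth_on_mult U G)
  note inv = smooth_on_divide[OF U _ this]
  have "smooth_on U (\<lambda>s. matrix_inv (G s) $ 1 $ 1)"
    by (rule smooth_on_congI[OF U inv[OF G det] matrix_inv_2(1)[OF det]])
  moreover have "smooth_on U (\<lambda>s. matrix_inv (G s) $ 1 $ 2)"
    by (rule smooth_on_congI[OF U inv[OF smooth_on_minus[OF U G] det] matrix_inv_2(2)[OF det]])
  moreover have "smooth_on U (\<lambda>s. matrix_inv (G s) $ 2 $ 1)"
    by (rule smooth_on_congI[OF U inv[OF smooth_on_minus[OF U G] det] matrix_inv_2(3)[OF det]])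
  moreover have "smooth_on U (\<lambda>s. matrix_inv (G s) $ 2 $ 2)"
    by (rule smooth_on_congI[OF U inv[OF G det] matrix_inv_2(4)[OF det]])
  ultimately have inv: "smooth_on U (\<lambda>s. matrix_inv (G s) $ k $ l)" for k l
    using exhaust_2[of k] exhaust_2[of l] by metis
  note M = smooth_on_mult[OF U inv smooth_on_diff[OF U smooth_on_add[OF U smooth_on_pd[OF G] smooth_on_pd[OF G]] smooth_on_pd[OF G]]]
  show ?thesis unfolding levi_civita_def sum_2
    by (rule smooth_on_divide[OF U smooth_on_add[OF U M M] smooth_on_const]) simp
qed

lemma nondegenerate_2:
  fixes a b c x y :: real
  assumes "a * c - b * b \<noteq> 0" "a * x + b * y = 0" "b * x + c * y = 0"
  shows "x = 0" "y = 0"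
proof -
  have "(a * c - b * b) * x = c * (a * x + b * y) - b * (b * x + c * y)"
    "(a * c - b * b) * y = a * (b * x + c * y) - b * (a * x + b * y)" by (simp_all add: algebra_simps)
  then show "x = 0" "y = 0" using assms(1) unfolding assms(2,3) by simp_all
qed

text \<open>The Gauss curvature contains a single component of the lowered curvature tensor. Metric
  compatibility makes that tensor skew in its first two indices, so this component determines the
  others, and nondegeneracy raises the index again.\<close>

lemma flat_riemann:
  assumes U: "open U" "s \<in> U" and sym: "\<And>t i j. t \<in> U \<Longrightarrow> G t $ i $ j = G t $ j $ i"
    and G: "\<And>i j. smooth_on U (\<lambda>t. G t $ i $ j)"
    and det: "\<And>s. s \<in> U \<Longrightarrow> det (G s) \<noteq> 0" and flat: "gauss_curvature G s = 0"
  shows "riemann G s l k 1 2 = 0"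
proof -
  define g where "g i j t = G t $ i $ j" for i j t
  define \<Gamma> where "\<Gamma> k i j t = levi_civita G t k i j" for k i j t
  have dg: "g i j differentiable at s" and dG: "\<Gamma> k i j differentiable at s" for i j k
    using smooth_on_differentiable[OF G U(2)]
      smooth_on_differentiable[OF smooth_on_levi_civita[OF U(1) G det] U(2)]
    by (simp_all add: g_def[abs_def] \<Gamma>_def[abs_def])
  have gs: "g 2 1 t = g 1 2 t" if "t \<in> U" for t unfolding g_def by (rule sym[OF that])
  have \<Gamma>s: "\<Gamma> k 2 1 t = \<Gamma> k 1 2 t" if "t \<in> U" for t k
    unfolding \<Gamma>_def by (rule levi_civita_metric(1)[where G = G, OF U(1) that sym det[OF that]])
  have C: "pd l (g i j) t = \<Gamma> 1 l i t * g 1 j t + \<Gamma> 1 l j t * g 1 i t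
      + (\<Gamma> 2 l i t * g 2 j t + \<Gamma> 2 l j t * g 2 i t)" if "t \<in> U" for t l i j
    using levi_civita_metric(2)[where G = G and l = l and i = i and j = j, OF U(1) that sym det[OF that]]
    by (simp add: g_def[abs_def] \<Gamma>_def sum_2)
  have gC: "pd n (pd l (g i j)) s = pd n (\<lambda>t. \<Gamma> 1 l i t * g 1 j t + \<Gamma> 1 l j t * g 1 i t
      + (\<Gamma> 2 l i t * g 2 j t + \<Gamma> 2 l j t * g 2 i t)) s" for n l i j
    by (rule pd_cong_open[OF U C])
  have comm: "pd 1 (pd 2 (g i j)) s = pd 2 (pd 1 (g i j)) s" for i j
    using pd_commute_real[OF U G] by (simp add: g_def[abs_def])
  define R where "R a k = g a 1 s * riemann G s 1 k 1 2 + g a 2 s * riemann G s 2 k 1 2" for a k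
  have R: "riemann G s l k 1 2 = pd 1 (\<Gamma> l 2 k) s - pd 2 (\<Gamma> l 1 k) s
     + (\<Gamma> l 1 1 s * \<Gamma> 1 2 k s - \<Gamma> l 2 1 s * \<Gamma> 1 1 k s + (\<Gamma> l 1 2 s * \<Gamma> 2 2 k s - \<Gamma> l 2 2 s * \<Gamma> 2 1 k s))"
    for l k by (simp add: riemann_def \<Gamma>_def[abs_def] sum_2)
  note diff = differentiable_add[OF differentiable_mult[OF dG dg] differentiable_mult[OF dG dg]]
  have gC': "pd n (pd l (g i j)) s =
      pd n (\<Gamma> 1 l i) s * g 1 j s + \<Gamma> 1 l i s * pd n (g 1 j) s
      + (pd n (\<Gamma> 1 l j) s * g 1 i s + \<Gamma> 1 l j s * pd n (g 1 i) s)
      + (pd n (\<Gamma> 2 l i) s * g 2 j s + \<Gamma> 2 l i s * pd n (g 2 j) s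
      + (pd n (\<Gamma> 2 l j) s * g 2 i s + \<Gamma> 2 l j s * pd n (g 2 i) s))" for n l i j
    unfolding gC pd_add[OF diff diff] pd_add[OF differentiable_mult[OF dG dg] differentiable_mult[OF dG dg]]
      pd_mult[OF dG dg] ..
  \<comment> \<open>Ricci identity for the parallel tensor \<open>g\<close>: the commutator of its
    second derivatives, rewritten by compatibility, is the symmetric part of
    \<open>R\<close>.\<close>
  have anti: "R i j + R j i = 0" for i j
  proof -
    have "R i j + R j i = pd 1 (pd 2 (g i j)) s - pd 2 (pd 1 (g i j)) s"
      unfolding gC' R_def R C[OF U(2)]
      using exhaust_2[of i] exhaust_2[of j]
      by (elim disjE; simp only: gs[OF U(2)] \<Gamma>s[OF U(2)]; simp only: algebra_simps)
    then show ?thesis using comm by simp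
  qed
  have "R 1 2 / det (G s) = 0"
    using flat unfolding gauss_curvature_def R_def g_def sum_2 .
  then have "R 1 2 = 0" using det[OF U(2)] by simp
  moreover have "R 1 1 = 0" "R 2 2 = 0" using anti[of 1 1] anti[of 2 2] by linarith+
  ultimately have R0: "R 1 k = 0" "R 2 k = 0"
    using anti[of 1 2] exhaust_2[of k] by (metis add_0)+
  have "g 1 1 s * g 2 2 s - g 1 2 s * g 1 2 s \<noteq> 0"
    using det[OF U(2)] sym[OF U(2), of 2 1] unfolding det_2 g_def by simp
  note z = nondegenerate_2[OF this R0[unfolded R_def gs[OF U(2)]]]
  show ?thesis using z exhaust_2[of l] by metis
qed

section \<open>The algebra of the tangent plane\<close>

definition area :: "real^2 \<Rightarrow> real^2 \<Rightarrow> real" where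
  "area v w = v $ 1 * w $ 2 - v $ 2 * w $ 1"

lemma area_add: "area (u + v) w = area u w + area v w" "area u (v + w) = area u v + area u w"
  and area_scaleR: "area (x *\<^sub>R v) w = x * area v w" "area v (x *\<^sub>R w) = x * area v w"
  and area_self: "area v v = 0" and area_swap: "area w v = - area v w"
  and area_zero: "area 0 v = 0" "area v 0 = 0"
  by (simp_all add: area_def algebra_simps)

text \<open>The coefficient is given by a Euclidean projection instead of a bare existence
  statement, since \<open>c\<close> and \<open>lam\<close> are built from it and have to vary
  smoothly.\<close>

lemma area_zeroD:
  assumes "area x v = 0" "v \<noteq> 0"
  shows "x = ((x \<bullet> v) / (v \<bullet> v)) *\<^sub>R v"
proof -
  have "(v \<bullet> v) *\<^sub>R x - (x \<bullet> v) *\<^sub>R v = area x v *\<^sub>R vector [v $ 2, - v $ 1]"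
    by (simp add: vec_eq_iff forall_2 inner_vec_def sum_2 vector_2 area_def algebra_simps)
  then have "(v \<bullet> v) *\<^sub>R x = (x \<bullet> v) *\<^sub>R v" using assms(1) by simp
  then have "(1 / (v \<bullet> v)) *\<^sub>R ((v \<bullet> v) *\<^sub>R x) = (1 / (v \<bullet> v)) *\<^sub>R ((x \<bullet> v) *\<^sub>R v)" by simp
  then show ?thesis using assms(2) by simp
qed

lemma area_basis:
  assumes "area v w \<noteq> 0"
  shows "z = (area z w / area v w) *\<^sub>R v + (area v z / area v w) *\<^sub>R w"
proof -
  have "area v w *\<^sub>R z = area z w *\<^sub>R v + area v z *\<^sub>R w"
    by (simp add: vec_eq_iff forall_2 area_def algebra_simps)
  then have "(1 / area v w) *\<^sub>R (area v w *\<^sub>R z) = (1 / area v w) *\<^sub>R (area z w *\<^sub>R v + area v z *\<^sub>R w)"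
    by simp
  then show ?thesis using assms by (simp add: scaleR_add_right)
qed

lemma span_eq_iff_area:
  assumes "v \<noteq> 0" "w \<noteq> 0"
  shows "span {v} = span {w} \<longleftrightarrow> area v w = 0"
proof
  assume "span {v} = span {w}"
  then have "v \<in> span {w}" by (metis span_base singletonI)
  then show "area v w = 0" by (auto simp: span_singleton area_scaleR area_self)
next
  assume "area v w = 0"
  from area_zeroD[OF this assms(2)] obtain c where c: "v = c *\<^sub>R w" by blast
  then have "c \<noteq> 0" using assms by auto
  with c have "w = (1 / c) *\<^sub>R v" by simp
  with c show "span {v} = span {w}"
    unfolding span_eq by (metis empty_subsetI insert_subset span_base span_scale singletonI)
qed

text \<open>On \<open>\<real> \<oplus> \<real>\<^sup>2\<close>, with the first summand spanned by a unit \<open>e\<close>, the product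
  \<open>v * w = m v w + g v w e\<close> is commutative, and it is associative.  If \<open>v\<close> is characteristic, then
  multiplication by \<open>v\<close> is, up to multiples of \<open>e\<close>, the rank one perturbation
  \<open>x \<mapsto> c v x + lam v x v\<close> of a homothety, and \<open>lam v\<close> extends to a character of the algebra.\<close>

locale tangent_algebra =
  fixes m :: "real^2 \<Rightarrow> real^2 \<Rightarrow> real^2" and g :: "real^2 \<Rightarrow> real^2 \<Rightarrow> real"
  assumes m_bilinear: "bilinear m" and m_commute: "m x y = m y x"
    and g_bilinear: "bilinear g" and g_commute: "g x y = g y x"
    and nondegenerate: "(\<And>y. g x y = 0) \<Longrightarrow> x = 0"
    and assoc: "m x (m y z) + g y z *\<^sub>R x = m y (m x z) + g x z *\<^sub>R y"
begin

definition char_vec :: "real^2 \<Rightarrow> bool" where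
  "char_vec v \<longleftrightarrow> v \<noteq> 0 \<and> area (m v v) v = 0"

text \<open>The trace of multiplication by \<open>v\<close> minus, for a characteristic
  \<open>v\<close>, its eigenvalue on \<open>v\<close>: what is left is the eigenvalue on the
  quotient by \<open>v\<close>.\<close>

definition c :: "real^2 \<Rightarrow> real" where
  "c v = m v (axis 1 1) $ 1 + m v (axis 2 1) $ 2 - (m v v \<bullet> v) / (v \<bullet> v)"

definition lam :: "real^2 \<Rightarrow> real^2 \<Rightarrow> real" where
  "lam v x = ((m v x - c v *\<^sub>R x) \<bullet> v) / (v \<bullet> v)"

lemmas m_simps = bilinear_ladd[OF m_bilinear] bilinear_radd[OF m_bilinear]
  bilinear_lmul[OF m_bilinear] bilinear_rmul[OF m_bilinear]
lemmas g_simps = bilinear_ladd[OF g_bilinear] bilinear_radd[OF g_bilinear]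
  bilinear_lmul[OF g_bilinear] bilinear_rmul[OF g_bilinear]

lemma lam_add: "lam v (x + y) = lam v x + lam v y" and lam_scaleR: "lam v (a *\<^sub>R x) = a * lam v x"
  by (simp_all add: lam_def m_simps add_divide_distrib[symmetric] inner_simps algebra_simps)

lemma m_char:
  assumes "char_vec v"
  shows "m v x = c v *\<^sub>R x + lam v x *\<^sub>R v"
proof -
  have v: "v \<noteq> 0" "area (m v v) v = 0" using assms by (simp_all add: char_vec_def)
  define \<alpha> where "\<alpha> = (m v v \<bullet> v) / (v \<bullet> v)"
  have vv: "m v v = \<alpha> *\<^sub>R v" using area_zeroD[OF v(2,1)] by (simp add: \<alpha>_def)
  have ax: "z = z $ 1 *\<^sub>R axis 1 1 + z $ 2 *\<^sub>R axis 2 1" for z :: "real^2"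
    by (simp add: vec_eq_iff forall_2 axis_def)
  have mz: "m v z = z $ 1 *\<^sub>R m v (axis 1 1) + z $ 2 *\<^sub>R m v (axis 2 1)" for z
    using arg_cong[OF ax[of z], of "m v"] by (simp only: m_simps)
  \<comment> \<open>Linearised determinant: applying an endomorphism to each argument of the area
    form in turn multiplies the form by the trace.\<close>
  have "area (m v x) v + area x (m v v)
      = (m v (axis 1 1) $ 1 + m v (axis 2 1) $ 2) * area x v"
    unfolding mz[of x] mz[of v] by (simp add: area_def algebra_simps)
  also have "m v (axis 1 1) $ 1 + m v (axis 2 1) $ 2 = c v + \<alpha>" by (simp add: c_def \<alpha>_def)
  finally have "area (m v x) v + area x (m v v) = (c v + \<alpha>) * area x v" .
  then have "area (m v x - c v *\<^sub>R x) v = 0"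
    unfolding vv by (simp add: area_def algebra_simps)
  from area_zeroD[OF this v(1)] show ?thesis
    unfolding lam_def by (metis add.commute diff_add_cancel)
qed

text \<open>This is the e-component of the assertion that \<open>v - c v e\<close> is an eigenvector
  of multiplication by \<open>x\<close>; \<open>m_char\<close> is the tangential component. In
  associativity for \<open>x\<close>, \<open>y\<close>, \<open>v\<close> everything cancels except a
  multiple of \<open>x\<close> and a multiple of \<open>y\<close>.\<close>

lemma g_char:
  assumes "char_vec v"
  shows "g v x = - c v * lam v x"
proof -
  note mc = m_char[OF assms]
  have *: "area x y * (g v x + c v * lam v x) = 0" for x y
  proof -
    have "m x (m y v) + g y v *\<^sub>R x = m y (m x v) + g x v *\<^sub>R y" by (rule assoc)
    then have "m x (m v y) + g v y *\<^sub>R x = m y (m v x) + g v x *\<^sub>R y"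
      by (simp only: m_commute[of _ v] g_commute[of _ v])
    then have "(c v * lam v y + g v y) *\<^sub>R x = (c v * lam v x + g v x) *\<^sub>R y"
      unfolding mc by (simp add: m_simps m_commute[of _ v] mc m_commute[of y x] algebra_simps)
    from arg_cong[OF this, of "\<lambda>z. area x z"] show ?thesis
      by (simp add: area_add area_scaleR area_self algebra_simps)
  qed
  show ?thesis
  proof (cases "x = 0")
    case True
    then show ?thesis using bilinear_rzero[OF g_bilinear] lam_scaleR[of v 0 0] by simp
  next
    case False
    \<comment> \<open>The rotation of \<open>x\<close> by a right angle is independent of
      \<open>x\<close>, so the factor \<open>area x y\<close> cancels.\<close>
    have "area x (vector [- x $ 2, x $ 1]) = x \<bullet> x"
      by (simp add: area_def inner_vec_def sum_2 vector_2)
    with *[of x "vector [- x $ 2, x $ 1]"] False show ?thesis by simp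
  qed
qed

text \<open>Eigenvalues on a common eigenvector multiply along with the operators. The term
  \<open>g x y\<close> is the contribution of the e-part of the product, because the character has
  value 1 on the unit.\<close>

lemma lam_character:
  assumes "char_vec v"
  shows "lam v x * lam v y = lam v (m x y) + g x y"
proof -
  note mc = m_char[OF assms]
  have v: "v \<noteq> 0" using assms by (simp add: char_vec_def)
  have "m v (m x y) + g x y *\<^sub>R v = m x (m v y) + g v y *\<^sub>R x" by (rule assoc)
  then have "(lam v (m x y) + g x y) *\<^sub>R v = (lam v x * lam v y) *\<^sub>R v"
    unfolding mc g_char[OF assms] by (simp add: m_simps m_commute[of x v] mc algebra_simps)
  then show ?thesis using v by simp
qed

text \<open>The vector \<open>m v w\<close> is computed by \<open>m_char\<close> from
  \<open>v\<close> and from \<open>w\<close>. Comparing the coefficients of \<open>v\<close>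
  expresses that the two eigenvectors have product zero.\<close>

lemma lam_other:
  assumes "char_vec v" "char_vec w" "area v w \<noteq> 0"
  shows "lam v w = c w"
proof -
  have "c v *\<^sub>R w + lam v w *\<^sub>R v = c w *\<^sub>R v + lam w v *\<^sub>R w"
    using m_char[OF assms(1), of w] m_char[OF assms(2), of v] m_commute[of v w] by simp
  from arg_cong[OF this, of "\<lambda>z. area z w"] show ?thesis
    using assms(3) by (simp add: area_add area_scaleR area_self)
qed

lemma c_nonzero: "char_vec v \<Longrightarrow> c v \<noteq> 0"
  using g_char[of v] nondegenerate[of v] by (auto simp: char_vec_def)

text \<open>The third direction \<open>w\<close> supplies \<open>g v v\<close>: evaluating
  \<open>g w v\<close> in two ways yields minus the square of \<open>c v\<close>, the value that
  turns \<open>g\<close> into a form of rank one.\<close>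

lemma lam_self:
  assumes "char_vec u" "char_vec v" "char_vec w" "area u v \<noteq> 0" "area v w \<noteq> 0" "area u w \<noteq> 0"
  shows "lam u u \<noteq> c u"
proof
  assume 0: "lam u u = c u"
  note cv = assms(1-3)
  have sw: "area w u \<noteq> 0" "area v u \<noteq> 0" "area w v \<noteq> 0"
    using assms(4-6) area_swap[of u] area_swap[of v w] by simp_all
  define x y where "x = area w v / area u v" and "y = area u w / area u v"
  have w: "w = x *\<^sub>R u + y *\<^sub>R v" unfolding x_def y_def by (rule area_basis[OF assms(4)])
  have y: "y \<noteq> 0" using assms by (simp add: y_def)
  have guu: "g u u = - (c u * c u)" and guv: "g u v = - (c u * c v)"
    using g_char[OF cv(1)] 0 lam_other[OF cv(1,2) assms(4)] by simp_all
  have "c w = x * c u + y * c v"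
    using lam_other[OF cv(1,3) assms(6)] lam_other[OF cv(1,2) assms(4)] 0
    by (simp add: w lam_add lam_scaleR)
  moreover have "g w v = - (c w * c v)"
    using g_char[OF cv(3), of v] lam_other[OF cv(3,2) sw(3)] by simp
  ultimately have "y * (g v v + c v * c v) = 0"
    using guv by (simp add: w g_simps algebra_simps)
  with y have gvv: "g v v = - (c v * c v)" by simp
  \<comment> \<open>The witness of degeneracy is the vector on which \<open>lam u\<close> vanishes,
    as \<open>lam u\<close> takes the values \<open>c u\<close> and \<open>c v\<close> on
    \<open>u\<close> and \<open>v\<close>.\<close>
  have "g (c v *\<^sub>R u + (- c u) *\<^sub>R v) z = 0" for z
  proof -
    have "g (c v *\<^sub>R u + (- c u) *\<^sub>R v) u = 0" "g (c v *\<^sub>R u + (- c u) *\<^sub>R v) v = 0"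
      unfolding g_simps guu guv gvv g_commute[of v u] by simp_all
    moreover obtain p q where "z = p *\<^sub>R u + q *\<^sub>R v" using area_basis[OF assms(4)] by blast
    ultimately show ?thesis by (simp only: g_simps) simp
  qed
  then have "c v *\<^sub>R u + (- c u) *\<^sub>R v = 0" by (rule nondegenerate)
  moreover have "area (c v *\<^sub>R u + (- c u) *\<^sub>R v) v = c v * area u v"
    by (simp add: area_def algebra_simps)
  ultimately show False using assms(4) c_nonzero[OF cv(2)] by (simp add: area_zero)
qed

text \<open>The characteristic cubic in the basis \<open>v\<close>, \<open>w\<close>. The two known
  roots account for the factors \<open>x\<close> and \<open>y\<close>; the remaining linear factor
  locates the third direction.\<close>

lemma area_square:
  assumes "char_vec v" "char_vec w" "area v w \<noteq> 0"
  shows "area (m (x *\<^sub>R v + y *\<^sub>R w) (x *\<^sub>R v + y *\<^sub>R w)) (x *\<^sub>R v + y *\<^sub>R w)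
    = x * y * area v w * (x * (lam v v - c v) - y * (lam w w - c w))"
proof -
  have wv: "area w v \<noteq> 0" using assms(3) area_swap[of v w] by simp
  have "m (x *\<^sub>R v + y *\<^sub>R w) (x *\<^sub>R v + y *\<^sub>R w) =
     (x * x * (lam v v + c v) + x * y * c w + x * y * c w) *\<^sub>R v
     + (y * y * (lam w w + c w) + x * y * c v + x * y * c v) *\<^sub>R w"
    using lam_other[OF assms] lam_other[OF assms(2,1) wv]
    by (simp add: m_simps m_commute[of w v] m_char[OF assms(1)] m_char[OF assms(2)])
      (simp add: vec_eq_iff algebra_simps)
  then show ?thesis
    by (simp add: area_add area_scaleR area_self area_swap[of w v] algebra_simps)
qed

text \<open>The linear factor left by \<open>area_square\<close> is not zero, because
  \<open>lam_self\<close> excludes that its first coefficient vanishes. It has one root direction,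
  and a fourth characteristic \<open>z\<close> would have to share it with \<open>w\<close>.\<close>

lemma char_vec_at_most_three:
  assumes "char_vec u" "char_vec v" "char_vec w" "area u v \<noteq> 0" "area v w \<noteq> 0" "area u w \<noteq> 0"
    and z: "char_vec z"
  shows "area z u = 0 \<or> area z v = 0 \<or> area z w = 0"
proof (rule ccontr)
  assume "\<not> ?thesis"
  then have n: "area z u \<noteq> 0" "area z v \<noteq> 0" "area z w \<noteq> 0" by auto
  define a b where "a = lam u u - c u" and "b = lam v v - c v"
  have a: "a \<noteq> 0" using lam_self[OF assms(1-6)] by (simp add: a_def)
  have *: "area t v * a = area u t * b" if "char_vec t" "area t u \<noteq> 0" "area t v \<noteq> 0" for t
  proof -
    define x y where "x = area t v / area u v" and "y = area u t / area u v"
    have xy: "x \<noteq> 0" "y \<noteq> 0" using that assms(4) area_swap[of t u] by (simp_all add: x_def y_def)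
    have t: "t = x *\<^sub>R u + y *\<^sub>R v" unfolding x_def y_def by (rule area_basis[OF assms(4)])
    have "area (m t t) t = 0" using that by (simp add: char_vec_def)
    then have "x * a = y * b"
      unfolding t area_square[OF assms(1,2,4)] using xy assms(4) by (simp add: a_def b_def)
    then show ?thesis using assms(4) by (simp add: x_def y_def field_simps)
  qed
  have 1: "area z v * a = area u z * b" and 2: "area w v * a = area u w * b"
    using *[OF z n(1,2)] *[OF assms(3)] assms(5,6) area_swap[of u w] area_swap[of v w] by simp_all
  have b: "b \<noteq> 0" using 2 a assms(5) area_swap[of v w] by auto
  have "(area z v * area u w - area w v * area u z) * a * b
      = (area z v * a) * (area u w * b) - (area w v * a) * (area u z * b)"
    by (simp add: algebra_simps)
  then have "(area z v * area u w - area w v * area u z) * a * b = 0"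
    unfolding 1 2 by simp
  then have "area z v * area u w - area w v * area u z = 0" using a b by simp
  moreover have "area z v * area u w - area w v * area u z = area u v * area z w"
    by (simp add: area_def algebra_simps)
  ultimately show False using assms(4) n(3) by simp
qed

end

section \<open>The Gauss and Codazzi equations of a flat surface\<close>

lemma centroaffine_det: "centroaffine_surface r U \<Longrightarrow> s \<in> U \<Longrightarrow> det (ca_metric r s) \<noteq> 0"
  by (simp add: centroaffine_surface_def)

text \<open>The centroaffine connection is the Levi-Civita connection plus the difference tensor. By
  flatness its Gauss equation says only that the alternated covariant derivative of the difference
  tensor and the defect of associativity have sum zero. With the index lowered the former is
  symmetric, because the lowered tensor is totally symmetric, and the latter is skew; so each of
  them vanishes.\<close>

lemma flat_structure:
  assumes S: "centroaffine_surface r U" and flat: "flat_metric r U" and s: "s \<in> U"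
  defines "g \<equiv> \<lambda>i j t. ca_metric r t $ i $ j" and "C \<equiv> \<lambda>k i j t. difference_tensor r t k i j"
    and "\<Gamma> \<equiv> \<lambda>k i j t. levi_civita (ca_metric r) t k i j"
  shows "C k i j s = C k j i s"
    and "g 1 1 s * C 1 i 2 s + g 1 2 s * C 2 i 2 s = g 1 2 s * C 1 i 1 s + g 2 2 s * C 2 i 1 s"
    and "C 1 i 2 s * C m 1 1 s + C 2 i 2 s * C m 1 2 s + (if m = 1 then g i 2 s else 0)
      = C 1 i 1 s * C m 1 2 s + C 2 i 1 s * C m 2 2 s + (if m = 2 then g i 1 s else 0)"
    and "pd 1 (C m 2 i) s - pd 2 (C m 1 i) s
      = (\<Sum>k\<in>UNIV. \<Gamma> k 1 i s * C m 2 k s - \<Gamma> m 1 k s * C k 2 i s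
          - \<Gamma> k 2 i s * C m 1 k s + \<Gamma> m 2 k s * C k 1 i s)"
proof -
  define A where "A k i j t = ca_connection r t k i j" for k i j t
  have U: "open U" and det: "\<And>t. t \<in> U \<Longrightarrow> det (ca_metric r t) \<noteq> 0"
    using S by (simp_all add: centroaffine_surface_def)
  note sg = smooth_on_centroaffine(1)[OF S] and sA = smooth_on_centroaffine(2)[OF S]
  note sym = ca_symmetric(1)[OF S]
  note s\<Gamma> = smooth_on_levi_civita[OF U sg det]
  have sC: "smooth_on U (C k i j)" for k i j
    unfolding C_def difference_tensor_def by (rule smooth_on_diff[OF U sA s\<Gamma>])
  have dg: "g i j differentiable at s" and dC: "C k i j differentiable at s"
    and dA: "A k i j differentiable at s" and d\<Gamma>: "\<Gamma> k i j differentiable at s" for i j k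
    using smooth_on_differentiable[OF sg s] smooth_on_differentiable[OF sC s]
      smooth_on_differentiable[OF sA s] smooth_on_differentiable[OF s\<Gamma> s]
    by (simp_all add: g_def A_def[abs_def] \<Gamma>_def)
  have gs: "g 2 1 t = g 1 2 t" if "t \<in> U" for t unfolding g_def by (rule sym[OF that])
  have As: "A k i j t = A k j i t" if "t \<in> U" for t k i j
    unfolding A_def by (rule ca_symmetric(2)[OF S that])
  have \<Gamma>s: "\<Gamma> k i j t = \<Gamma> k j i t" if "t \<in> U" for t k i j
    unfolding \<Gamma>_def by (rule levi_civita_metric(1)[where G = "ca_metric r", OF U(1) that sym det[OF that]])
  have Cs: "C k i j t = C k j i t" if "t \<in> U" for t k i j
    using As[OF that, of k i j] \<Gamma>s[OF that, of k i j]
    by (simp add: C_def difference_tensor_def A_def \<Gamma>_def)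
  then show "C k i j s = C k j i s" using s .
  have pCs: "pd n (C k i j) s = pd n (C k j i) s" and p\<Gamma>s: "pd n (\<Gamma> k i j) s = pd n (\<Gamma> k j i) s" for n k i j
    by (rule pd_cong_open[OF U s Cs] pd_cong_open[OF U s \<Gamma>s], assumption)+
  have pgs: "pd n (g 2 1) s = pd n (g 1 2) s" for n by (rule pd_cong_open[OF U s gs])
  have A: "A k i j t = \<Gamma> k i j t + C k i j t" for k i j t
    by (simp add: A_def \<Gamma>_def C_def difference_tensor_def)
  have pA: "pd n (A k i j) s = pd n (\<Gamma> k i j) s + pd n (C k i j) s" for n k i j
    unfolding A[abs_def] by (rule pd_add[OF d\<Gamma> dC])
  have compat: "pd l (g i j) t = \<Gamma> 1 l i t * g 1 j t + \<Gamma> 1 l j t * g 1 i t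
      + (\<Gamma> 2 l i t * g 2 j t + \<Gamma> 2 l j t * g 2 i t)" if "t \<in> U" for t l i j
    using levi_civita_metric(2)[where G = "ca_metric r" and l = l and i = i and j = j,
        OF U(1) that sym det[OF that]]
    unfolding g_def \<Gamma>_def sum_2 .
  note sub = gs[OF s] Cs[OF s, of _ 2 1] \<Gamma>s[OF s, of _ 2 1] pCs[of _ _ 2 1] p\<Gamma>s[of _ _ 2 1] pgs
  \<comment> \<open>Total symmetry of the lowered difference tensor, from the Codazzi equation of
    the metric. It is proved on all of \<open>U\<close> because its derivative at \<open>s\<close>
    is needed too.\<close>
  have low: "g 1 1 t * C 1 i 2 t + g 1 2 t * C 2 i 2 t = g 1 2 t * C 1 i 1 t + g 2 2 t * C 2 i 1 t"
    if t: "t \<in> U" for t i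
  proof -
    have "pd 1 (g i 2) t + (A 1 i 2 t * g 1 1 t + A 2 i 2 t * g 2 1 t)
      = pd 2 (g i 1) t + (A 1 i 1 t * g 1 2 t + A 2 i 1 t * g 2 2 t)"
      using codazzi_gauss(1)[OF S t, of i] unfolding g_def A_def sum_2 .
    then show ?thesis unfolding compat[OF t] A
      using exhaust_2[of i] by (auto simp: gs[OF t] \<Gamma>s[OF t, of _ 2 1] algebra_simps)
  qed
  then show "g 1 1 s * C 1 i 2 s + g 1 2 s * C 2 i 2 s = g 1 2 s * C 1 i 1 s + g 2 2 s * C 2 i 1 s"
    using s .
  define T where "T i t = g 1 1 t * C 1 i 2 t + g 1 2 t * C 2 i 2 t
    - (g 1 2 t * C 1 i 1 t + g 2 2 t * C 2 i 1 t)" for i t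
  have T0: "T i s = 0" for i using low[OF s] by (simp add: T_def)
  \<comment> \<open>\<open>E\<close> is the alternated covariant derivative of the difference
    tensor; the Christoffel terms that act on the second alternated index cancel by symmetry.
    \<open>N\<close> below is the defect of associativity.\<close>
  define E where "E i m = pd 1 (C m 2 i) s - pd 2 (C m 1 i) s
      + (\<Gamma> m 1 1 s * C 1 2 i s + \<Gamma> m 1 2 s * C 2 2 i s) - (\<Gamma> 1 1 i s * C m 2 1 s + \<Gamma> 2 1 i s * C m 2 2 s)
      - (\<Gamma> m 2 1 s * C 1 1 i s + \<Gamma> m 2 2 s * C 2 1 i s) + (\<Gamma> 1 2 i s * C m 1 1 s + \<Gamma> 2 2 i s * C m 1 2 s)"
    for i m
  define N where "N i m = C 1 i 2 s * C m 1 1 s + C 2 i 2 s * C m 1 2 s + (if m = 1 then g i 2 s else 0)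
      - (C 1 i 1 s * C m 1 2 s + C 2 i 1 s * C m 2 2 s + (if m = 2 then g i 1 s else 0))" for i m
  have cases: "i = 1 \<or> i = 2" for i :: 2 by (rule exhaust_2)
  have EN: "E i m + N i m = 0" for i m
  proof -
    have 1: "pd 1 (A m i 2) s + (A 1 i 2 s * A m 1 1 s + A 2 i 2 s * A m 2 1 s) + (if m = 1 then g i 2 s else 0)
      = pd 2 (A m i 1) s + (A 1 i 1 s * A m 1 2 s + A 2 i 1 s * A m 2 2 s) + (if m = 2 then g i 1 s else 0)"
      using codazzi_gauss(2)[OF S s, of m i] unfolding g_def A_def sum_2 .
    have "gauss_curvature (ca_metric r) s = 0" using flat s by (simp add: flat_metric_def)
    from flat_riemann[where G = "ca_metric r", OF U s sym sg det this, of m i]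
    have 2: "pd 1 (\<Gamma> m 2 i) s - pd 2 (\<Gamma> m 1 i) s + (\<Gamma> m 1 1 s * \<Gamma> 1 2 i s - \<Gamma> m 2 1 s * \<Gamma> 1 1 i s
        + (\<Gamma> m 1 2 s * \<Gamma> 2 2 i s - \<Gamma> m 2 2 s * \<Gamma> 2 1 i s)) = 0"
      unfolding riemann_def sum_2 \<Gamma>_def .
    have "E i m + N i m =
      (pd 1 (A m i 2) s + (A 1 i 2 s * A m 1 1 s + A 2 i 2 s * A m 2 1 s) + (if m = 1 then g i 2 s else 0)
      - (pd 2 (A m i 1) s + (A 1 i 1 s * A m 1 2 s + A 2 i 1 s * A m 2 2 s) + (if m = 2 then g i 1 s else 0)))
      - (pd 1 (\<Gamma> m 2 i) s - pd 2 (\<Gamma> m 1 i) s + (\<Gamma> m 1 1 s * \<Gamma> 1 2 i s - \<Gamma> m 2 1 s * \<Gamma> 1 1 i s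
        + (\<Gamma> m 1 2 s * \<Gamma> 2 2 i s - \<Gamma> m 2 2 s * \<Gamma> 2 1 i s)))"
      unfolding E_def N_def pA A using cases[of i]
      by (elim disjE; simp only: sub; simp only: algebra_simps)
    with 1 2 show ?thesis by simp
  qed
  have pT: "pd n (T i) s = 0" for n i
  proof -
    have "pd n (T i) s = pd n (\<lambda>t. 0) s"
      by (rule pd_cong_open[OF U s]) (use low in \<open>simp add: T_def\<close>)
    then show ?thesis by (simp add: pd_const)
  qed
  note dgC = differentiable_mult[OF dg dC]
  have pT': "pd n (T i) s = pd n (g 1 1) s * C 1 i 2 s + g 1 1 s * pd n (C 1 i 2) s
      + (pd n (g 1 2) s * C 2 i 2 s + g 1 2 s * pd n (C 2 i 2) s)
      - (pd n (g 1 2) s * C 1 i 1 s + g 1 2 s * pd n (C 1 i 1) s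
      + (pd n (g 2 2) s * C 2 i 1 s + g 2 2 s * pd n (C 2 i 1) s))" for n i
    unfolding T_def[abs_def] pd_diff[OF differentiable_add[OF dgC dgC] differentiable_add[OF dgC dgC]]
      pd_add[OF dgC dgC] pd_mult[OF dg dC] ..
  define F where "F a i = g a 1 s * E i 1 + g a 2 s * E i 2" for a i
  define M where "M a i = g a 1 s * N i 1 + g a 2 s * N i 2" for a i
  have FM: "F a i = - M a i" for a i
    using EN[of i 1] EN[of i 2] unfolding F_def M_def by (metis add_eq_0_iff2 minus_add_distrib mult_minus_right)
  \<comment> \<open>Up to multiples of \<open>T\<close>, the skew part of \<open>F\<close> is the
    alternated derivative of the symmetry defect \<open>T\<close>, which is identically
    zero.\<close>
  have "F 1 2 - F 2 1 = pd 1 (T 2) s - pd 2 (T 1) s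
      - (\<Gamma> 1 1 1 s + \<Gamma> 2 1 2 s) * T 2 s + (\<Gamma> 1 1 2 s + \<Gamma> 2 2 2 s) * T 1 s"
    unfolding F_def E_def pT' compat[OF s] unfolding T_def sub by (simp only: algebra_simps)
  then have F12: "F 1 2 = F 2 1" unfolding pT T0 by simp
  \<comment> \<open>Where \<open>T\<close> vanishes, the operators given by the difference tensor
    are self-adjoint, so their commutator is skew; the metric terms of \<open>N\<close> are skew in
    any case.\<close>
  have "M 1 1 = C 2 1 2 s * T 1 s - C 2 1 1 s * T 2 s"
    unfolding M_def N_def T_def sub by (simp add: algebra_simps)
  then have M11: "M 1 1 = 0" unfolding T0 by simp
  have "M 2 2 = C 1 1 2 s * T 2 s - C 1 2 2 s * T 1 s"
    unfolding M_def N_def T_def sub by (simp add: algebra_simps)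
  then have M22: "M 2 2 = 0" unfolding T0 by simp
  have "M 1 2 + M 2 1 = (C 2 2 2 s - C 1 1 2 s) * T 1 s + (C 1 1 1 s - C 2 1 2 s) * T 2 s"
    unfolding M_def N_def T_def sub by (simp add: algebra_simps)
  then have M12: "M 1 2 + M 2 1 = 0" unfolding T0 by simp
  have F0: "F 1 i = 0" "F 2 i = 0" for i
    using FM[of 1 1] FM[of 2 2] FM[of 1 2] FM[of 2 1] F12 M11 M22 M12 cases[of i] by auto
  have "g 1 1 s * g 2 2 s - g 1 2 s * g 1 2 s \<noteq> 0"
    using det[OF s] gs[OF s] unfolding det_2 g_def by simp
  note E0 = nondegenerate_2[OF this F0[unfolded F_def gs[OF s]]]
  have E0: "E i m = 0" for i m using E0 cases[of m] by metis
  then have "N i m = 0" using EN[of i m] by simp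
  then show "C 1 i 2 s * C m 1 1 s + C 2 i 2 s * C m 1 2 s + (if m = 1 then g i 2 s else 0)
      = C 1 i 1 s * C m 1 2 s + C 2 i 1 s * C m 2 2 s + (if m = 2 then g i 1 s else 0)"
    unfolding N_def by simp
  show "pd 1 (C m 2 i) s - pd 2 (C m 1 i) s
      = (\<Sum>k\<in>UNIV. \<Gamma> k 1 i s * C m 2 k s - \<Gamma> m 1 k s * C k 2 i s
          - \<Gamma> k 2 i s * C m 1 k s + \<Gamma> m 2 k s * C k 1 i s)"
    using E0[of i m] unfolding E_def sum_2 by simp
qed


definition tangent_mult :: "(real^2 \<Rightarrow> real^3) \<Rightarrow> real^2 \<Rightarrow> real^2 \<Rightarrow> real^2 \<Rightarrow> real^2" where
  "tangent_mult r s v w =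
     (\<chi> k. \<Sum>i\<in>UNIV. \<Sum>j\<in>UNIV. difference_tensor r s k i j * v $ i * w $ j)"

lemma tangent_algebra_ca:
  assumes S: "centroaffine_surface r U" and flat: "flat_metric r U" and s: "s \<in> U"
  shows "tangent_algebra (tangent_mult r s) (metric_form (ca_metric r) s)"
proof
  let ?m = "tangent_mult r s" and ?g = "metric_form (ca_metric r) s"
  let ?C = "difference_tensor r s"
  let ?G = "\<lambda>i j. ca_metric r s $ i $ j"
  note st = flat_structure[OF S flat s]
  have G: "?G 2 1 = ?G 1 2" by (rule ca_symmetric(1)[OF S s])
  have C: "?C k 2 1 = ?C k 1 2" for k by (rule st(1))
  have m: "?m v w $ k = ?C k 1 1 * v $ 1 * w $ 1 + ?C k 1 2 * v $ 1 * w $ 2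
      + (?C k 1 2 * v $ 2 * w $ 1 + ?C k 2 2 * v $ 2 * w $ 2)" for v w k
    unfolding tangent_mult_def by (simp add: sum_2 C)
  have g: "?g v w = ?G 1 1 * v $ 1 * w $ 1 + ?G 1 2 * v $ 1 * w $ 2
      + (?G 1 2 * v $ 2 * w $ 1 + ?G 2 2 * v $ 2 * w $ 2)" for v w
    by (simp add: metric_form_def sum_2 G)
  show "bilinear ?m"
    by (auto simp: bilinear_def linear_iff vec_eq_iff m algebra_simps)
  show "?m x y = ?m y x" for x y by (simp add: vec_eq_iff m algebra_simps)
  show "bilinear ?g" by (auto simp: bilinear_def linear_iff g algebra_simps)
  show "?g x y = ?g y x" for x y by (simp add: g algebra_simps)
  show "x = 0" if x: "\<And>y. ?g x y = 0" for x
  proof -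
    have "?G 1 1 * x $ 1 + ?G 1 2 * x $ 2 = 0" "?G 1 2 * x $ 1 + ?G 2 2 * x $ 2 = 0"
      using x[of "axis 1 1"] x[of "axis 2 1"] unfolding g by (simp_all add: axis_def)
    moreover have "?G 1 1 * ?G 2 2 - ?G 1 2 * ?G 1 2 \<noteq> 0"
      using centroaffine_det[OF S s] G by (simp add: det_2)
    ultimately have "x $ 1 = 0" "x $ 2 = 0" by (metis nondegenerate_2)+
    then show ?thesis by (simp add: vec_eq_iff forall_2)
  qed
  show "?m x (?m y z) + ?g y z *\<^sub>R x = ?m y (?m x z) + ?g x z *\<^sub>R y" for x y z
  proof -
    define N where "N i m = ?C 1 i 2 * ?C m 1 1 + ?C 2 i 2 * ?C m 1 2 + (if m = 1 then ?G i 2 else 0)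
      - (?C 1 i 1 * ?C m 1 2 + ?C 2 i 1 * ?C m 2 2 + (if m = 2 then ?G i 1 else 0))" for i m
    have N: "N i m = 0" for i m using st(3)[of i m] by (simp add: N_def)
    \<comment> \<open>The defect is alternating in \<open>x\<close>, \<open>y\<close> and linear in
      \<open>z\<close>, so on a plane the components \<open>N\<close> determine it.\<close>
    have "(?m x (?m y z) + ?g y z *\<^sub>R x) $ k - (?m y (?m x z) + ?g x z *\<^sub>R y) $ k
        = (x $ 1 * y $ 2 - x $ 2 * y $ 1) * (z $ 1 * N 1 k + z $ 2 * N 2 k)" for k
      using exhaust_2[of k]
      by (elim disjE; simp add: m g N_def C G; simp add: algebra_simps)
    then show ?thesis unfolding N by (simp add: vec_eq_iff)
  qed
qed

section \<open>The characteristic cubic in terms of the algebra\<close>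

text \<open>Here \<open>p1\<close>, \<open>p2\<close> are the components of \<open>v\<close> lowered
  by the metric, \<open>D\<close> is the determinant of the metric, \<open>c1\<close> to
  \<open>c4\<close> are the components of the lowered difference tensor, and \<open>w1\<close>,
  \<open>w2\<close> are those of a general vector conjugate to \<open>v\<close>. The factor
  \<open>D\<close> on the left clears the inverse metric from the trace; the last bracket on the
  right is \<open>D\<close> times the area of \<open>v * v\<close> and \<open>v\<close>.\<close>

lemma conjugate_cubic:
  fixes k v1 v2 g11 g12 g22 c1 c2 c3 c4 :: real
  defines "p1 \<equiv> g11 * v1 + g12 * v2" and "p2 \<equiv> g12 * v1 + g22 * v2"
    and "D \<equiv> g11 * g22 - g12 * g12"
  defines "w1 \<equiv> - k * p2" and "w2 \<equiv> k * p1"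
  shows "D * (c1 * w1^3 + 3 * c2 * w1^2 * w2 + 3 * c3 * w1 * w2^2 + c4 * w2^3)
      - ((g22 * c1 - 2 * g12 * c2 + g11 * c3) * w1 + (g22 * c2 - 2 * g12 * c3 + g11 * c4) * w2)
        * (g11 * w1 * w1 + g12 * w1 * w2 + (g12 * w2 * w1 + g22 * w2 * w2))
    = k^3 * D^2 * ((c1 * v1^2 + 2 * c2 * v1 * v2 + c3 * v2^2) * p2
        - (c2 * v1^2 + 2 * c3 * v1 * v2 + c4 * v2^2) * p1)"
  unfolding w1_def w2_def p1_def p2_def D_def by algebra

lemma characteristic_vector_iff:
  assumes S: "centroaffine_surface r U" and flat: "flat_metric r U" and s: "s \<in> U"
  shows "characteristic_vector r s v
    \<longleftrightarrow> v \<noteq> 0 \<and> area (tangent_mult r s v v) v = 0"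
proof (cases "v = 0")
  case False
  let ?g = "metric_form (ca_metric r) s"
  let ?C = "difference_tensor r s"
  let ?G = "\<lambda>i j. ca_metric r s $ i $ j"
  note st = flat_structure[OF S flat s]
  have G: "?G 2 1 = ?G 1 2" by (rule ca_symmetric(1)[OF S s])
  have C: "?C k 2 1 = ?C k 1 2" for k by (rule st(1))
  define D where "D = ?G 1 1 * ?G 2 2 - ?G 1 2 * ?G 1 2"
  have D: "D \<noteq> 0" using centroaffine_det[OF S s] G by (simp add: D_def det_2)
  define c where "c k i j = ?G k 1 * ?C 1 i j + ?G k 2 * ?C 2 i j" for k i j
  have c: "c 1 1 2 = c 2 1 1" "c 1 2 2 = c 2 1 2"
    using st(2)[of 1] st(2)[of 2] unfolding c_def G C .
  define p1 p2 where "p1 = ?G 1 1 * v $ 1 + ?G 1 2 * v $ 2" and "p2 = ?G 1 2 * v $ 1 + ?G 2 2 * v $ 2"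
  define Q where "Q w = cubic_form r s w - 2 * chebyshev r s w * ?g w w" for w
  have cubic: "cubic_form r s w = c 1 1 1 * w $ 1 ^ 3 + 3 * c 2 1 1 * w $ 1 ^ 2 * w $ 2
      + 3 * c 2 1 2 * w $ 1 * w $ 2 ^ 2 + c 2 2 2 * w $ 2 ^ 3" for w
  proof -
    have "cubic_form r s w = c 1 1 1 * w $ 1 ^ 3 + (c 2 1 1 + 2 * c 1 1 2) * w $ 1 ^ 2 * w $ 2
        + (c 1 2 2 + 2 * c 2 1 2) * w $ 1 * w $ 2 ^ 2 + c 2 2 2 * w $ 2 ^ 3"
      unfolding cubic_form_def sum_2 c_def C G by (simp add: power2_eq_square power3_eq_cube algebra_simps)
    then show ?thesis unfolding c by simp
  qed
  \<comment> \<open>Cramer's rule raises the index without a division.\<close>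
  have C1: "D * ?C 1 i j = ?G 2 2 * c 1 i j - ?G 1 2 * c 2 i j" for i j
    unfolding D_def c_def G by (simp add: algebra_simps)
  have C2: "D * ?C 2 i j = ?G 1 1 * c 2 i j - ?G 1 2 * c 1 i j" for i j
    unfolding D_def c_def G by (simp add: algebra_simps)
  have T: "D * (2 * chebyshev r s w) = (?G 2 2 * c 1 1 1 - 2 * ?G 1 2 * c 2 1 1 + ?G 1 1 * c 2 1 2) * w $ 1
      + (?G 2 2 * c 2 1 1 - 2 * ?G 1 2 * c 2 1 2 + ?G 1 1 * c 2 2 2) * w $ 2" for w
  proof -
    have "D * (2 * chebyshev r s w) = (D * ?C 1 1 1 + D * ?C 2 1 2) * w $ 1
        + (D * ?C 1 1 2 + D * ?C 2 2 2) * w $ 2"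
      unfolding chebyshev_def sum_2 C by (simp add: algebra_simps)
    then show ?thesis unfolding C1 C2 c by (simp add: algebra_simps)
  qed
  have ar: "D * area (tangent_mult r s v v) v
      = (c 1 1 1 * v $ 1 ^ 2 + 2 * c 2 1 1 * v $ 1 * v $ 2 + c 2 1 2 * v $ 2 ^ 2) * p2
      - (c 2 1 1 * v $ 1 ^ 2 + 2 * c 2 1 2 * v $ 1 * v $ 2 + c 2 2 2 * v $ 2 ^ 2) * p1"
  proof -
    have "D * area (tangent_mult r s v v) v
      = (D * ?C 1 1 1 * v $ 1 ^ 2 + 2 * (D * ?C 1 1 2) * v $ 1 * v $ 2 + D * ?C 1 2 2 * v $ 2 ^ 2) * v $ 2
      - (D * ?C 2 1 1 * v $ 1 ^ 2 + 2 * (D * ?C 2 1 2) * v $ 1 * v $ 2 + D * ?C 2 2 2 * v $ 2 ^ 2) * v $ 1"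
      by (simp add: area_def tangent_mult_def sum_2 C power2_eq_square algebra_simps)
    also have "\<dots> = (c 1 1 1 * v $ 1 ^ 2 + 2 * c 2 1 1 * v $ 1 * v $ 2 + c 2 1 2 * v $ 2 ^ 2) * p2
      - (c 2 1 1 * v $ 1 ^ 2 + 2 * c 2 1 2 * v $ 1 * v $ 2 + c 2 2 2 * v $ 2 ^ 2) * p1"
      unfolding C1 C2 c p1_def p2_def by (simp add: power2_eq_square algebra_simps)
    finally show ?thesis .
  qed
  have orth: "?g v w = p1 * w $ 1 + p2 * w $ 2" for w
    by (simp add: metric_form_def sum_2 G p1_def p2_def algebra_simps)
  have p: "\<not> (p1 = 0 \<and> p2 = 0)"
    using nondegenerate_2[of "?G 1 1" "?G 2 2" "?G 1 2" "v $ 1" "v $ 2"] D False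
    by (auto simp: D_def p1_def p2_def vec_eq_iff forall_2)
  have Qw: "Q w = \<kappa> ^ 3 * D ^ 2 * area (tangent_mult r s v v) v"
    if w: "w $ 1 = - \<kappa> * p2" "w $ 2 = \<kappa> * p1" for w \<kappa>
  proof -
    have "D * Q w = D * cubic_form r s w - D * (2 * chebyshev r s w) * ?g w w"
      by (simp add: Q_def algebra_simps)
    also have "\<dots> = \<kappa> ^ 3 * D ^ 2 * (D * area (tangent_mult r s v v) v)"
      unfolding cubic T ar w metric_form_def sum_2 G unfolding p1_def p2_def D_def
      by (rule conjugate_cubic)
    finally have "D * Q w = D * (\<kappa> ^ 3 * D ^ 2 * area (tangent_mult r s v v) v)"
      by (simp only: mult_ac)
    then show ?thesis using D by simp
  qed
  show ?thesis
  proof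
    assume "characteristic_vector r s v"
    then obtain w where w: "w \<noteq> 0" "?g v w = 0" "Q w = 0"
      unfolding characteristic_vector_def Q_def by blast
    obtain \<kappa> where \<kappa>: "w $ 1 = - \<kappa> * p2" "w $ 2 = \<kappa> * p1"
    proof (cases "p1 = 0")
      case True
      then show ?thesis using that[of "- w $ 1 / p2"] p w(2) orth by auto
    next
      case False
      then show ?thesis using that[of "w $ 2 / p1"] w(2) orth by (auto simp: field_simps)
    qed
    then have "\<kappa> \<noteq> 0" using w(1) by (auto simp: vec_eq_iff forall_2)
    then show "v \<noteq> 0 \<and> area (tangent_mult r s v v) v = 0"
      using Qw[OF \<kappa>] w(3) D False by simp
  next
    assume a: "v \<noteq> 0 \<and> area (tangent_mult r s v v) v = 0"
    define w :: "real^2" where "w = vector [- p2, p1]"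
    have w: "w $ 1 = - p2" "w $ 2 = p1" by (simp_all add: w_def vector_2)
    have "Q w = 0" using Qw[of w 1] w a by simp
    moreover have "w \<noteq> 0" using w p by (auto simp: vec_eq_iff forall_2)
    moreover have "?g v w = 0" unfolding orth w by simp
    ultimately show "characteristic_vector r s v"
      using a unfolding characteristic_vector_def Q_def by blast
  qed
qed (simp add: characteristic_vector_def)

text \<open>Differentiating the character equation, contracting with a characteristic vector and using that
  the covariant derivative of the difference tensor is totally symmetric, every term but the
  exterior derivative of \<open>L\<close> cancels.\<close>

lemma character_closed:
  assumes S: "centroaffine_surface r U" and flat: "flat_metric r U"
    and W: "open W" "W \<subseteq> U" "s \<in> W"
    and L: "\<And>i. L i differentiable at s"
    and character: "\<And>t i j. t \<in> W \<Longrightarrow> L i t * L j t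
      = difference_tensor r t 1 i j * L 1 t + difference_tensor r t 2 i j * L 2 t + ca_metric r t $ i $ j"
    and v: "\<And>i l. difference_tensor r s l i 1 * v $ 1 + difference_tensor r s l i 2 * v $ 2
      = (if l = i then c else 0) + L i s * v $ l"
    and c: "L 1 s * v $ 1 + L 2 s * v $ 2 \<noteq> c"
  shows "pd 1 (L 2) s = pd 2 (L 1) s"
proof -
  define g where "g i j t = ca_metric r t $ i $ j" for i j t
  define C where "C k i j t = difference_tensor r t k i j" for k i j t
  define \<Gamma> where "\<Gamma> k i j = levi_civita (ca_metric r) s k i j" for k i j
  have U: "open U" and det: "\<And>t. t \<in> U \<Longrightarrow> det (ca_metric r t) \<noteq> 0" and s: "s \<in> U"
    using S W by (auto simp: centroaffine_surface_def)
  note sg = smooth_on_centroaffine(1)[OF S] and sA = smooth_on_centroaffine(2)[OF S]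
  note sym = ca_symmetric(1)[OF S]
  have dg: "g i j differentiable at s" for i j
    using smooth_on_differentiable[OF sg s] by (simp add: g_def[abs_def])
  have dC: "C k i j differentiable at s" for k i j
    using smooth_on_differentiable[OF smooth_on_diff[OF U sA smooth_on_levi_civita[OF U sg det]] s]
    by (simp add: C_def[abs_def] difference_tensor_def)
  have gs: "g 2 1 s = g 1 2 s" unfolding g_def by (rule sym[OF s])
  have \<Gamma>s: "\<Gamma> k 2 1 = \<Gamma> k 1 2" for k
    unfolding \<Gamma>_def by (rule levi_civita_metric(1)[where G = "ca_metric r", OF U s sym det[OF s]])
  have Cs: "C k 2 1 s = C k 1 2 s" for k unfolding C_def by (rule flat_structure(1)[OF S flat s])
  have compat: "pd l (g i j) s = \<Gamma> 1 l i * g 1 j s + \<Gamma> 1 l j * g 1 i s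
      + (\<Gamma> 2 l i * g 2 j s + \<Gamma> 2 l j * g 2 i s)" for l i j
    using levi_civita_metric(2)[where G = "ca_metric r" and l = l and i = i and j = j,
        OF U s sym det[OF s]]
    unfolding g_def \<Gamma>_def sum_2 .
  have E: "pd 1 (C m 2 i) s - pd 2 (C m 1 i) s
      = \<Gamma> 1 1 i * C m 2 1 s - \<Gamma> m 1 1 * C 1 2 i s - \<Gamma> 1 2 i * C m 1 1 s + \<Gamma> m 2 1 * C 1 1 i s
      + (\<Gamma> 2 1 i * C m 2 2 s - \<Gamma> m 1 2 * C 2 2 i s - \<Gamma> 2 2 i * C m 1 2 s + \<Gamma> m 2 2 * C 2 1 i s)" for m i
    using flat_structure(4)[OF S flat s, of m i] unfolding C_def[symmetric] \<Gamma>_def[symmetric] sum_2 .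
  have ch: "L i t * L j t = C 1 i j t * L 1 t + C 2 i j t * L 2 t + g i j t" if "t \<in> W" for i j t
    using character[OF that] by (simp add: C_def g_def)
  have "pd n (\<lambda>t. L i t * L j t) s = pd n (\<lambda>t. C 1 i j t * L 1 t + C 2 i j t * L 2 t + g i j t) s"
    for n i j
    by (rule pd_cong_open[OF W(1,3) ch])
  then have D: "pd n (L i) s * L j s + L i s * pd n (L j) s = pd n (C 1 i j) s * L 1 s + C 1 i j s * pd n (L 1) s
      + (pd n (C 2 i j) s * L 2 s + C 2 i j s * pd n (L 2) s) + pd n (g i j) s" for n i j
    by (simp only: pd_mult[OF L L] pd_add[OF differentiable_add[OF differentiable_mult[OF dC L]
        differentiable_mult[OF dC L]] dg] pd_add[OF differentiable_mult[OF dC L]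
        differentiable_mult[OF dC L]] pd_mult[OF dC L])
  define d where "d = pd 1 (L 2) s - pd 2 (L 1) s"
  define K where "K l i = C l i 1 s * v $ 1 + C l i 2 s * v $ 2" for l i
  have K: "K l i = (if l = i then c else 0) + L i s * v $ l" for l i
    using v by (simp add: K_def C_def)
  \<comment> \<open>Symmetry of the covariant derivative and metric compatibility replace the
    derivatives of \<open>C\<close> and \<open>g\<close> by Christoffel terms; those contracted with
    the index \<open>j\<close> become products of values of \<open>L\<close> by the character
    equation.\<close>
  have X: "(pd 1 (C 1 2 j) s - pd 2 (C 1 1 j) s) * L 1 s + (pd 1 (C 2 2 j) s - pd 2 (C 2 1 j) s) * L 2 s
      + (pd 1 (g 2 j) s - pd 2 (g 1 j) s)
    = \<Gamma> 1 1 j * (L 2 s * L 1 s) + \<Gamma> 2 1 j * (L 2 s * L 2 s) - \<Gamma> 1 2 j * (L 1 s * L 1 s) - \<Gamma> 2 2 j * (L 1 s * L 2 s)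
      - (\<Gamma> 1 1 1 * L 1 s + \<Gamma> 2 1 1 * L 2 s) * C 1 2 j s - (\<Gamma> 1 1 2 * L 1 s + \<Gamma> 2 1 2 * L 2 s) * C 2 2 j s
      + (\<Gamma> 1 2 1 * L 1 s + \<Gamma> 2 2 1 * L 2 s) * C 1 1 j s + (\<Gamma> 1 2 2 * L 1 s + \<Gamma> 2 2 2 * L 2 s) * C 2 1 j s" for j
    unfolding E compat ch[OF W(3)] gs Cs \<Gamma>s by (simp add: algebra_simps)
  \<comment> \<open>The derivative along 1 of the character equation for the indices 2 and
    \<open>j\<close>, minus the derivative along 2 of the equation for 1 and
    \<open>j\<close>.\<close>
  have "d * L j s = (L 1 s * pd 2 (L j) s - L 2 s * pd 1 (L j) s)
      + ((pd 1 (C 1 2 j) s - pd 2 (C 1 1 j) s) * L 1 s + (pd 1 (C 2 2 j) s - pd 2 (C 2 1 j) s) * L 2 s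
      + (pd 1 (g 2 j) s - pd 2 (g 1 j) s))
      + (C 1 2 j s * pd 1 (L 1) s + C 2 2 j s * pd 1 (L 2) s - C 1 1 j s * pd 2 (L 1) s - C 2 1 j s * pd 2 (L 2) s)"
    for j
    using D[of 1 2 j] D[of 2 1 j] unfolding d_def by (simp add: algebra_simps)
  note dL = this[unfolded X]
  have "d * (L 1 s * v $ 1 + L 2 s * v $ 2) = d * L 1 s * v $ 1 + d * L 2 s * v $ 2"
    by (simp add: algebra_simps)
  also have "\<dots> = (L 1 s * (pd 2 (L 1) s * v $ 1 + pd 2 (L 2) s * v $ 2)
        - L 2 s * (pd 1 (L 1) s * v $ 1 + pd 1 (L 2) s * v $ 2))
      + (\<Gamma> 1 1 1 * v $ 1 + \<Gamma> 1 1 2 * v $ 2) * (L 2 s * L 1 s) + (\<Gamma> 2 1 1 * v $ 1 + \<Gamma> 2 1 2 * v $ 2) * (L 2 s * L 2 s)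
      - (\<Gamma> 1 2 1 * v $ 1 + \<Gamma> 1 2 2 * v $ 2) * (L 1 s * L 1 s) - (\<Gamma> 2 2 1 * v $ 1 + \<Gamma> 2 2 2 * v $ 2) * (L 1 s * L 2 s)
      - (\<Gamma> 1 1 1 * L 1 s + \<Gamma> 2 1 1 * L 2 s) * K 1 2 - (\<Gamma> 1 1 2 * L 1 s + \<Gamma> 2 1 2 * L 2 s) * K 2 2
      + (\<Gamma> 1 2 1 * L 1 s + \<Gamma> 2 2 1 * L 2 s) * K 1 1 + (\<Gamma> 1 2 2 * L 1 s + \<Gamma> 2 2 2 * L 2 s) * K 2 1
      + (K 1 2 * pd 1 (L 1) s + K 2 2 * pd 1 (L 2) s - K 1 1 * pd 2 (L 1) s - K 2 1 * pd 2 (L 2) s)"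
    unfolding dL K_def by (simp only: algebra_simps)
  \<comment> \<open>In \<open>K\<close> the rank one part cancels against the products of
    \<open>L\<close> and its derivatives, and against the Christoffel terms in the same way. The
    homothety leaves \<open>c * d\<close>, its Christoffel terms cancelling by symmetry.\<close>
  also have "\<dots> = c * d"
    unfolding K d_def \<Gamma>s by (simp add: algebra_simps)
  finally have "d * (L 1 s * v $ 1 + L 2 s * v $ 2 - c) = 0" by (simp add: algebra_simps)
  then show ?thesis using c by (simp add: d_def)
qed

section \<open>Closed forms and implicit functions\<close>

lemma poincare:
  fixes P Q :: "real^2 \<Rightarrow> real" and p :: "real^2" and e :: real
  defines "V \<equiv> ball p e"
  assumes P: "smooth_on V P" and Q: "smooth_on V Q"
    and closed: "\<And>s. s \<in> V \<Longrightarrow> pd 1 Q s = pd 2 P s"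
  shows "\<exists>f. smooth_on V f \<and> (\<forall>s\<in>V. pd 1 f s = P s \<and> pd 2 f s = Q s)"
proof -
  have V: "open V" "convex V" by (simp_all add: V_def)
  have bl: "bounded_linear (\<lambda>h::real^2. h $ i)" for i by (rule bounded_linear_vec_nth)
  \<comment> \<open>Coordinate functionals as bounded linear functions, the type in which
    differentiation under the integral sign requires the derivative to be continuous.\<close>
  define b where "b i = Blinfun (\<lambda>h::real^2. h $ i)" for i
  have b: "blinfun_apply (b i) h = h $ i" for i h
    unfolding b_def by (simp add: bounded_linear_Blinfun_apply[OF bl])
  let ?x = "\<lambda>s t. p + t *\<^sub>R (s - p)"
  have x: "?x s t \<in> V" if "s \<in> V" "t \<in> cbox 0 1" for s t
  proof -
    have "norm (t *\<^sub>R (s - p)) \<le> norm (s - p)"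
      using that(2) by (simp add: mult_left_le_one_le)
    then show ?thesis using that(1) by (simp add: V_def dist_norm norm_minus_commute)
  qed
  \<comment> \<open>The integral of \<open>F s\<close> is that of the form along the segment from
    the centre to \<open>s\<close>; \<open>A\<close> and \<open>B\<close> are the partial
    derivatives of the integrand in the coordinates of \<open>s\<close>.\<close>
  define F where "F s t = P (?x s t) * (s - p) $ 1 + Q (?x s t) * (s - p) $ 2" for s t
  define A where "A s t = P (?x s t) + t * (pd 1 P (?x s t) * (s - p) $ 1 + pd 1 Q (?x s t) * (s - p) $ 2)" for s t
  define B where "B s t = Q (?x s t) + t * (pd 2 P (?x s t) * (s - p) $ 1 + pd 2 Q (?x s t) * (s - p) $ 2)" for s t
  define f' where "f' s t = A s t *\<^sub>R b 1 + B s t *\<^sub>R b 2" for s t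
  note D = has_derivative_pd[OF smooth_on_differentiable]
  have cont: "continuous_on (V \<times> cbox 0 1) (\<lambda>(s, t). G (?x s t))" if "continuous_on V G"
    for G :: "real^2 \<Rightarrow> real"
    unfolding split_beta
    by (rule continuous_on_compose2[OF that]) (auto intro!: continuous_intros x simp: split_beta)
  have cont1: "continuous_on (cbox 0 1) (\<lambda>t. G (?x s t))" if "continuous_on V G" "s \<in> V"
    for G :: "real^2 \<Rightarrow> real" and s
    by (rule continuous_on_compose2[OF that(1)]) (auto intro!: continuous_intros x that(2))
  note c = smooth_on_continuous[OF P] smooth_on_continuous[OF Q]
    smooth_on_continuous[OF smooth_on_pd[OF P]] smooth_on_continuous[OF smooth_on_pd[OF Q]]
  define f where "f s = integral (cbox 0 1) (F s)" for s
  have f: "(f has_derivative (\<lambda>h. P s * h $ 1 + Q s * h $ 2)) (at s)" if s: "s \<in> V" for s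
  proof -
    have "(f has_derivative integral (cbox 0 1) (f' s)) (at s within V)"
      unfolding f_def
    proof (rule leibniz_rule[OF _ _ _ s V(2)])
      fix s t assume st: "s \<in> V" "t \<in> cbox (0::real) 1"
      have inner: "((\<lambda>s. ?x s t) has_derivative (\<lambda>h. t *\<^sub>R h)) (at s)"
        by (auto intro!: derivative_eq_intros)
      have "((\<lambda>s. F s t) has_derivative (\<lambda>h.
          ((t *\<^sub>R h) $ 1 *\<^sub>R pd 1 P (?x s t) + (t *\<^sub>R h) $ 2 *\<^sub>R pd 2 P (?x s t)) * (s - p) $ 1 + P (?x s t) * h $ 1
          + (((t *\<^sub>R h) $ 1 *\<^sub>R pd 1 Q (?x s t) + (t *\<^sub>R h) $ 2 *\<^sub>R pd 2 Q (?x s t)) * (s - p) $ 2 + Q (?x s t) * h $ 2)))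
          (at s)"
        unfolding F_def
        by (rule derivative_eq_intros has_derivative_compose[OF inner D[OF P x[OF st]]]
            has_derivative_compose[OF inner D[OF Q x[OF st]]] bounded_linear.has_derivative[OF bl] refl)+
          (simp add: algebra_simps)
      then show "((\<lambda>s. F s t) has_derivative blinfun_apply (f' s t)) (at s within V)"
        by (rule has_derivative_at_withinI[OF has_derivative_eq_rhs])
          (simp add: fun_eq_iff f'_def b blinfun.add_left blinfun.scaleR_left, simp add: A_def B_def algebra_simps)
    next
      fix s assume s: "s \<in> V"
      show "F s integrable_on cbox 0 1"
        unfolding F_def by (intro integrable_continuous continuous_intros cont1 c s)
    next
      show "continuous_on (V \<times> cbox 0 1) (\<lambda>(s, t). f' s t)"
        unfolding f'_def A_def B_def split_beta
        by (intro continuous_intros cont[unfolded split_beta] c)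
    qed
    moreover have "(f' s has_integral (P s *\<^sub>R b 1 + Q s *\<^sub>R b 2)) (cbox 0 1)"
    proof -
      have I: "((\<lambda>t. G (?x s t) + t * (pd 1 G (?x s t) * (s - p) $ 1 + pd 2 G (?x s t) * (s - p) $ 2))
          has_integral G s) (cbox 0 1)" if "smooth_on V G" for G
      proof -
        have "((\<lambda>t. G (?x s t) + t * (pd 1 G (?x s t) * (s - p) $ 1 + pd 2 G (?x s t) * (s - p) $ 2))
          has_integral 1 * G (?x s 1) - 0 * G (?x s 0)) {0..1}"
        proof (rule fundamental_theorem_of_calculus)
          fix t :: real assume "t \<in> {0..1}"
          then have t: "t \<in> cbox 0 1" by simp
          have inner: "((\<lambda>t. ?x s t) has_derivative (\<lambda>k. k *\<^sub>R (s - p))) (at t within {0..1})"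
            by (auto intro!: derivative_eq_intros)
          have "((\<lambda>t. t * G (?x s t)) has_derivative
            (\<lambda>k. t * ((k *\<^sub>R (s - p)) $ 1 *\<^sub>R pd 1 G (?x s t) + (k *\<^sub>R (s - p)) $ 2 *\<^sub>R pd 2 G (?x s t))
              + k * G (?x s t))) (at t within {0..1})"
            by (rule has_derivative_mult[OF has_derivative_ident has_derivative_compose[OF inner D[OF that x[OF s t]]]])
          then show "((\<lambda>t. t * G (?x s t)) has_vector_derivative
            G (?x s t) + t * (pd 1 G (?x s t) * (s - p) $ 1 + pd 2 G (?x s t) * (s - p) $ 2))
            (at t within {0..1})"
            unfolding has_vector_derivative_def
            by (rule has_derivative_eq_rhs) (simp add: fun_eq_iff algebra_simps)
        qed simp
        then show ?thesis by simp
      qed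
      \<comment> \<open>Closedness exchanges the mixed terms of \<open>A\<close> and
        \<open>B\<close>, which makes them the derivatives in t of t times \<open>P\<close> and of t
        times \<open>Q\<close> along the segment.\<close>
      have "(A s has_integral P s) (cbox 0 1)"
        by (rule has_integral_eq[OF _ I[OF P]]) (simp add: A_def closed x[OF s] del: mem_box)
      moreover have "(B s has_integral Q s) (cbox 0 1)"
        by (rule has_integral_eq[OF _ I[OF Q]]) (simp add: B_def closed[symmetric] x[OF s] del: mem_box)
      ultimately show ?thesis
        unfolding f'_def by (intro has_integral_add has_integral_scaleR_left)
    qed
    ultimately have "(f has_derivative blinfun_apply (P s *\<^sub>R b 1 + Q s *\<^sub>R b 2)) (at s within V)"
      by (simp add: integral_unique)
    then have "(f has_derivative blinfun_apply (P s *\<^sub>R b 1 + Q s *\<^sub>R b 2)) (at s)"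
      using at_within_open[OF s V(1)] by simp
    then show ?thesis
      by (rule has_derivative_eq_rhs) (simp add: fun_eq_iff b blinfun.add_left blinfun.scaleR_left)
  qed
  have pdf: "pd 1 f s = P s" "pd 2 f s = Q s" if "s \<in> V" for s
    using pd_eqI[OF f[OF that]] by (simp_all add: axis_def)
  have "smooth_on V (pd i f)" for i
    using smooth_on_congI[OF V(1) P pdf(1)] smooth_on_congI[OF V(1) Q pdf(2)] exhaust_2[of i] by metis
  then have "smooth_on V f"
    by (rule smooth_onI_pd[rotated]) (use f in \<open>auto simp: differentiable_def\<close>)
  with pdf show ?thesis by blast
qed

section \<open>Smooth dependence of a simple root of a cubic\<close>

text \<open>Where \<open>h\<close> vanishes, the product rule asks only for continuity of
  \<open>k\<close>. This breaks the circle in the implicit function argument, where \<open>k\<close>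
  contains the very root whose differentiability is in question.\<close>

lemma has_derivative_mult_vanishing:
  fixes h k :: "'a::real_normed_vector \<Rightarrow> real"
  assumes h: "(h has_derivative D) (at x)" "h x = 0" and k: "isCont k x"
  shows "((\<lambda>y. h y * k y) has_derivative (\<lambda>v. D v * k x)) (at x)"
proof -
  interpret D: bounded_linear D by (rule has_derivative_bounded_linear[OF h(1)])
  obtain K where K: "\<And>v. norm (D v) \<le> norm v * K" using D.bounded by blast
  have kt: "((\<lambda>y. k y) \<longlongrightarrow> k x) (at x)" using k by (simp add: isCont_def)
  have "((\<lambda>y. (h y - D (y - x)) / norm (y - x) * k y) \<longlongrightarrow> 0 * k x) (at x)"
    using h by (intro tendsto_mult kt) (simp add: has_derivative_at_within divide_inverse_commute)
  moreover have "((\<lambda>y. D (y - x) / norm (y - x) * (k y - k x)) \<longlongrightarrow> 0) (at x)"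
  proof (rule Lim_null_comparison)
    show "((\<lambda>y. K * \<bar>k y - k x\<bar>) \<longlongrightarrow> 0) (at x)"
      using tendsto_mult[OF tendsto_const tendsto_rabs[OF tendsto_diff[OF kt tendsto_const]], of K "k x"]
      by simp
    have "norm (D (y - x) / norm (y - x) * (k y - k x)) \<le> K * \<bar>k y - k x\<bar>" if "y \<noteq> x" for y
    proof -
      have "\<bar>D (y - x)\<bar> / norm (y - x) \<le> K"
        using K[of "y - x"] that by (simp add: divide_le_eq mult.commute)
      from mult_right_mono[OF this, of "\<bar>k y - k x\<bar>"] show ?thesis by (simp add: abs_mult)
    qed
    then show "\<forall>\<^sub>F y in at x. norm (D (y - x) / norm (y - x) * (k y - k x)) \<le> K * \<bar>k y - k x\<bar>"
      by (auto simp: eventually_at_filter)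
  qed
  ultimately have "((\<lambda>y. (h y - D (y - x)) / norm (y - x) * k y
      + D (y - x) / norm (y - x) * (k y - k x)) \<longlongrightarrow> 0 * k x + 0) (at x)"
    by (rule tendsto_add)
  then have "((\<lambda>y. inverse (norm (y - x)) *\<^sub>R (h y * k y - h x * k x - D (y - x) * k x)) \<longlongrightarrow> 0) (at x)"
    by (simp add: h(2) divide_inverse algebra_simps)
  moreover have "bounded_linear (\<lambda>v. D v * k x)"
    by (rule bounded_linear_mult_const[OF D.bounded_linear_axioms])
  ultimately show ?thesis by (simp add: has_derivative_at_within)
qed

lemma implicit_cubic_root_pos:
  fixes a b c d :: "real^2 \<Rightarrow> real"
  assumes U: "open U" "s0 \<in> U"
    and sm: "smooth_on U a" "smooth_on U b" "smooth_on U c" "smooth_on U d"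
    and a0: "a s0 = 0" and b0: "b s0 > 0"
  shows "\<exists>W \<tau>. open W \<and> s0 \<in> W \<and> W \<subseteq> U \<and> smooth_on W \<tau> \<and> \<tau> s0 = 0 \<and>
    (\<forall>s\<in>W. a s + b s * \<tau> s + c s * \<tau> s ^ 2 + d s * \<tau> s ^ 3 = 0)"
proof -
  define \<beta> where "\<beta> = b s0 / 2"
  define M where "M = max \<bar>c s0\<bar> \<bar>d s0\<bar> + 1"
  \<comment> \<open>For arguments of modulus at most \<epsilon> the terms of \<open>q\<close> with
    \<open>c\<close> and \<open>d\<close> are bounded by 2 M \<epsilon> and 3 M \<epsilon>, together
    at most \<beta> / 2; hence the 10. The bound 1 keeps products of two arguments below
    \<epsilon>.\<close>
  define \<epsilon> where "\<epsilon> = min 1 (\<beta> / (10 * M))"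
  have \<beta>: "\<beta> > 0" "\<beta> < b s0" using b0 by (simp_all add: \<beta>_def)
  have M: "M > 0" "\<bar>c s0\<bar> < M" "\<bar>d s0\<bar> < M" by (auto simp: M_def)
  have \<epsilon>: "\<epsilon> > 0" "\<epsilon> \<le> 1" "10 * M * \<epsilon> \<le> \<beta>"
    using \<beta> M by (simp_all add: \<epsilon>_def min_def field_simps)
  have ct: "continuous_on U a" "continuous_on U b" "continuous_on U c" "continuous_on U d"
    using sm smooth_on_continuous by auto
  \<comment> \<open>The bound on \<open>a\<close> ensures that the cubic changes sign between
    -\<epsilon> and \<epsilon>.\<close>
  define W where "W = {s\<in>U. \<bar>a s\<bar> < \<epsilon> * \<beta> / 2 \<and> \<beta> < b s \<and> \<bar>c s\<bar> < M \<and> \<bar>d s\<bar> < M}"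
  have W: "open W" "W \<subseteq> U" "s0 \<in> W"
  proof -
    have "W = (U \<inter> (\<lambda>s. \<bar>a s\<bar>) -` {..<\<epsilon> * \<beta> / 2}) \<inter> (U \<inter> b -` {\<beta><..})
        \<inter> ((U \<inter> (\<lambda>s. \<bar>c s\<bar>) -` {..<M}) \<inter> (U \<inter> (\<lambda>s. \<bar>d s\<bar>) -` {..<M}))"
      by (auto simp: W_def)
    moreover have "open \<dots>"
      by (intro open_Int continuous_open_preimage[OF _ U(1)] continuous_on_rabs ct) auto
    ultimately show "open W" by simp
    show "W \<subseteq> U" by (auto simp: W_def)
    show "s0 \<in> W" using U a0 \<beta> M \<epsilon> by (simp add: W_def)
  qed
  define P where "P s t = a s + b s * t + c s * t ^ 2 + d s * t ^ 3" for s t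
  \<comment> \<open>The divided difference of the cubic in t; on the diagonal it is the
    derivative.\<close>
  define q where "q s t t' = b s + c s * (t + t') + d s * (t * t + t * t' + t' * t')" for s t t'
  have Pq: "P s t - P s t' = (t - t') * q s t t'" for s t t'
    by (simp add: P_def q_def power2_eq_square power3_eq_cube algebra_simps)
  have q: "q s t t' > \<beta> / 2" if "s \<in> W" "\<bar>t\<bar> \<le> \<epsilon>" "\<bar>t'\<bar> \<le> \<epsilon>" for s t t'
  proof -
    have "\<bar>t + t'\<bar> \<le> 2 * \<epsilon>" using that by linarith
    then have "\<bar>c s * (t + t')\<bar> \<le> M * (2 * \<epsilon>)"
      unfolding abs_mult using that(1) M by (intro mult_mono) (auto simp: W_def)
    moreover have "\<bar>x * y\<bar> \<le> \<epsilon>" if "\<bar>x\<bar> \<le> \<epsilon>" "\<bar>y\<bar> \<le> \<epsilon>" for x y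
      using mult_mono[of "\<bar>x\<bar>" \<epsilon> "\<bar>y\<bar>" 1] that \<epsilon> by (simp add: abs_mult)
    then have "\<bar>t * t + t * t' + t' * t'\<bar> \<le> 3 * \<epsilon>"
      using that(2,3) by (smt (verit, best))
    then have "\<bar>d s * (t * t + t * t' + t' * t')\<bar> \<le> M * (3 * \<epsilon>)"
      unfolding abs_mult using that(1) M by (intro mult_mono) (auto simp: W_def)
    moreover have "b s > \<beta>" using that by (simp add: W_def)
    ultimately show ?thesis using \<epsilon>(3) unfolding q_def by (simp add: abs_le_iff)
  qed
  have "\<exists>t. \<bar>t\<bar> \<le> \<epsilon> \<and> P s t = 0" if s: "s \<in> W" for s
  proof -
    have as: "\<bar>a s\<bar> < \<epsilon> * \<beta> / 2" using s by (simp add: W_def)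
    have "\<epsilon> * q s \<epsilon> 0 > \<epsilon> * (\<beta> / 2)" "\<epsilon> * q s (-\<epsilon>) 0 > \<epsilon> * (\<beta> / 2)"
      using q[OF s, of \<epsilon> 0] q[OF s, of "-\<epsilon>" 0] \<epsilon> by simp_all
    moreover have "P s \<epsilon> = a s + \<epsilon> * q s \<epsilon> 0" "P s (-\<epsilon>) = a s - \<epsilon> * q s (-\<epsilon>) 0"
      using Pq[of s \<epsilon> 0] Pq[of s "-\<epsilon>" 0] by (simp_all add: P_def)
    ultimately have "P s (-\<epsilon>) \<le> 0" "0 \<le> P s \<epsilon>" using as by (simp_all add: abs_less_iff)
    moreover have "continuous_on {-\<epsilon>..\<epsilon>} (P s)" unfolding P_def by (intro continuous_intros)
    ultimately obtain t where "-\<epsilon> \<le> t" "t \<le> \<epsilon>" "P s t = 0"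
      using IVT'[of "P s" "-\<epsilon>" 0 \<epsilon>] \<epsilon> by auto
    then show ?thesis by (intro exI[of _ t]) auto
  qed
  then obtain \<tau> where \<tau>: "\<And>s. s \<in> W \<Longrightarrow> \<bar>\<tau> s\<bar> \<le> \<epsilon>" "\<And>s. s \<in> W \<Longrightarrow> P s (\<tau> s) = 0" by metis
  have "\<tau> s0 * q s0 (\<tau> s0) 0 = 0"
    using Pq[of s0 "\<tau> s0" 0] \<tau>(2)[OF W(3)] a0 by (simp add: P_def)
  then have \<tau>0: "\<tau> s0 = 0" using q[OF W(3) \<tau>(1)[OF W(3)], of 0] \<epsilon> \<beta> by auto
  have der: "\<tau> differentiable at s"
    "pd i \<tau> s = - ((pd i a s + pd i b s * \<tau> s + pd i c s * (\<tau> s * \<tau> s) + pd i d s * (\<tau> s * \<tau> s * \<tau> s))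
      * inverse (q s (\<tau> s) (\<tau> s)))" if s: "s \<in> W" for s i
  proof -
    have df: "a differentiable at s" "b differentiable at s" "c differentiable at s" "d differentiable at s"
      using sm smooth_on_differentiable s W(2) by blast+
    \<comment> \<open>\<open>h\<close> freezes the root at its value in \<open>s\<close>. The
      increment of the root is then -h / q: a differentiable factor vanishing at \<open>s\<close>
      times a factor known only to be continuous.\<close>
    define h where "h y = a y + b y * \<tau> s + c y * (\<tau> s * \<tau> s) + d y * (\<tau> s * \<tau> s * \<tau> s)" for y
    have h0: "h s = 0" using \<tau>(2)[OF s] by (simp add: h_def P_def power2_eq_square power3_eq_cube)
    note cm = differentiable_mult[OF _ differentiable_const]
    have dh: "h differentiable at s"
      unfolding h_def by (intro differentiable_add cm df)
    have ph: "pd i h s = pd i a s + pd i b s * \<tau> s + pd i c s * (\<tau> s * \<tau> s) + pd i d s * (\<tau> s * \<tau> s * \<tau> s)" for i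
      unfolding h_def by (simp add: pd_add pd_mult pd_const df differentiable_add cm)
    have eq: "(\<tau> y - \<tau> s) * q y (\<tau> y) (\<tau> s) = - h y" if "y \<in> W" for y
      using Pq[of y "\<tau> y" "\<tau> s"] \<tau>(2)[OF that]
      by (simp add: h_def P_def power2_eq_square power3_eq_cube)
    have ev: "\<forall>\<^sub>F y in at s. y \<in> W" using W(1) s eventually_at_topological by blast
    have "(\<tau> \<longlongrightarrow> \<tau> s) (at s)"
    proof (rule LIM_zero_cancel, rule Lim_null_comparison)
      have "isCont h s" using dh by (rule differentiable_imp_continuous_within)
      then have "(h \<longlongrightarrow> 0) (at s)" using h0 by (simp add: isCont_def)
      from tendsto_mult[OF tendsto_const tendsto_rabs[OF this], of "2 / \<beta>"]
      show "((\<lambda>y. 2 / \<beta> * \<bar>h y\<bar>) \<longlongrightarrow> 0) (at s)" by simp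
      have "norm (\<tau> y - \<tau> s) \<le> 2 / \<beta> * \<bar>h y\<bar>" if "y \<in> W" for y
      proof -
        have "\<bar>\<tau> y - \<tau> s\<bar> * (\<beta> / 2) \<le> \<bar>\<tau> y - \<tau> s\<bar> * \<bar>q y (\<tau> y) (\<tau> s)\<bar>"
          using q[OF that \<tau>(1)[OF that] \<tau>(1)[OF s]] by (intro mult_left_mono) auto
        also have "\<dots> = \<bar>h y\<bar>" using eq[OF that] by (metis abs_minus_cancel abs_mult)
        finally show ?thesis using \<beta> by (simp add: field_simps)
      qed
      then show "\<forall>\<^sub>F y in at s. norm (\<tau> y - \<tau> s) \<le> 2 / \<beta> * \<bar>h y\<bar>"
        by (rule eventually_mono[OF ev])
    qed
    then have cont: "isCont \<tau> s" by (simp add: isCont_def)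
    have nz: "q s (\<tau> s) (\<tau> s) \<noteq> 0" using q[OF s \<tau>(1)[OF s] \<tau>(1)[OF s]] \<beta> by auto
    define k where "k y = - inverse (q y (\<tau> y) (\<tau> s))" for y
    have "isCont b s" "isCont c s" "isCont d s"
      using df differentiable_imp_continuous_within by blast+
    then have "isCont (\<lambda>y. q y (\<tau> y) (\<tau> s)) s" unfolding q_def by (intro continuous_intros cont)
    then have ck: "isCont k s" unfolding k_def using nz by (intro continuous_intros) auto
    have "(h has_derivative frechet_derivative h (at s)) (at s)"
      using dh frechet_derivative_works by blast
    note has_derivative_mult_vanishing[OF this h0 ck]
    from has_derivative_add[OF has_derivative_const this, of "\<tau> s"]
    have "((\<lambda>y. \<tau> s + h y * k y) has_derivative (\<lambda>v. frechet_derivative h (at s) v * k s)) (at s)"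
      by simp
    moreover have "\<tau> s + h y * k y = \<tau> y" if "y \<in> W" for y
    proof -
      have "q y (\<tau> y) (\<tau> s) \<noteq> 0" using q[OF that \<tau>(1)[OF that] \<tau>(1)[OF s]] \<beta> by auto
      then show ?thesis using eq[OF that] by (simp add: k_def field_simps)
    qed
    ultimately have D: "(\<tau> has_derivative (\<lambda>v. frechet_derivative h (at s) v * k s)) (at s)"
      using has_derivative_transform_within_open[OF _ W(1) s] by blast
    then show "\<tau> differentiable at s" by (auto simp: differentiable_def)
    show "pd i \<tau> s = - ((pd i a s + pd i b s * \<tau> s + pd i c s * (\<tau> s * \<tau> s) + pd i d s * (\<tau> s * \<tau> s * \<tau> s))
      * inverse (q s (\<tau> s) (\<tau> s)))"
      using pd_eqI[OF D] ph[of i] by (simp add: k_def pd_def)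
  qed
  \<comment> \<open>Bootstrapping: the formula for \<open>pd i \<tau>\<close> involves only
    \<open>\<tau>\<close> and smooth coefficients, so each order of regularity yields the
    next.\<close>
  have "Ck_on k W \<tau>" for k
  proof (induction k)
    case 0
    then show ?case
      using der(1) by (auto intro!: continuous_at_imp_continuous_on differentiable_imp_continuous_within)
  next
    case (Suc k)
    note M = Ck_on_scaleR[OF W(1), where 'a = real, unfolded real_scaleR_def]
    have smW: "Ck_on k W a" "Ck_on k W b" "Ck_on k W c" "Ck_on k W d"
      "Ck_on k W (pd i a)" "Ck_on k W (pd i b)" "Ck_on k W (pd i c)" "Ck_on k W (pd i d)" for i
      using sm smooth_on_pd[of U a i] smooth_on_pd[of U b i] smooth_on_pd[of U c i]
        smooth_on_pd[of U d i] Ck_on_subset[OF _ W(2)] unfolding smooth_on_def by blast+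
    have nz: "q s (\<tau> s) (\<tau> s) \<noteq> 0" if "s \<in> W" for s
      using q[OF that \<tau>(1)[OF that] \<tau>(1)[OF that]] \<beta> by auto
    have "Ck_on k W (\<lambda>s. q s (\<tau> s) (\<tau> s))"
      unfolding q_def by (intro Ck_on_add[OF W(1)] M smW Suc)
    from Ck_on_inverse[OF W(1) nz this]
    have N: "Ck_on k W (\<lambda>s. - ((pd i a s + pd i b s * \<tau> s + pd i c s * (\<tau> s * \<tau> s) + pd i d s * (\<tau> s * \<tau> s * \<tau> s))
      * inverse (q s (\<tau> s) (\<tau> s))))" for i
      by (intro Ck_on_minus[OF W(1)] Ck_on_add[OF W(1)] M smW Suc)
    have "Ck_on k W (pd i \<tau>)" for i
      by (rule iffD2[OF Ck_on_cong[OF W(1) der(2)] N])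
    then show ?case using der(1) by simp
  qed
  then show ?thesis using W \<tau>0 \<tau>(2) unfolding smooth_on_def P_def by blast
qed

lemma implicit_cubic_root:
  fixes a b c d :: "real^2 \<Rightarrow> real"
  assumes U: "open U" "s0 \<in> U"
    and sm: "smooth_on U a" "smooth_on U b" "smooth_on U c" "smooth_on U d"
    and a0: "a s0 = 0" and b0: "b s0 \<noteq> 0"
  shows "\<exists>W \<tau>. open W \<and> s0 \<in> W \<and> W \<subseteq> U \<and> smooth_on W \<tau> \<and> \<tau> s0 = 0 \<and>
    (\<forall>s\<in>W. a s + b s * \<tau> s + c s * \<tau> s ^ 2 + d s * \<tau> s ^ 3 = 0)"
proof (cases "b s0 > 0")
  case True
  then show ?thesis using implicit_cubic_root_pos[OF U sm a0] by blast
next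
  case False
  note m = smooth_on_minus[OF U(1)]
  have "\<exists>W \<tau>. open W \<and> s0 \<in> W \<and> W \<subseteq> U \<and> smooth_on W \<tau> \<and> \<tau> s0 = 0 \<and>
    (\<forall>s\<in>W. - a s + - b s * \<tau> s + - c s * \<tau> s ^ 2 + - d s * \<tau> s ^ 3 = 0)"
    using implicit_cubic_root_pos[OF U m[OF sm(1)] m[OF sm(2)] m[OF sm(3)] m[OF sm(4)]] False a0 b0
    by simp
  moreover have "- a s + - b s * t + - c s * t ^ 2 + - d s * t ^ 3
      = - (a s + b s * t + c s * t ^ 2 + d s * t ^ 3)" for s t by simp
  ultimately show ?thesis by (metis neg_equal_0_iff_equal)
qed

section \<open>Local injectivity of a pair of functions\<close>

lemma locally_injective_pair:
  fixes \<xi> \<eta> :: "real^2 \<Rightarrow> real"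
  assumes V: "open V" "a \<in> V" and sm: "smooth_on V \<xi>" "smooth_on V \<eta>"
    and det: "pd 1 \<xi> a * pd 2 \<eta> a - pd 2 \<xi> a * pd 1 \<eta> a \<noteq> 0"
  shows "\<exists>e>0. ball a e \<subseteq> V \<and> inj_on (\<lambda>s. (\<xi> s, \<eta> s)) (ball a e)"
proof -
  define f' where "f' s h = (h $ 1 *\<^sub>R pd 1 \<xi> s + h $ 2 *\<^sub>R pd 2 \<xi> s, h $ 1 *\<^sub>R pd 1 \<eta> s + h $ 2 *\<^sub>R pd 2 \<eta> s)"
    for s and h :: "real^2"
  define \<Delta> where "\<Delta> = pd 1 \<xi> a * pd 2 \<eta> a - pd 2 \<xi> a * pd 1 \<eta> a"
  \<comment> \<open>The columns of the inverse Jacobian matrix at \<open>a\<close>.\<close>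
  define A B :: "real^2" where "A = vector [pd 2 \<eta> a / \<Delta>, - pd 1 \<eta> a / \<Delta>]"
    and "B = vector [- pd 2 \<xi> a / \<Delta>, pd 1 \<xi> a / \<Delta>]"
  define g' :: "real \<times> real \<Rightarrow> real^2" where "g' z = fst z *\<^sub>R A + snd z *\<^sub>R B" for z
  have "linear g'" by (simp add: linear_iff g'_def algebra_simps)
  then have bl: "bounded_linear g'" by (simp add: linear_conv_bounded_linear)
  have gf: "g' \<circ> f' a = id"
  proof
    fix h :: "real^2"
    have e: "(h $ 1 * pd 1 \<xi> a + h $ 2 * pd 2 \<xi> a) * pd 2 \<eta> a - (h $ 1 * pd 1 \<eta> a + h $ 2 * pd 2 \<eta> a) * pd 2 \<xi> a
      = h $ 1 * \<Delta>"
      "(h $ 1 * pd 1 \<eta> a + h $ 2 * pd 2 \<eta> a) * pd 1 \<xi> a - (h $ 1 * pd 1 \<xi> a + h $ 2 * pd 2 \<xi> a) * pd 1 \<eta> a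
      = h $ 2 * \<Delta>" by (simp_all add: \<Delta>_def algebra_simps)
    have "g' (f' a h) $ 1 = h $ 1 * \<Delta> / \<Delta>" "g' (f' a h) $ 2 = h $ 2 * \<Delta> / \<Delta>"
      unfolding e[symmetric] g'_def f'_def A_def B_def
      by (simp_all add: vector_2 add_divide_distrib diff_divide_distrib algebra_simps)
    then show "(g' \<circ> f' a) h = id h"
      using det by (simp add: \<Delta>_def[symmetric] vec_eq_iff forall_2)
  qed
  have der: "((\<lambda>s. (\<xi> s, \<eta> s)) has_derivative f' s) (at s)" if "s \<in> V" for s
    unfolding f'_def
    by (rule has_derivative_Pair has_derivative_pd[OF smooth_on_differentiable[OF sm(1) that]]
        has_derivative_pd[OF smooth_on_differentiable[OF sm(2) that]])+
  have small: "\<exists>d>0. \<forall>x. dist a x < d \<longrightarrow> onorm (\<lambda>v. f' x v - f' a v) < e" if e: "e > 0" for e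
  proof -
    define \<delta> where "\<delta> x = \<bar>pd 1 \<xi> x - pd 1 \<xi> a\<bar> + \<bar>pd 2 \<xi> x - pd 2 \<xi> a\<bar>
      + (\<bar>pd 1 \<eta> x - pd 1 \<eta> a\<bar> + \<bar>pd 2 \<eta> x - pd 2 \<eta> a\<bar>)" for x
    have le: "onorm (\<lambda>v. f' x v - f' a v) \<le> \<delta> x" for x
    proof (rule onorm_le)
      fix v :: "real^2"
      have h: "\<bar>v $ i * p\<bar> \<le> norm v * \<bar>p\<bar>" for i p
        unfolding abs_mult by (rule mult_right_mono[OF component_le_norm_cart abs_ge_zero])
      have "f' x v - f' a v = (v $ 1 * (pd 1 \<xi> x - pd 1 \<xi> a) + v $ 2 * (pd 2 \<xi> x - pd 2 \<xi> a),
        v $ 1 * (pd 1 \<eta> x - pd 1 \<eta> a) + v $ 2 * (pd 2 \<eta> x - pd 2 \<eta> a))"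
        by (simp add: f'_def right_diff_distrib)
      also have "norm \<dots> \<le> \<bar>v $ 1 * (pd 1 \<xi> x - pd 1 \<xi> a) + v $ 2 * (pd 2 \<xi> x - pd 2 \<xi> a)\<bar>
        + \<bar>v $ 1 * (pd 1 \<eta> x - pd 1 \<eta> a) + v $ 2 * (pd 2 \<eta> x - pd 2 \<eta> a)\<bar>"
        unfolding real_norm_def[symmetric] by (rule norm_Pair_le)
      also have "\<dots> \<le> (\<bar>v $ 1 * (pd 1 \<xi> x - pd 1 \<xi> a)\<bar> + \<bar>v $ 2 * (pd 2 \<xi> x - pd 2 \<xi> a)\<bar>)
        + (\<bar>v $ 1 * (pd 1 \<eta> x - pd 1 \<eta> a)\<bar> + \<bar>v $ 2 * (pd 2 \<eta> x - pd 2 \<eta> a)\<bar>)"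
        by (intro add_mono abs_triangle_ineq)
      also have "\<dots> \<le> norm v * \<delta> x"
        unfolding \<delta>_def distrib_left by (intro add_mono h)
      finally show "norm (f' x v - f' a v) \<le> \<delta> x * norm v" by (simp add: mult.commute)
    qed
    have cp: "continuous_on V (pd i \<xi>)" "continuous_on V (pd i \<eta>)" for i
      by (intro smooth_on_continuous smooth_on_pd sm)+
    have "continuous_on V \<delta>"
      unfolding \<delta>_def[abs_def] by (intro continuous_intros cp)
    from continuous_open_preimage[OF this V(1), of "{..<e}"]
    have "open (V \<inter> \<delta> -` {..<e})" by simp
    moreover have "a \<in> V \<inter> \<delta> -` {..<e}" using V(2) e by (simp add: \<delta>_def)
    ultimately obtain d where "d > 0" "ball a d \<subseteq> V \<inter> \<delta> -` {..<e}" by (rule openE)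
    then have "\<delta> x < e" if "dist a x < d" for x using that by auto
    then have "onorm (\<lambda>v. f' x v - f' a v) < e" if "dist a x < d" for x
      using le[of x] that by (meson le_less_trans)
    with \<open>d > 0\<close> show ?thesis by blast
  qed
  obtain e where "e > 0" "ball a e \<subseteq> V" "inj_on (\<lambda>s. (\<xi> s, \<eta> s)) (ball a e)"
    by (rule has_derivative_locally_injective[OF V(2,1) bl gf der small])
  then show ?thesis by blast
qed

section \<open>The characteristic web\<close>

lemma smooth_on_tangent_mult:
  assumes S: "centroaffine_surface r U" and W: "open W" "W \<subseteq> U"
    and v: "\<And>i. smooth_on W (\<lambda>s. v s $ i)" and w: "\<And>i. smooth_on W (\<lambda>s. w s $ i)"
  shows "smooth_on W (\<lambda>s. tangent_mult r s (v s) (w s) $ k)"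
proof -
  have U: "open U" using S by (simp add: centroaffine_surface_def)
  have "smooth_on U (\<lambda>s. difference_tensor r s k i j)" for i j
    unfolding difference_tensor_def
    by (intro smooth_on_diff smooth_on_levi_civita smooth_on_centroaffine[OF S] U centroaffine_det[OF S])
  note C = smooth_on_subset[OF this W(2)]
  show ?thesis
    unfolding tangent_mult_def sum_2 vec_lambda_beta
    by (intro smooth_on_add smooth_on_mult C v w W)
qed

lemma char_vec_iff:
  assumes "centroaffine_surface r U" "flat_metric r U" "s \<in> U"
  shows "tangent_algebra.char_vec (tangent_mult r s) v \<longleftrightarrow> characteristic_vector r s v"
  unfolding characteristic_vector_iff[OF assms]
    tangent_algebra.char_vec_def[OF tangent_algebra_ca[OF assms]] ..

text \<open>For directions \<open>u + t v\<close> near \<open>u\<close>, being characteristic is a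
  cubic equation in t with root 0 at \<open>s0\<close>. Its linear coefficient there is
  \<open>(lam u u - c u) * area u v\<close>, which \<open>lam_self\<close> shows to be nonzero, so
  the root continues smoothly.\<close>

lemma characteristic_field:
  assumes S: "centroaffine_surface r U" and flat: "flat_metric r U" and s0: "s0 \<in> U"
    and uvw: "characteristic_vector r s0 u" "characteristic_vector r s0 v" "characteristic_vector r s0 w"
    and ar: "area u v \<noteq> 0" "area v w \<noteq> 0" "area u w \<noteq> 0"
  shows "\<exists>W z. open W \<and> s0 \<in> W \<and> W \<subseteq> U \<and> z s0 = u \<and> (\<forall>i. smooth_on W (\<lambda>s. z s $ i)) \<and>
    (\<forall>s\<in>W. characteristic_vector r s (z s))"
proof -
  have U: "open U" using S by (simp add: centroaffine_surface_def)
  let ?m = "tangent_mult r"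
  define k0 k1 k2 k3 where "k0 s = area (?m s u u) u"
    and "k1 s = area (?m s u u) v + 2 * area (?m s u v) u"
    and "k2 s = 2 * area (?m s u v) v + area (?m s v v) u"
    and "k3 s = area (?m s v v) v" for s
  have sm: "smooth_on U (\<lambda>s. area (?m s x y) z)" for x y z
    unfolding area_def
    by (intro smooth_on_diff smooth_on_mult smooth_on_tangent_mult[OF S U subset_refl] smooth_on_const U)
  have sm: "smooth_on U k0" "smooth_on U k1" "smooth_on U k2" "smooth_on U k3"
    unfolding k0_def[abs_def] k1_def[abs_def] k2_def[abs_def] k3_def[abs_def]
    by (intro sm smooth_on_add smooth_on_mult smooth_on_const U)+
  have cubic: "area (?m s (u + t *\<^sub>R v) (u + t *\<^sub>R v)) (u + t *\<^sub>R v)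
      = k0 s + k1 s * t + k2 s * t ^ 2 + k3 s * t ^ 3" if "s \<in> U" for s t
  proof -
    interpret tangent_algebra "?m s" "metric_form (ca_metric r) s"
      by (rule tangent_algebra_ca[OF S flat that])
    show ?thesis unfolding k0_def k1_def k2_def k3_def
      by (simp add: m_simps m_commute[of v u] area_add area_scaleR)
        (simp add: power2_eq_square power3_eq_cube algebra_simps)
  qed
  have "k0 s0 = 0 \<and> k1 s0 \<noteq> 0"
  proof -
    interpret tangent_algebra "?m s0" "metric_form (ca_metric r) s0"
      by (rule tangent_algebra_ca[OF S flat s0])
    have cv: "char_vec u" "char_vec v" "char_vec w"
      using uvw char_vec_iff[OF S flat s0] by simp_all
    have "k1 s0 = (lam u u - c u) * area u v"
      unfolding k1_def m_char[OF cv(1)] area_add area_scaleR area_self area_swap[of u v]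
      by (simp add: algebra_simps)
    moreover have "k0 s0 = 0" using cv(1) by (simp add: k0_def char_vec_def)
    ultimately show ?thesis using lam_self[OF cv ar] ar(1) by simp
  qed
  then obtain W \<tau> where W: "open W" "s0 \<in> W" "W \<subseteq> U" "smooth_on W \<tau>" "\<tau> s0 = 0"
    "\<And>s. s \<in> W \<Longrightarrow> k0 s + k1 s * \<tau> s + k2 s * \<tau> s ^ 2 + k3 s * \<tau> s ^ 3 = 0"
    using implicit_cubic_root[OF U s0 sm] by blast
  have "smooth_on W (\<lambda>s. (u + \<tau> s *\<^sub>R v) $ i)" for i
    unfolding vector_add_component vector_scaleR_component real_scaleR_def
    by (intro smooth_on_add smooth_on_mult smooth_on_const W)
  moreover have "characteristic_vector r s (u + \<tau> s *\<^sub>R v)" if s: "s \<in> W" for s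
  proof -
    have sU: "s \<in> U" using s W(3) by blast
    have "area (u + \<tau> s *\<^sub>R v) v \<noteq> 0" using ar(1) by (simp add: area_add area_scaleR area_self)
    then have "u + \<tau> s *\<^sub>R v \<noteq> 0" using area_zero(1) by metis
    then show ?thesis
      unfolding characteristic_vector_iff[OF S flat sU] cubic[OF sU] using W(6)[OF s] by simp
  qed
  ultimately show ?thesis
    using W by (intro exI[of _ W] exI[of _ "\<lambda>s. u + \<tau> s *\<^sub>R v"]) auto
qed

text \<open>The locale fixes the algebra at one point; here the point becomes an argument, so that
  characters can be differentiated along the surface.\<close>

definition character :: "(real^2 \<Rightarrow> real^3) \<Rightarrow> real^2 \<Rightarrow> real^2 \<Rightarrow> real^2 \<Rightarrow> real" where
  "character r s = tangent_algebra.lam (tangent_mult r s)"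

lemma smooth_on_character:
  assumes S: "centroaffine_surface r U" and flat: "flat_metric r U" and W: "open W" "W \<subseteq> U"
    and v: "\<And>i. smooth_on W (\<lambda>s. v s $ i)" and ch: "\<And>s. s \<in> W \<Longrightarrow> v s \<noteq> 0"
  shows "smooth_on W (\<lambda>s. character r s (v s) x)"
proof -
  note sm = smooth_on_add smooth_on_mult smooth_on_diff smooth_on_const v W
    smooth_on_tangent_mult[OF S W]
  have ip: "smooth_on W (\<lambda>s. f s \<bullet> v s)" if "\<And>i. smooth_on W (\<lambda>s. f s $ i)" for f
    unfolding inner_vec_def inner_real_def sum_2 by (intro sm that)
  define c where "c s = tangent_mult r s (v s) (axis 1 1) $ 1 + tangent_mult r s (v s) (axis 2 1) $ 2
     - (tangent_mult r s (v s) (v s) \<bullet> v s) / (v s \<bullet> v s)" for s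
  have "smooth_on W (\<lambda>s. (tangent_mult r s (v s) (v s) \<bullet> v s) / (v s \<bullet> v s))"
    by (rule smooth_on_divide[OF W(1) ip ip]) (auto intro: sm simp: ch)
  then have "smooth_on W c" unfolding c_def[abs_def] by (intro sm)
  then have "smooth_on W (\<lambda>s. (tangent_mult r s (v s) x - c s *\<^sub>R x) $ i)" for i
    unfolding vector_minus_component vector_scaleR_component real_scaleR_def by (intro sm)
  then have "smooth_on W (\<lambda>s. ((tangent_mult r s (v s) x - c s *\<^sub>R x) \<bullet> v s) / (v s \<bullet> v s))"
    by (intro smooth_on_divide[OF W(1) ip ip] v) (auto simp: ch)
  then show ?thesis
  proof (rule smooth_on_congI[OF W(1)])
    fix s assume "s \<in> W"
    then have T: "tangent_algebra (tangent_mult r s) (metric_form (ca_metric r) s)"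
      using tangent_algebra_ca[OF S flat] W(2) by blast
    show "character r s (v s) x = ((tangent_mult r s (v s) x - c s *\<^sub>R x) \<bullet> v s) / (v s \<bullet> v s)"
      unfolding character_def c_def tangent_algebra.lam_def[OF T] tangent_algebra.c_def[OF T] ..
  qed
qed

lemma character_linear:
  assumes S: "centroaffine_surface r U" and flat: "flat_metric r U" and s: "s \<in> U"
  shows "character r s v (x *\<^sub>R y + x' *\<^sub>R y') = x * character r s v y + x' * character r s v y'"
  unfolding character_def
    tangent_algebra.lam_add[OF tangent_algebra_ca[OF assms]]
    tangent_algebra.lam_scaleR[OF tangent_algebra_ca[OF assms]] ..

lemma pd_character:
  assumes S: "centroaffine_surface r U" and flat: "flat_metric r U" and W: "open W" "W \<subseteq> U" "s \<in> W"
    and v: "\<And>i. smooth_on W (\<lambda>s. v s $ i)" and ch: "\<And>s. s \<in> W \<Longrightarrow> characteristic_vector r s (v s)"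
    and three: "characteristic_vector r s x" "characteristic_vector r s y"
      "area (v s) x \<noteq> 0" "area x y \<noteq> 0" "area (v s) y \<noteq> 0"
  shows "pd 1 (\<lambda>s. character r s (v s) (axis 2 1)) s = pd 2 (\<lambda>s. character r s (v s) (axis 1 1)) s"
proof -
  have s: "s \<in> U" using W by blast
  have nz: "v s \<noteq> 0" if "s \<in> W" for s using ch[OF that] by (simp add: characteristic_vector_def)
  define L where "L i s = character r s (v s) (axis i 1)" for i s
  have Ld: "L i differentiable at s" for i
    unfolding L_def[abs_def]
    by (rule smooth_on_differentiable[OF smooth_on_character[OF S flat W(1,2) v nz] W(3)])
  have lin: "character r t w z = z $ 1 * character r t w (axis 1 1) + z $ 2 * character r t w (axis 2 1)"
    if "t \<in> U" for t w z
  proof -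
    have "z = z $ 1 *\<^sub>R axis 1 1 + z $ 2 *\<^sub>R axis 2 1"
      by (simp add: vec_eq_iff forall_2 axis_def)
    then show ?thesis using character_linear[OF S flat that] by metis
  qed
  have axm: "tangent_mult r t (axis i 1) (axis j 1) $ k = difference_tensor r t k i j" for t i j k
    using exhaust_2[of i] exhaust_2[of j] by (auto simp: tangent_mult_def sum_2 axis_def)
  have axg: "metric_form (ca_metric r) t (axis i 1) (axis j 1) = ca_metric r t $ i $ j" for t i j
    using exhaust_2[of i] exhaust_2[of j] by (auto simp: metric_form_def sum_2 axis_def)
  interpret T: tangent_algebra "tangent_mult r s" "metric_form (ca_metric r) s"
    by (rule tangent_algebra_ca[OF S flat s])
  have cv: "T.char_vec (v s)" "T.char_vec x" "T.char_vec y"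
    using three ch[OF W(3)] char_vec_iff[OF S flat s] by simp_all
  have "pd 1 (L 2) s = pd 2 (L 1) s"
  proof (rule character_closed[OF S flat W Ld])
    fix t i j assume t: "t \<in> W"
    then have tU: "t \<in> U" using W by blast
    interpret tangent_algebra "tangent_mult r t" "metric_form (ca_metric r) t"
      by (rule tangent_algebra_ca[OF S flat tU])
    have "char_vec (v t)" using ch[OF t] char_vec_iff[OF S flat tU] by simp
    from lam_character[OF this, of "axis i 1" "axis j 1"]
    show "L i t * L j t = difference_tensor r t 1 i j * L 1 t + difference_tensor r t 2 i j * L 2 t
        + ca_metric r t $ i $ j"
      unfolding character_def[symmetric] lin[OF tU, of _ "tangent_mult r t _ _"] axm axg L_def .
  next
    fix i l
    have axis: "(axis i 1 :: real^2) $ l = (if l = i then 1 else 0)" by (simp add: axis_def)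
    have "tangent_mult r s (v s) (axis i 1) $ l
        = (T.c (v s) *\<^sub>R axis i 1 + character r s (v s) (axis i 1) *\<^sub>R v s) $ l"
      unfolding character_def using T.m_char[OF cv(1)] by simp
    moreover have "tangent_mult r s (v s) (axis i 1) $ l
        = difference_tensor r s l i 1 * v s $ 1 + difference_tensor r s l i 2 * v s $ 2"
      using exhaust_2[of i] flat_structure(1)[OF S flat s, of l 1 2]
      by (auto simp: tangent_mult_def sum_2 axis_def)
    ultimately show "difference_tensor r s l i 1 * v s $ 1 + difference_tensor r s l i 2 * v s $ 2
        = (if l = i then T.c (v s) else 0) + L i s * v s $ l"
      using axis by (simp add: L_def split: if_splits)
  next
    show "L 1 s * v s $ 1 + L 2 s * v s $ 2 \<noteq> T.c (v s)"
      using T.lam_self[OF cv three(3-5)] lin[OF s, of "v s" "v s"]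
      by (simp add: L_def character_def mult.commute)
  qed
  then show ?thesis unfolding L_def[abs_def] .
qed

section \<open>From three potentials to a hexagonal web\<close>

text \<open>Each foliation is cut out by the difference of the two other potentials, and the signs
  are chosen so that the first difference minus the second is the third. One-dimensionality of the
  kernels keeps the differentials from vanishing.\<close>

lemma hexagonalI:
  fixes f :: "3 \<Rightarrow> real^2 \<Rightarrow> real"
  assumes V: "open V" and f: "\<And>i. smooth_on V (f i)"
    and ker: "\<And>s. s \<in> V \<Longrightarrow> L 1 s = ker_differential (\<lambda>s. f 2 s - f 3 s) s"
      "\<And>s. s \<in> V \<Longrightarrow> L 2 s = ker_differential (\<lambda>s. f 1 s - f 3 s) s"
      "\<And>s. s \<in> V \<Longrightarrow> L 3 s = ker_differential (\<lambda>s. f 2 s - f 1 s) s"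
    and dim: "\<And>s i. s \<in> V \<Longrightarrow> \<exists>v. v \<noteq> 0 \<and> L i s = span {v}"
    and distinct: "\<And>s i j. s \<in> V \<Longrightarrow> i \<noteq> j \<Longrightarrow> L i s \<noteq> L j s"
  shows "hexagonal V L"
  unfolding hexagonal_def
proof
  have sm: "smooth_on V (\<lambda>s. f i s - f j s)" for i j by (intro smooth_on_diff V f)
  define h where "h = (\<lambda>i::3. if i = 1 then (\<lambda>s. f 2 s - f 3 s) else if i = 2 then (\<lambda>s. f 1 s - f 3 s)
    else (\<lambda>s. f 2 s - f 1 s))"
  have h: "smooth_on V (h i)" for i using sm by (simp add: h_def)
  have kh: "L i s = ker_differential (h i) s" if "s \<in> V" for i s
    using ker[OF that] exhaust_3[of i] by (auto simp: h_def)
  have "L i s \<noteq> UNIV" if s: "s \<in> V" for i s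
  proof -
    obtain v where v: "L i s = span {v}" using dim[OF s] by blast
    have False if "L i s = UNIV"
    proof -
      have "axis 1 1 \<in> span {v}" "axis 2 1 \<in> span {v}" using that v by auto
      then obtain k k' where "axis 1 1 = k *\<^sub>R v" "axis 2 1 = k' *\<^sub>R v"
        unfolding span_singleton by blast
      then have "area (axis 1 1) (axis 2 1) = 0" by (simp add: area_scaleR area_self)
      then show ?thesis by (simp add: area_def axis_def)
    qed
    then show ?thesis by blast
  qed
  then have fd0: "frechet_derivative (h i) (at s) \<noteq> (\<lambda>v. 0)" if "s \<in> V" for i s
    using kh[OF that, of i] that unfolding ker_differential_def by force
  then have "foliation V (L i)" for i
    unfolding foliation_def using V h kh fd0 by (intro ballI exI[of _ V] exI[of _ "h i"]) simp
  then show "three_web V L" unfolding three_web_def using V distinct by blast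
  show "\<forall>s\<in>V. \<exists>W \<xi> \<eta>. s \<in> W \<and> W \<subseteq> V \<and> local_coordinates W \<xi> \<eta> \<and>
      (\<forall>t\<in>W. L 1 t = ker_differential \<xi> t \<and> L 2 t = ker_differential \<eta> t \<and>
        L 3 t = ker_differential (\<lambda>x. \<xi> x - \<eta> x) t)"
  proof
    fix s assume s: "s \<in> V"
    have jac: "pd 1 (h 1) t * pd 2 (h 2) t - pd 2 (h 1) t * pd 1 (h 2) t \<noteq> 0" if t: "t \<in> V" for t
    proof
      assume 0: "pd 1 (h 1) t * pd 2 (h 2) t - pd 2 (h 1) t * pd 1 (h 2) t = 0"
      have fd: "frechet_derivative (h i) (at t) = (\<lambda>v. v $ 1 *\<^sub>R pd 1 (h i) t + v $ 2 *\<^sub>R pd 2 (h i) t)" for i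
        using frechet_derivative_at[OF has_derivative_pd[OF smooth_on_differentiable[OF h t]]] by simp
      obtain v w where v: "v \<noteq> 0" "L 1 t = span {v}" and w: "w \<noteq> 0" "L 2 t = span {w}"
        using dim[OF t] by metis
      have "(pd 1 (h 1) t, pd 2 (h 1) t) \<noteq> (0, 0)"
        using fd0[OF t, of 1] by (auto simp: fd)
      \<comment> \<open>A tangent vector of the level curve of \<open>h 1\<close>. If the Jacobian
        vanished, it would lie in both kernels and two directions of the web would coincide.\<close>
      moreover define z :: "real^2" where "z = vector [- pd 2 (h 1) t, pd 1 (h 1) t]"
      ultimately have "z \<noteq> 0" by (auto simp: vec_eq_iff forall_2 vector_2)
      have "z \<in> L 1 t" "z \<in> L 2 t"
        using 0 unfolding kh[OF t] ker_differential_def fd z_def by (auto simp: vector_2 algebra_simps)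
      then obtain k k' where k: "z = k *\<^sub>R v" "z = k' *\<^sub>R w"
        unfolding v(2) w(2) span_singleton by blast
      with \<open>z \<noteq> 0\<close> have "k \<noteq> 0" "k' \<noteq> 0" by auto
      moreover have "k * (k' * area v w) = area z z"
        using area_scaleR(1)[of k v z] area_scaleR(2)[of v k' w] k by simp
      ultimately have "area v w = 0" by (simp add: area_self)
      then have "L 1 t = L 2 t" using span_eq_iff_area[OF v(1) w(1)] v(2) w(2) by simp
      then show False using distinct[OF t, of 1 2] by simp
    qed
    obtain e where e: "e > 0" "ball s e \<subseteq> V" "inj_on (\<lambda>s. (h 1 s, h 2 s)) (ball s e)"
      using locally_injective_pair[OF V s h h jac[OF s]] by blast
    have "local_coordinates (ball s e) (h 1) (h 2)"
      unfolding local_coordinates_def using e h smooth_on_subset jac by blast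
    moreover have "(\<lambda>x. h 1 x - h 2 x) = h 3" by (simp add: h_def fun_eq_iff)
    ultimately show "\<exists>W \<xi> \<eta>. s \<in> W \<and> W \<subseteq> V \<and> local_coordinates W \<xi> \<eta> \<and>
      (\<forall>t\<in>W. L 1 t = ker_differential \<xi> t \<and> L 2 t = ker_differential \<eta> t \<and>
        L 3 t = ker_differential (\<lambda>x. \<xi> x - \<eta> x) t)"
      using e kh by (intro exI[of _ "ball s e"] exI[of _ "h 1"] exI[of _ "h 2"]) (auto simp: subset_eq)
  qed
qed

theorem theorem1:
  fixes r :: "real^2 \<Rightarrow> real^3" and U :: "(real^2) set"
  assumes "hyperbolic_surface r U"
    and "flat_metric r U"
    and "s0 \<in> U"
    and "card (characteristic_directions r s0) = 3"
  shows "\<exists>V L. s0 \<in> V \<and> V \<subseteq> U \<and> characteristic_web r V L \<and> hexagonal V L"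
proof -
  have S: "centroaffine_surface r U" using assms(1) by (simp add: hyperbolic_surface_def)
  have U: "open U" using S by (simp add: centroaffine_surface_def)
  note flat = assms(2) and s0 = assms(3)
  have nz: "v \<noteq> 0" if "characteristic_vector r s v" for s v
    using that by (simp add: characteristic_vector_def)
  obtain X1 X2 X3 where X: "characteristic_directions r s0 = {X1, X2, X3}" "X1 \<noteq> X2" "X2 \<noteq> X3" "X1 \<noteq> X3"
    using assms(4) by (auto simp: card_3_iff)
  then have "\<exists>v. X = span {v} \<and> characteristic_vector r s0 v" if "X \<in> {X1, X2, X3}" for X
    using that unfolding characteristic_directions_def by blast
  then obtain v1 v2 v3 where "X1 = span {v1}" "X2 = span {v2}" "X3 = span {v3}"
    and cv: "characteristic_vector r s0 v1" "characteristic_vector r s0 v2" "characteristic_vector r s0 v3"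
    by (metis insertI1 insertI2)
  then have ar: "area v1 v2 \<noteq> 0" "area v2 v3 \<noteq> 0" "area v1 v3 \<noteq> 0"
    using X span_eq_iff_area[OF nz nz] by metis+
  then have ra: "area v2 v1 \<noteq> 0" "area v3 v2 \<noteq> 0" "area v3 v1 \<noteq> 0"
    using area_swap[of v1 v2] area_swap[of v2 v3] area_swap[of v1 v3] by simp_all
  note field = characteristic_field[OF S flat s0]
  obtain W1 z1 where z1: "open W1" "s0 \<in> W1" "W1 \<subseteq> U" "z1 s0 = v1" "\<And>i. smooth_on W1 (\<lambda>s. z1 s $ i)"
    "\<And>s. s \<in> W1 \<Longrightarrow> characteristic_vector r s (z1 s)"
    using field[OF cv ar] by blast
  obtain W2 z2 where z2: "open W2" "s0 \<in> W2" "W2 \<subseteq> U" "z2 s0 = v2" "\<And>i. smooth_on W2 (\<lambda>s. z2 s $ i)"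
    "\<And>s. s \<in> W2 \<Longrightarrow> characteristic_vector r s (z2 s)"
    using field[OF cv(2,1,3) ra(1) ar(3,2)] by blast
  obtain W3 z3 where z3: "open W3" "s0 \<in> W3" "W3 \<subseteq> U" "z3 s0 = v3" "\<And>i. smooth_on W3 (\<lambda>s. z3 s $ i)"
    "\<And>s. s \<in> W3 \<Longrightarrow> characteristic_vector r s (z3 s)"
    using field[OF cv(3,1,2) ra(3) ar(1) ra(2)] by blast
  define z where "z = (\<lambda>i::3. if i = 1 then z1 else if i = 2 then z2 else z3)"
  define W where "W = W1 \<inter> W2 \<inter> W3"
  have W: "open W" "s0 \<in> W" "W \<subseteq> U" using z1 z2 z3 by (auto simp: W_def)
  have zs: "smooth_on W (\<lambda>s. z i s $ k)" for i k
    using smooth_on_subset[OF z1(5), of W] smooth_on_subset[OF z2(5), of W]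
      smooth_on_subset[OF z3(5), of W] by (auto simp: z_def W_def)
  have zc: "characteristic_vector r s (z i s)" if "s \<in> W" for i s
    using that z1(6) z2(6) z3(6) by (simp add: z_def W_def)
  \<comment> \<open>The three fields stay pairwise independent near \<open>s0\<close>, so the
    pointwise results on three directions apply there; within this set a ball is taken, as the
    construction of potentials requires.\<close>
  define W' where "W' = W \<inter> (\<Inter>(i, j)\<in>{(i, j). i \<noteq> j}. {s\<in>W. area (z i s) (z j s) \<noteq> 0})"
  have "open {s\<in>W. area (z i s) (z j s) \<noteq> 0}" for i j
  proof -
    have "continuous_on W (\<lambda>s. area (z i s) (z j s))"
      unfolding area_def by (intro continuous_intros smooth_on_continuous zs)
    then have "open (W \<inter> (\<lambda>s. area (z i s) (z j s)) -` (- {0}))"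
      by (rule continuous_open_preimage[OF _ W(1)]) auto
    also have "W \<inter> (\<lambda>s. area (z i s) (z j s)) -` (- {0}) = {s\<in>W. area (z i s) (z j s) \<noteq> 0}"
      by auto
    finally show ?thesis .
  qed
  then have "open W'" unfolding W'_def by (intro open_Int W(1) open_INT) auto
  moreover have "s0 \<in> W'"
  proof -
    have "area (z i s0) (z j s0) \<noteq> 0" if "i \<noteq> j" for i j
      using that ar ra z1(4) z2(4) z3(4) exhaust_3[of i] exhaust_3[of j] by (auto simp: z_def)
    then show ?thesis using W by (auto simp: W'_def)
  qed
  ultimately obtain e where e: "e > 0" "ball s0 e \<subseteq> W'" using openE by blast
  define V where "V = ball s0 e"
  have V: "open V" "s0 \<in> V" "V \<subseteq> W" "V \<subseteq> U" using e W by (auto simp: V_def W'_def)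
  have za: "area (z i s) (z j s) \<noteq> 0" if "s \<in> V" "i \<noteq> j" for s i j
    using that e(2) by (auto simp: V_def W'_def)
  have zsV: "smooth_on V (\<lambda>s. z i s $ k)" for i k using smooth_on_subset[OF zs V(3)] .
  have zcV: "characteristic_vector r s (z i s)" if "s \<in> V" for i s using zc V(3) that by blast
  define \<omega> where "\<omega> i s x = character r s (z i s) x" for i s x
  have "\<exists>f. smooth_on V f \<and> (\<forall>s\<in>V. pd 1 f s = \<omega> i s (axis 1 1) \<and> pd 2 f s = \<omega> i s (axis 2 1))" for i
    unfolding V_def
  proof (rule poincare)
    show "smooth_on (ball s0 e) (\<lambda>s. \<omega> i s (axis 1 1))" "smooth_on (ball s0 e) (\<lambda>s. \<omega> i s (axis 2 1))"
      unfolding \<omega>_def V_def[symmetric]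
      by (rule smooth_on_character[OF S flat V(1,4) zsV nz[OF zcV]]; assumption)+
    fix s assume "s \<in> ball s0 e"
    then have s: "s \<in> V" by (simp add: V_def)
    consider "i = 1" | "i = 2" | "i = 3" using exhaust_3[of i] by blast
    then obtain j k where ijk: "i \<noteq> j" "j \<noteq> k" "i \<noteq> k"
    proof cases
      case 1
      then show ?thesis using that[of 2 3] by simp
    next
      case 2
      then show ?thesis using that[of 1 3] by simp
    next
      case 3
      then show ?thesis using that[of 1 2] by simp
    qed
    show "pd 1 (\<lambda>s. \<omega> i s (axis 2 1)) s = pd 2 (\<lambda>s. \<omega> i s (axis 1 1)) s"
      unfolding \<omega>_def
      by (rule pd_character[OF S flat V(1,4) s zsV zcV zcV[OF s, of j] zcV[OF s, of k]
            za[OF s ijk(1)] za[OF s ijk(2)] za[OF s ijk(3)]])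
  qed
  then obtain f where f: "\<And>i. smooth_on V (f i)"
    "\<And>i s. s \<in> V \<Longrightarrow> pd 1 (f i) s = \<omega> i s (axis 1 1)"
    "\<And>i s. s \<in> V \<Longrightarrow> pd 2 (f i) s = \<omega> i s (axis 2 1)" by metis
  have lin: "\<omega> i s (x *\<^sub>R y + x' *\<^sub>R y') = x * \<omega> i s y + x' * \<omega> i s y'" if "s \<in> V" for i s x y x' y'
    unfolding \<omega>_def by (rule character_linear[OF S flat]) (use V that in blast)
  have df: "(f i has_derivative \<omega> i s) (at s)" if s: "s \<in> V" for i s
  proof (rule has_derivative_eq_rhs[OF has_derivative_pd[OF smooth_on_differentiable[OF f(1) s]]])
    have "\<omega> i s h = h $ 1 *\<^sub>R pd 1 (f i) s + h $ 2 *\<^sub>R pd 2 (f i) s" for h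
    proof -
      have "h = h $ 1 *\<^sub>R axis 1 1 + h $ 2 *\<^sub>R axis 2 1"
        by (simp add: vec_eq_iff forall_2 axis_def)
      then have "\<omega> i s h = \<omega> i s (h $ 1 *\<^sub>R axis 1 1 + h $ 2 *\<^sub>R axis 2 1)" by simp
      then show ?thesis unfolding lin[OF s] f(2,3)[OF s] by simp
    qed
    then show "(\<lambda>h. h $ 1 *\<^sub>R pd 1 (f i) s + h $ 2 *\<^sub>R pd 2 (f i) s) = \<omega> i s"
      by (simp add: fun_eq_iff)
  qed
  \<comment> \<open>Both characters have the value \<open>c (z k s)\<close> on the third field,
    while they differ on \<open>z i s\<close> by \<open>lam_self\<close>; the kernel is therefore
    exactly one line.\<close>
  have ker: "ker_differential (\<lambda>s. f i s - f j s) s = span {z k s}"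
    if s: "s \<in> V" and ijk: "i \<noteq> j" "j \<noteq> k" "i \<noteq> k" for i j k s
  proof -
    have sU: "s \<in> U" using s V by blast
    interpret tangent_algebra "tangent_mult r s" "metric_form (ca_metric r) s"
      by (rule tangent_algebra_ca[OF S flat sU])
    have cv: "char_vec (z i s)" for i using zcV[OF s] char_vec_iff[OF S flat sU] by simp
    define \<theta> where "\<theta> x = \<omega> i s x - \<omega> j s x" for x
    have "frechet_derivative (\<lambda>s. f i s - f j s) (at s) = \<theta>"
      unfolding \<theta>_def[abs_def]
      by (rule frechet_derivative_at[OF has_derivative_diff[OF df[OF s] df[OF s]], symmetric])
    then have K: "ker_differential (\<lambda>s. f i s - f j s) s = {x. \<theta> x = 0}"
      by (simp add: ker_differential_def)
    have other: "\<omega> a s (z b s) = c (z b s)" if "a \<noteq> b" for a b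
      unfolding \<omega>_def character_def by (rule lam_other[OF cv cv za[OF s that]])
    have 1: "\<theta> (z k s) = 0" unfolding \<theta>_def other[OF ijk(2)] other[OF ijk(3)] by simp
    have "\<omega> i s (z i s) \<noteq> c (z i s)"
      unfolding \<omega>_def character_def
      by (rule lam_self[OF cv cv cv za[OF s ijk(1)] za[OF s ijk(2)] za[OF s ijk(3)]])
    then have 2: "\<theta> (z i s) \<noteq> 0" unfolding \<theta>_def other[OF ijk(1)[symmetric]] by simp
    have \<theta>l: "\<theta> (x *\<^sub>R y + x' *\<^sub>R y') = x * \<theta> y + x' * \<theta> y'" for x y x' y'
      unfolding \<theta>_def lin[OF s] by (simp add: algebra_simps)
    have a: "area (z k s) (z i s) \<noteq> 0" by (rule za[OF s ijk(3)[symmetric]])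
    have "\<theta> x = 0 \<longleftrightarrow> x \<in> span {z k s}" for x
    proof
      assume 0: "\<theta> x = 0"
      obtain p q where x: "x = p *\<^sub>R z k s + q *\<^sub>R z i s" using area_basis[OF a] by blast
      have "q * \<theta> (z i s) = 0" using 0 unfolding x \<theta>l 1 by simp
      then have "q = 0" using 2 by simp
      then show "x \<in> span {z k s}" unfolding x by (simp add: span_base span_scale)
    next
      assume "x \<in> span {z k s}"
      then obtain p where x: "x = p *\<^sub>R z k s + 0 *\<^sub>R z k s" by (auto simp: span_singleton)
      show "\<theta> x = 0" unfolding x \<theta>l 1 by simp
    qed
    then show ?thesis unfolding K by (simp only: Collect_mem_eq)
  qed
  define L where "L i s = span {z i s}" for i s
  have dist: "L i s \<noteq> L j s" if "s \<in> V" "i \<noteq> j" for i j s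
    unfolding L_def span_eq_iff_area[OF nz[OF zcV[OF that(1)]] nz[OF zcV[OF that(1)]]] by (rule za[OF that])
  have hex: "hexagonal V L"
  proof (rule hexagonalI[where f = f, OF V(1) f(1)])
    fix s assume s: "s \<in> V"
    show "L 1 s = ker_differential (\<lambda>s. f 2 s - f 3 s) s" "L 2 s = ker_differential (\<lambda>s. f 1 s - f 3 s) s"
      "L 3 s = ker_differential (\<lambda>s. f 2 s - f 1 s) s"
      unfolding L_def by (rule ker[OF s, symmetric]; simp)+
    show "\<exists>v. v \<noteq> 0 \<and> L i s = span {v}" for i using nz[OF zcV[OF s]] by (auto simp: L_def)
  qed (rule dist)
  moreover have "characteristic_web r V L"
    unfolding characteristic_web_def
  proof
    show "three_web V L" using hex by (simp add: hexagonal_def)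
    show "\<forall>s\<in>V. characteristic_directions r s = range (\<lambda>i. L i s)"
    proof
      fix s assume s: "s \<in> V"
      then have sU: "s \<in> U" using V by blast
      interpret tangent_algebra "tangent_mult r s" "metric_form (ca_metric r) s"
        by (rule tangent_algebra_ca[OF S flat sU])
      note ci = char_vec_iff[OF S flat sU]
      have cv: "char_vec (z i s)" for i using zcV[OF s] ci by simp
      \<comment> \<open>Completeness of the web: at nearby points no characteristic direction
        appears besides the three continued from \<open>s0\<close>.\<close>
      have "\<exists>i. span {v} = L i s" if v: "characteristic_vector r s v" for v
      proof -
        have "area v (z 1 s) = 0 \<or> area v (z 2 s) = 0 \<or> area v (z 3 s) = 0"
          using v ci
          by (intro char_vec_at_most_three[OF cv cv cv za[OF s] za[OF s] za[OF s]]) simp_all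
        then show ?thesis
          unfolding L_def span_eq_iff_area[OF nz[OF v] nz[OF zcV[OF s]]] by blast
      qed
      then show "characteristic_directions r s = range (\<lambda>i. L i s)"
        unfolding characteristic_directions_def L_def using zcV[OF s] by blast
    qed
  qed
  ultimately show ?thesis using V by blast
qed

end
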